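(* Assume that the Gram matrix $\mathcal{G}_A$ is invertible and Hermitian, that, if $m\geq 2$, $$[\mathcal{G}_A]_{\sigma,m-1;\sigma' m}=[\mathcal{G}_A]_{\sigma m;\sigma',m-1}\quad\text{for all }\sigma,\sigma'\in\mathcal{S},$$ and that $\mathcal{G}^{\min}_A$ is positive definite. Define $\Gamma'=(\Gamma'_0,\Gamma'_1)\colon B_{\max}\to\mathbb{C}^{d}\times\mathbb{C}^d$ by $$\Gamma'_0\widehat f:=c,\qquad \Gamma'_1\widehat f:=\langle\varphi,f^\#\rangle-\mathcal{G}^{\min}_A\chi$$ for $\widehat f=(f,f')\in B_{\max}$, that is, for $$f=f^\#+h_{m+1}(c)+h_m(\chi),\quad f'=L_mf^\#+z_1h_{m+1}(c)+\widetilde k+k_\perp,$$ with $f^\#\in\mathfrak{H}_{m+2}$, $c,\chi\in\mathbb{C}^d$, $\widetilde k\in\mathfrak{K}_A$, $k_\perp\in\mathcal{H}_A^\perp$, $d(\widetilde k)=\mathfrak{M}_d\eta(\chi)+\eta(c)$. Then $(\mathbb{C}^d,\Gamma'_0,\Gamma'_1)$ is a boundary triple for $B_{\max}$. The corresponding $\gamma$-field $\gamma_{\Gamma'}$ and Weyl function $M_{\Gamma'}$ are bounded analytic operator functions given, for $z\in\operatorname{res}L\cap\operatorname{res}\hat\Delta$, by $$\gamma_{\Gamma'}(z)\mathbb{C}^d=\ker(B_{\max}-z)=\{(L-z)^{-1}h_m(c)+h_m(\chi)\mid \chi=(z-\hat\Delta)^{-1}c,\ c\in\mathbb{C}^d\}$$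 and $$M_{\Gamma'}(z)=q(z)+\hat r(z),\qquad \hat r(z):=\mathcal{G}^{\min}_A(\hat\Delta-z)^{-1},$$ where $\hat\Delta:=(\mathcal{G}^{\min}_A)^{-1}\Delta$ and $\Delta=(\Delta_{\sigma\sigma'})=\Delta^*$ is the $d\times d$ matrix $$\Delta_{\sigma\sigma'}:=[\mathcal{G}_A\mathfrak{M}_d]_{\sigma m,\sigma' m}=z_1[\mathcal{G}^{\min}_A]_{\sigma\sigma'}+\begin{cases}[\mathcal{G}_A]_{\sigma,m-1;\sigma' m}, & m\ge2,\\ 0,& m=1.\end{cases}$$ Moreover, $M_{\Gamma'}$ is a uniformly strict Nevanlinna function.
   Context: Setting. $L$ is a lower semibounded self-adjoint operator in a Hilbert space $\mathfrak{H}_0$; scalar products are conjugate linear in the first factor; $\operatorname{res}$ denotes the resolvent set. Fix a real $z_1\in\operatorname{res}L$ lying strictly below the spectrum of $L$ and put $b_n(L):=(L-z_1)^n$. $(\mathfrak{H}_n)_{n\in\mathbb{Z}}$ is the scale of Hilbert spaces of $L$ with $\langle\cdot,\cdot\rangle_n:=\langle b_n(L)^{1/2}\cdot,b_n(L)^{1/2}\cdot\rangle_0$ ($\mathfrak{H}_n=\operatorname{dom}(L-z_1)^{n/2}$ for $n\ge0$, completion of $\mathfrak{H}_0$ for $n<0$). $L$ acts from $\mathfrak{H}_{n+2}$ to $\mathfrak{H}_n$ for all $n$; as an operator in $\mathfrak{H}_n$ with domain $\mathfrak{H}_{n+2}$ it is self-adjoint, is denoted $L_n$ (or just $L$), and $\operatorname{res}L_n=\operatorname{res}L$.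 $\langle\cdot,\cdot\rangle$ is the duality pairing between $\mathfrak{H}_{-n}$ and $\mathfrak{H}_n$ induced by $\langle\cdot,\cdot\rangle_0$. Fix $m,d\in\mathbb{N}=\{1,2,\dots\}$, an index set $\mathcal{S}$ with $d$ elements, $J:=\{1,\dots,m\}$, and functionals $\varphi_\sigma\in\mathfrak{H}_{-m-2}\setminus\mathfrak{H}_{-m-1}$ ($\sigma\in\mathcal{S}$) that are linearly independent modulo $\mathfrak{H}_{-m-1}$. Put $\langle\varphi,f\rangle:=(\langle\varphi_\sigma,f\rangle)_\sigma\in\mathbb{C}^d$ for $f\in\mathfrak{H}_{m+2}$; $h_{\sigma j}:=b_j(L)^{-1}\varphi_\sigma\in\mathfrak{H}_{-m-2+2j}\setminus\mathfrak{H}_{-m-1+2j}$ for $j\in\{1,\dots,m+1\}$; $h_m(c):=\sum_\sigma c_\sigma h_{\sigma m}$, $h_{m+1}(c):=\sum_\sigma c_\sigma h_{\sigma,m+1}$ for $c\in\mathbb{C}^d$. $\mathfrak{K}_A:=\operatorname{span}\{h_{\sigma j}\mid(\sigma,j)\in\mathcal{S}\times J\}$ has dimension $md$; for $k\in\mathfrak{K}_A$, $d(k)=(d_{\sigma j}(k))\in\mathbb{C}^{md}$ is its coordinate vector, $k=\sum d_{\sigma j}(k)h_{\sigma j}$. $\mathfrak{K}^{\min}_A:=\mathfrak{K}_A\cap\mathfrak{H}_{m-2}=h_m(\mathbb{C}^d)$, and $d(h_m(c))=\eta(c):=(\delta_{jm}c_\sigma)_{\sigma j}$. $\mathcal{G}_A=([\mathcal{G}_A]_{\sigma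 j,\sigma'j'})$ is an invertible Hermitian $md\times md$ matrix; $\mathcal{H}_A:=\mathfrak{H}_m\dotplus\mathfrak{K}_A$ (direct sum, with the Hilbert sum topology, $\mathfrak{K}_A$ finite-dimensional) has the indefinite inner product $[f+k,f'+k']_A:=\langle f,f'\rangle_m+\langle d(k),\mathcal{G}_Ad(k')\rangle_{\mathbb{C}^{md}}$. Put $[\mathcal{G}_Ad(k)]_m:=([\mathcal{G}_Ad(k)]_{\sigma m})_\sigma\in\mathbb{C}^d$ and $[\mathcal{G}^{\min}_A]_{\sigma\sigma'}:=[\mathcal{G}_A]_{\sigma m,\sigma'm}$ (a $d\times d$ matrix). $\mathcal{H}^{\min}_A:=\mathfrak{H}_m\dotplus\mathfrak{K}^{\min}_A\subseteq\mathcal{H}_A$, and $\mathcal{H}^\perp_A$ is the $[\cdot,\cdot]_A$-orthogonal complement of $\mathcal{H}^{\min}_A$ in $\mathcal{H}_A$. $\mathfrak{M}$ is the $m\times m$ matrix with $z_1$ on the diagonal, $1$ on the first superdiagonal ($\mathfrak{M}_{j,j+1}=1$) and $0$ elsewhere; $[\mathfrak{M}_d]_{\sigma j,\sigma'j'}:=\delta_{\sigma\sigma'}\mathfrak{M}_{jj'}$. The operator $A_{\max}$ in $\mathcal{H}_A$ is $$A_{\max}=\{(f^\#+h_{m+1}(c)+k,\ L_mf^\#+z_1h_{m+1}(c)+\widetilde k)\mid f^\#\in\mathfrak{H}_{m+2},\ c\in\mathbb{C}^d,\ k,\widetilde k\in\mathfrak{K}_A,\ d(\widetilde k)=\mathfrak{M}_dd(k)+\eta(c)\}.$$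 The linear relation $B_{\max}$ in $\mathcal{H}_A$ is the componentwise sum $$B_{\max}:=\big(A_{\max}\cap(\mathcal{H}^{\min}_A\times\mathcal{H}_A)\big)\,\widehat{+}\,(\{0\}\times\mathcal{H}^\perp_A),$$ and $B_{\min}:=B_{\max}^*$, where the adjoint of a relation $T$ is $T^*=\{(g,g')\mid[f,g']_A=[f',g]_A\ \forall(f,f')\in T\}$. The Krein $Q$-function is the $d\times d$ matrix function $[q(z)]_{\sigma\sigma'}:=(z-z_1)\langle\varphi_\sigma,(L-z)^{-1}h_{\sigma',m+1}\rangle$, $z\in\operatorname{res}L$. Boundary triple for $B_{\max}=B_{\min}^*$: $\Gamma'\colon B_{\max}\to\mathbb{C}^d\times\mathbb{C}^d$ is linear, surjective, and $[f,g']_A-[f',g]_A=\langle\Gamma'_0\widehat f,\Gamma'_1\widehat g\rangle_{\mathbb{C}^d}-\langle\Gamma'_1\widehat f,\Gamma'_0\widehat g\rangle_{\mathbb{C}^d}$ for all $\widehat f=(f,f'),\widehat g=(g,g')\in B_{\max}$. For a relation $T$, $\ker(T-z)=\{f\mid(f,zf)\in T\}$. The $\gamma$-field and Weyl function are defined by: $\gamma_{\Gamma'}(z)c=f$ and $M_{\Gamma'}(z)c=\Gamma'_1(f,zf)$, where $f\in\ker(B_{\max}-z)$ is the element with $\Gamma'_0(f,zf)=c$. A uniformly strict Nevanlinna function is a matrix function $M$ analytic on $\mathbb{C}\setminus\mathbb{R}$ with $M(z)^*=M(\bar z)$ and $\operatorname{Im}M(z)/\operatorname{Im}z$ positive definite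 (with $\operatorname{Im}M=(M-M^* )/(2i)$) for all $z\in\mathbb{C}\setminus\mathbb{R}$. *)

theory Defs
  imports "HOL-Analysis.Analysis"
begin

section \<open>Complex vector spaces, inner products on subspaces, linear relations\<close>

class complex_vector = ab_group_add +
  fixes scaleC :: "complex \<Rightarrow> 'a \<Rightarrow> 'a" (infixr "*\<^sub>C" 75)
  assumes scaleC_add_right: "a *\<^sub>C (x + y) = a *\<^sub>C x + a *\<^sub>C y"
    and scaleC_add_left: "(a + b) *\<^sub>C x = a *\<^sub>C x + b *\<^sub>C x"
    and scaleC_scaleC: "a *\<^sub>C (b *\<^sub>C x) = (a * b) *\<^sub>C x"
    and scaleC_one: "1 *\<^sub>C x = x"

global_interpretation complex_vector: vector_space "scaleC :: complex \<Rightarrow> 'a \<Rightarrow> 'a::complex_vector"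
  by standard (simp_all add: scaleC_add_right scaleC_add_left scaleC_scaleC scaleC_one)

definition ipnorm :: "('h \<Rightarrow> 'h \<Rightarrow> complex) \<Rightarrow> 'h \<Rightarrow> real"
  where "ipnorm q x = sqrt (Re (q x x))"

text \<open>A Hilbert space is a complex subspace \<open>V\<close> of an ambient vector space together with a
  function \<open>q\<close>, of which only the values on \<open>V\<close> matter.  Inner products are conjugate linear in
  the first factor.\<close>

definition hilbert_space :: "'h::complex_vector set \<Rightarrow> ('h \<Rightarrow> 'h \<Rightarrow> complex) \<Rightarrow> bool"
  where "hilbert_space V q \<longleftrightarrow>
    complex_vector.subspace V \<and>
    (\<forall>x\<in>V. \<forall>y\<in>V. \<forall>z\<in>V. q x (y + z) = q x y + q x z) \<and>
    (\<forall>x\<in>V. \<forall>y\<in>V. \<forall>a. q x (a *\<^sub>C y) = a * q x y) \<and>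
    (\<forall>x\<in>V. \<forall>y\<in>V. q x y = cnj (q y x)) \<and>
    (\<forall>x\<in>V. x \<noteq> 0 \<longrightarrow> 0 < Re (q x x)) \<and>
    (\<forall>X::nat \<Rightarrow> 'h. range X \<subseteq> V \<and> (\<forall>e>0. \<exists>N. \<forall>i\<ge>N. \<forall>k\<ge>N. ipnorm q (X i - X k) < e) \<longrightarrow>
       (\<exists>x\<in>V. (\<lambda>i. ipnorm q (X i - x)) \<longlonglongrightarrow> 0))"

text \<open>\<open>q\<close> may be indefinite here.\<close>

definition rel_adjoint :: "'h set \<Rightarrow> ('h \<Rightarrow> 'h \<Rightarrow> complex) \<Rightarrow> ('h \<times> 'h) set \<Rightarrow> ('h \<times> 'h) set"
  where "rel_adjoint V q T =
    {(g, g'). g \<in> V \<and> g' \<in> V \<and> (\<forall>(f, f')\<in>T. q f g' = q f' g)}"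

definition op_graph :: "'h set \<Rightarrow> ('h \<Rightarrow> 'h) \<Rightarrow> ('h \<times> 'h) set"
  where "op_graph D T = {(f, T f) | f. f \<in> D}"

text \<open>For the graph of an operator, \<open>T = T\<^sup>*\<close> as relations entails that the domain is dense.\<close>

definition selfadjoint_op :: "'h set \<Rightarrow> ('h \<Rightarrow> 'h \<Rightarrow> complex) \<Rightarrow> 'h set \<Rightarrow> ('h \<Rightarrow> 'h) \<Rightarrow> bool"
  where "selfadjoint_op V q D T \<longleftrightarrow> op_graph D T = rel_adjoint V q (op_graph D T)"

definition lower_semibounded :: "('h \<Rightarrow> 'h \<Rightarrow> complex) \<Rightarrow> 'h set \<Rightarrow> ('h \<Rightarrow> 'h) \<Rightarrow> bool"
  where "lower_semibounded q D T \<longleftrightarrow> (\<exists>a. \<forall>f\<in>D. a * Re (q f f) \<le> Re (q f (T f)))"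

definition resolvent_set ::
    "'h::complex_vector set \<Rightarrow> ('h \<Rightarrow> 'h \<Rightarrow> complex) \<Rightarrow> 'h set \<Rightarrow> ('h \<Rightarrow> 'h) \<Rightarrow> complex set"
  where "resolvent_set V q D T =
    {z. bij_betw (\<lambda>f. T f - z *\<^sub>C f) D V \<and>
        (\<exists>C. \<forall>f\<in>D. ipnorm q f \<le> C * ipnorm q (T f - z *\<^sub>C f))}"

definition is_positive_sqrt ::
    "'h set \<Rightarrow> ('h \<Rightarrow> 'h \<Rightarrow> complex) \<Rightarrow> ('h \<times> 'h) set \<Rightarrow> ('h \<times> 'h) set \<Rightarrow> bool"
  where "is_positive_sqrt V q T S \<longleftrightarrow>
    single_valued S \<and> S = rel_adjoint V q S \<and> (\<forall>(f, f')\<in>S. 0 \<le> Re (q f f')) \<and> S O S = T"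

text \<open>Integer powers of an injective operator in \<open>V\<close>, given by its graph \<open>S\<close>; the factor
  \<open>Id_on V\<close> only serves to make the power with exponent \<open>0\<close> the identity of \<open>V\<close>.\<close>

definition rel_zpower :: "'h set \<Rightarrow> ('h \<times> 'h) set \<Rightarrow> int \<Rightarrow> ('h \<times> 'h) set"
  where "rel_zpower V S n =
    (if 0 \<le> n then Id_on V O (S ^^ nat n) else (Id_on V O (S ^^ nat (- n)))\<inverse>)"


section \<open>The data, and the scale of Hilbert spaces of \<open>L\<close>\<close>

text \<open>All the spaces of the scale are subspaces of one ambient complex vector space \<open>'h\<close>, and
  \<open>Lop\<close> is the action of \<open>L\<close> on the whole scale.  The index set of the functionals is the finite
  type \<open>'s\<close>, so that \<open>d = CARD('s)\<close>.  Matrices of size \<open>m d\<close> are functions on pairs of indices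
  \<open>(\<sigma>, j)\<close> with \<open>1 \<le> j \<le> m\<close>; their other values play no role.\<close>

record ('h, 's) peak_data =
  Hsp :: "int \<Rightarrow> 'h set"
  ips :: "int \<Rightarrow> 'h \<Rightarrow> 'h \<Rightarrow> complex"
  Lop :: "'h \<Rightarrow> 'h"
  z1 :: real
  mm :: nat
  phi :: "'s \<Rightarrow> 'h"
  Gram :: "'s \<times> nat \<Rightarrow> 's \<times> nat \<Rightarrow> complex"

abbreviation z1c :: "('h, 's) peak_data \<Rightarrow> complex"
  where "z1c P \<equiv> complex_of_real (z1 P)"

abbreviation hnorm :: "('h, 's) peak_data \<Rightarrow> int \<Rightarrow> 'h \<Rightarrow> real"
  where "hnorm P n \<equiv> ipnorm (ips P n)"

text \<open>The domain of \<open>L\<close> in \<open>\<HH>\<^sub>0\<close> is \<open>\<HH>\<^sub>2\<close>.\<close>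

definition res_L :: "('h::complex_vector, 's) peak_data \<Rightarrow> complex set"
  where "res_L P = resolvent_set (Hsp P 0) (ips P 0) (Hsp P 2) (Lop P)"

text \<open>\<open>S\<close> is \<open>(L - z\<^sub>1)\<^sup>1\<^sup>/\<^sup>2\<close>, and \<open>rel_zpower _ S n\<close> is \<open>b\<^sub>n(L)\<^sup>1\<^sup>/\<^sup>2\<close> as an operator in \<open>\<HH>\<^sub>0\<close>.
  For \<open>n \<ge> 0\<close> the space \<open>\<HH>\<^sub>n\<close> is its domain.  For \<open>n < 0\<close> it is a completion of \<open>\<HH>\<^sub>0\<close>, where
  the continuous inclusions \<open>\<HH>\<^sub>n\<^sub>+\<^sub>1 \<subseteq> \<HH>\<^sub>n\<close> fix how the completions lie in each other.  The last
  clause says that \<open>Lop\<close> is, for \<open>n < 0\<close>, the continuous extension of \<open>L\<close> to an operator from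
  \<open>\<HH>\<^sub>n\<^sub>+\<^sub>2\<close> to \<open>\<HH>\<^sub>n\<close>.\<close>

definition is_hilbert_scale :: "('h::complex_vector, 's) peak_data \<Rightarrow> bool"
  where "is_hilbert_scale P \<longleftrightarrow>
    (\<exists>S. is_positive_sqrt (Hsp P 0) (ips P 0)
            (op_graph (Hsp P 2) (\<lambda>f. Lop P f - z1c P *\<^sub>C f)) S \<and>
       (\<forall>n\<ge>0. Hsp P n = Domain (rel_zpower (Hsp P 0) S n)) \<and>
       (\<forall>n. \<forall>(f, f')\<in>rel_zpower (Hsp P 0) S n. \<forall>(g, g')\<in>rel_zpower (Hsp P 0) S n.
          ips P n f g = ips P 0 f' g')) \<and>
    (\<forall>n<0. hilbert_space (Hsp P n) (ips P n) \<and>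
       Hsp P (n + 1) \<subseteq> Hsp P n \<and>
       (\<exists>C. \<forall>f\<in>Hsp P (n + 1). hnorm P n f \<le> C * hnorm P (n + 1) f) \<and>
       (\<forall>f\<in>Hsp P n. \<forall>e>0. \<exists>g\<in>Hsp P 0. hnorm P n (f - g) < e)) \<and>
    (\<forall>n. (\<forall>f\<in>Hsp P (n + 2). Lop P f \<in> Hsp P n) \<and>
       (\<forall>f\<in>Hsp P (n + 2). \<forall>g\<in>Hsp P (n + 2). Lop P (f + g) = Lop P f + Lop P g) \<and>
       (\<forall>f\<in>Hsp P (n + 2). \<forall>a. Lop P (a *\<^sub>C f) = a *\<^sub>C Lop P f) \<and>
       (\<exists>C. \<forall>f\<in>Hsp P (n + 2). hnorm P n (Lop P f) \<le> C * hnorm P (n + 2) f))"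

text \<open>The value at \<open>g\<close> of the resolvent \<open>(L - z)\<^sup>-\<^sup>1\<close>, acting on the whole scale.\<close>

definition resolv :: "('h::complex_vector, 's) peak_data \<Rightarrow> complex \<Rightarrow> 'h \<Rightarrow> 'h"
  where "resolv P z = the_inv_into (\<Union>n. Hsp P n) (\<lambda>f. Lop P f - z *\<^sub>C f)"

text \<open>\<open>b\<^sub>j(L) = (L - z\<^sub>1)\<^sup>j\<close>, acting on the whole scale.\<close>

definition b_op :: "('h::complex_vector, 's) peak_data \<Rightarrow> nat \<Rightarrow> 'h \<Rightarrow> 'h"
  where "b_op P j = (\<lambda>f. Lop P f - z1c P *\<^sub>C f) ^^ j"

text \<open>The duality pairing between \<open>\<HH>\<^sub>-\<^sub>n\<close> and \<open>\<HH>\<^sub>n\<close> (\<open>n \<ge> 0\<close>) is the continuous extension of the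
  inner product of \<open>\<HH>\<^sub>0\<close> in the first argument.\<close>

definition duality :: "('h::complex_vector, 's) peak_data \<Rightarrow> int \<Rightarrow> 'h \<Rightarrow> 'h \<Rightarrow> complex"
  where "duality P n u f = (THE a. \<forall>X::nat \<Rightarrow> 'h.
    range X \<subseteq> Hsp P 0 \<and> (\<lambda>i. hnorm P (- n) (X i - u)) \<longlonglongrightarrow> 0 \<longrightarrow>
    (\<lambda>i. ips P 0 (X i) f) \<longlonglongrightarrow> a)"


section \<open>The functionals and the space \<open>\<K>\<^sub>A\<close>\<close>

definition phi_vec :: "('h::complex_vector, 's::finite) peak_data \<Rightarrow> 'h \<Rightarrow> complex^'s"
  where "phi_vec P f = (\<chi> \<sigma>. duality P (int (mm P) + 2) (phi P \<sigma>) f)"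

definition hvec :: "('h::complex_vector, 's) peak_data \<Rightarrow> 's \<Rightarrow> nat \<Rightarrow> 'h"
  where "hvec P \<sigma> j = the_inv_into (\<Union>n. Hsp P n) (b_op P j) (phi P \<sigma>)"

definition hsum :: "('h::complex_vector, 's::finite) peak_data \<Rightarrow> nat \<Rightarrow> complex^'s \<Rightarrow> 'h"
  where "hsum P j c = (\<Sum>\<sigma>\<in>UNIV. (c $ \<sigma>) *\<^sub>C hvec P \<sigma> j)"

definition idx :: "('h, 's) peak_data \<Rightarrow> ('s \<times> nat) set"
  where "idx P = UNIV \<times> {1..mm P}"

definition K_A :: "('h::complex_vector, 's) peak_data \<Rightarrow> 'h set"
  where "K_A P = complex_vector.span {hvec P \<sigma> j | \<sigma> j. (\<sigma>, j) \<in> idx P}"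

definition K_min :: "('h::complex_vector, 's) peak_data \<Rightarrow> 'h set"
  where "K_min P = K_A P \<inter> Hsp P (int (mm P) - 2)"

definition dcoord :: "('h::complex_vector, 's::finite) peak_data \<Rightarrow> 'h \<Rightarrow> 's \<times> nat \<Rightarrow> complex"
  where "dcoord P k = (THE a. (\<forall>i. i \<notin> idx P \<longrightarrow> a i = 0) \<and>
    k = (\<Sum>(\<sigma>, j)\<in>idx P. a (\<sigma>, j) *\<^sub>C hvec P \<sigma> j))"

definition eta :: "('h, 's::finite) peak_data \<Rightarrow> complex^'s \<Rightarrow> 's \<times> nat \<Rightarrow> complex"
  where "eta P c = (\<lambda>(\<sigma>, j). if j = mm P then c $ \<sigma> else 0)"


section \<open>The space \<open>\<H>\<^sub>A\<close> with its indefinite inner product\<close>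

definition H_A :: "('h::complex_vector, 's) peak_data \<Rightarrow> 'h set"
  where "H_A P = {f + k | f k. f \<in> Hsp P (int (mm P)) \<and> k \<in> K_A P}"

text \<open>The components of \<open>u \<in> \<H>\<^sub>A\<close> in the direct sum of \<open>\<HH>\<^sub>m\<close> and \<open>\<K>\<^sub>A\<close>.\<close>

definition regular_part :: "('h::complex_vector, 's) peak_data \<Rightarrow> 'h \<Rightarrow> 'h"
  where "regular_part P u = (THE f. f \<in> Hsp P (int (mm P)) \<and> (\<exists>k\<in>K_A P. u = f + k))"

definition singular_part :: "('h::complex_vector, 's) peak_data \<Rightarrow> 'h \<Rightarrow> 'h"
  where "singular_part P u = (THE k. k \<in> K_A P \<and> (\<exists>f\<in>Hsp P (int (mm P)). u = f + k))"

definition ip_A :: "('h::complex_vector, 's::finite) peak_data \<Rightarrow> 'h \<Rightarrow> 'h \<Rightarrow> complex"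
  where "ip_A P u v =
    ips P (int (mm P)) (regular_part P u) (regular_part P v) +
    (\<Sum>i\<in>idx P. \<Sum>k\<in>idx P.
       cnj (dcoord P (singular_part P u) i) * Gram P i k * dcoord P (singular_part P v) k)"

text \<open>The norm of the Hilbert sum of \<open>\<HH>\<^sub>m\<close> and \<open>\<K>\<^sub>A\<close>, which defines the topology of \<open>\<H>\<^sub>A\<close>.\<close>

definition norm_A :: "('h::complex_vector, 's::finite) peak_data \<Rightarrow> 'h \<Rightarrow> real"
  where "norm_A P u = sqrt ((hnorm P (int (mm P)) (regular_part P u))\<^sup>2 +
    (\<Sum>i\<in>idx P. (cmod (dcoord P (singular_part P u) i))\<^sup>2))"

definition H_min :: "('h::complex_vector, 's) peak_data \<Rightarrow> 'h set"
  where "H_min P = {f + k | f k. f \<in> Hsp P (int (mm P)) \<and> k \<in> K_min P}"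

definition H_perp :: "('h::complex_vector, 's::finite) peak_data \<Rightarrow> 'h set"
  where "H_perp P = {u \<in> H_A P. \<forall>v\<in>H_min P. ip_A P v u = 0}"


section \<open>Matrices\<close>

definition hermitian_on :: "'i set \<Rightarrow> ('i \<Rightarrow> 'i \<Rightarrow> complex) \<Rightarrow> bool"
  where "hermitian_on I A \<longleftrightarrow> (\<forall>i\<in>I. \<forall>k\<in>I. A i k = cnj (A k i))"

definition invertible_on :: "'i set \<Rightarrow> ('i \<Rightarrow> 'i \<Rightarrow> complex) \<Rightarrow> bool"
  where "invertible_on I A \<longleftrightarrow> (\<exists>B. \<forall>i\<in>I. \<forall>k\<in>I.
    (\<Sum>j\<in>I. A i j * B j k) = (if i = k then 1 else 0) \<and>
    (\<Sum>j\<in>I. B i j * A j k) = (if i = k then 1 else 0))"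

definition cdot :: "complex^'s \<Rightarrow> complex^'s \<Rightarrow> complex"
  where "cdot a b = (\<Sum>\<sigma>\<in>UNIV. cnj (a $ \<sigma>) * b $ \<sigma>)"

definition cadj :: "complex^'s^'s \<Rightarrow> complex^'s^'s"
  where "cadj A = (\<chi> \<sigma> \<tau>. cnj (A $ \<tau> $ \<sigma>))"

definition positive_definite :: "complex^'s^'s \<Rightarrow> bool"
  where "positive_definite A \<longleftrightarrow>
    (\<forall>x. x \<noteq> 0 \<longrightarrow> Im (cdot x (A *v x)) = 0 \<and> 0 < Re (cdot x (A *v x)))"

definition matrix_res :: "complex^'s^'s \<Rightarrow> complex set"
  where "matrix_res A = {z. invertible (A - mat z)}"

definition M_d :: "('h, 's) peak_data \<Rightarrow> 's \<times> nat \<Rightarrow> 's \<times> nat \<Rightarrow> complex"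
  where "M_d P = (\<lambda>(\<sigma>, i) (\<tau>, j). if \<sigma> = \<tau>
    then (if i = j then z1c P else if j = i + 1 then 1 else 0) else 0)"

definition G_min :: "('h, 's::finite) peak_data \<Rightarrow> complex^'s^'s"
  where "G_min P = (\<chi> \<sigma> \<tau>. Gram P (\<sigma>, mm P) (\<tau>, mm P))"

definition Delta :: "('h, 's::finite) peak_data \<Rightarrow> complex^'s^'s"
  where "Delta P = (\<chi> \<sigma> \<tau>. \<Sum>i\<in>idx P. Gram P (\<sigma>, mm P) i * M_d P i (\<tau>, mm P))"

definition Delta_hat :: "('h, 's::finite) peak_data \<Rightarrow> complex^'s^'s"
  where "Delta_hat P = matrix_inv (G_min P) ** Delta P"

definition q_fun :: "('h::complex_vector, 's::finite) peak_data \<Rightarrow> complex \<Rightarrow> complex^'s^'s"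
  where "q_fun P z = (\<chi> \<sigma> \<tau>. (z - z1c P) *
    duality P (int (mm P) + 2) (phi P \<sigma>) (resolv P z (hvec P \<tau> (mm P + 1))))"

definition r_hat :: "('h, 's::finite) peak_data \<Rightarrow> complex \<Rightarrow> complex^'s^'s"
  where "r_hat P z = G_min P ** matrix_inv (Delta_hat P - mat z)"


section \<open>The relations \<open>A_max\<close>, \<open>B_max\<close> and \<open>B_min\<close>\<close>

definition A_max :: "('h::complex_vector, 's::finite) peak_data \<Rightarrow> ('h \<times> 'h) set"
  where "A_max P =
    {(fs + hsum P (mm P + 1) c + k, Lop P fs + z1c P *\<^sub>C hsum P (mm P + 1) c + k') | fs c k k'.
       fs \<in> Hsp P (int (mm P) + 2) \<and> k \<in> K_A P \<and> k' \<in> K_A P \<and>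
       (\<forall>i\<in>idx P. dcoord P k' i = (\<Sum>l\<in>idx P. M_d P i l * dcoord P k l) + eta P c i)}"

definition cw_sum :: "('h::plus \<times> 'h) set \<Rightarrow> ('h \<times> 'h) set \<Rightarrow> ('h \<times> 'h) set"
  where "cw_sum S T = {(f + g, f' + g') | f f' g g'. (f, f') \<in> S \<and> (g, g') \<in> T}"

definition B_max :: "('h::complex_vector, 's::finite) peak_data \<Rightarrow> ('h \<times> 'h) set"
  where "B_max P = cw_sum (A_max P \<inter> (H_min P \<times> H_A P)) ({0} \<times> H_perp P)"

definition B_min :: "('h::complex_vector, 's::finite) peak_data \<Rightarrow> ('h \<times> 'h) set"
  where "B_min P = rel_adjoint (H_A P) (ip_A P) (B_max P)"

definition B_repr :: "('h::complex_vector, 's::finite) peak_data \<Rightarrow> 'h \<times> 'h \<Rightarrow>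
    'h \<Rightarrow> complex^'s \<Rightarrow> complex^'s \<Rightarrow> 'h \<Rightarrow> 'h \<Rightarrow> bool"
  where "B_repr P fh fs c x k' kp \<longleftrightarrow>
    fs \<in> Hsp P (int (mm P) + 2) \<and> k' \<in> K_A P \<and> kp \<in> H_perp P \<and>
    (\<forall>i\<in>idx P. dcoord P k' i = (\<Sum>l\<in>idx P. M_d P i l * eta P x l) + eta P c i) \<and>
    fh = (fs + hsum P (mm P + 1) c + hsum P (mm P) x,
          Lop P fs + z1c P *\<^sub>C hsum P (mm P + 1) c + k' + kp)"

definition Gamma0 :: "('h::complex_vector, 's::finite) peak_data \<Rightarrow> 'h \<times> 'h \<Rightarrow> complex^'s"
  where "Gamma0 P fh = (THE v. \<exists>fs c x k' kp. B_repr P fh fs c x k' kp \<and> v = c)"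

definition Gamma1 :: "('h::complex_vector, 's::finite) peak_data \<Rightarrow> 'h \<times> 'h \<Rightarrow> complex^'s"
  where "Gamma1 P fh = (THE v. \<exists>fs c x k' kp. B_repr P fh fs c x k' kp \<and>
    v = phi_vec P fs - G_min P *v x)"


section \<open>Boundary triples, gamma-fields, Weyl functions\<close>

definition ker_rel :: "('h::complex_vector \<times> 'h) set \<Rightarrow> complex \<Rightarrow> 'h set"
  where "ker_rel T z = {f. (f, z *\<^sub>C f) \<in> T}"

text \<open>A boundary triple for the relation \<open>B = T\<^sup>*\<close> in the inner product space \<open>(V, q)\<close>.\<close>

definition boundary_triple :: "'h::complex_vector set \<Rightarrow> ('h \<Rightarrow> 'h \<Rightarrow> complex) \<Rightarrow>
    ('h \<times> 'h) set \<Rightarrow> ('h \<times> 'h) set \<Rightarrow>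
    ('h \<times> 'h \<Rightarrow> complex^'s) \<Rightarrow> ('h \<times> 'h \<Rightarrow> complex^'s) \<Rightarrow> bool"
  where "boundary_triple V q T B \<Gamma>0 \<Gamma>1 \<longleftrightarrow>
    B = rel_adjoint V q T \<and>
    (\<forall>(f, f')\<in>B. \<forall>(g, g')\<in>B. \<forall>a b.
       (a *\<^sub>C f + b *\<^sub>C g, a *\<^sub>C f' + b *\<^sub>C g') \<in> B \<and>
       \<Gamma>0 (a *\<^sub>C f + b *\<^sub>C g, a *\<^sub>C f' + b *\<^sub>C g') = a *s \<Gamma>0 (f, f') + b *s \<Gamma>0 (g, g') \<and>
       \<Gamma>1 (a *\<^sub>C f + b *\<^sub>C g, a *\<^sub>C f' + b *\<^sub>C g') = a *s \<Gamma>1 (f, f') + b *s \<Gamma>1 (g, g')) \<and>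
    (\<lambda>fh. (\<Gamma>0 fh, \<Gamma>1 fh)) ` B = UNIV \<and>
    (\<forall>(f, f')\<in>B. \<forall>(g, g')\<in>B.
       q f g' - q f' g =
       cdot (\<Gamma>0 (f, f')) (\<Gamma>1 (g, g')) - cdot (\<Gamma>1 (f, f')) (\<Gamma>0 (g, g')))"

definition gamma_field :: "('h::complex_vector \<times> 'h) set \<Rightarrow> ('h \<times> 'h \<Rightarrow> complex^'s) \<Rightarrow>
    complex \<Rightarrow> complex^'s \<Rightarrow> 'h"
  where "gamma_field B \<Gamma>0 z c = (THE f. f \<in> ker_rel B z \<and> \<Gamma>0 (f, z *\<^sub>C f) = c)"

definition weyl_function :: "('h::complex_vector \<times> 'h) set \<Rightarrow> ('h \<times> 'h \<Rightarrow> complex^'s) \<Rightarrow>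
    ('h \<times> 'h \<Rightarrow> complex^'s) \<Rightarrow> complex \<Rightarrow> complex^'s \<Rightarrow> complex^'s"
  where "weyl_function B \<Gamma>0 \<Gamma>1 z c =
    \<Gamma>1 (gamma_field B \<Gamma>0 z c, z *\<^sub>C gamma_field B \<Gamma>0 z c)"

text \<open>Bounded operators from \<open>\<complex>\<^sup>d\<close> to a normed space \<open>(V, nrm)\<close> with scalar multiplication \<open>scl\<close>,
  and functions whose values are such operators and which are complex differentiable with respect to
  the operator norm at all points of an open set.\<close>

definition bounded_operator :: "(complex \<Rightarrow> 'b \<Rightarrow> 'b) \<Rightarrow> 'b set \<Rightarrow> ('b \<Rightarrow> real) \<Rightarrow>
    (complex^'s \<Rightarrow> 'b::ab_group_add) \<Rightarrow> bool"
  where "bounded_operator scl V nrm T \<longleftrightarrow>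
    Vector_Spaces.linear (*s) scl T \<and> range T \<subseteq> V \<and> (\<exists>C. \<forall>c. nrm (T c) \<le> C * norm c)"

definition bounded_analytic_on :: "(complex \<Rightarrow> 'b \<Rightarrow> 'b) \<Rightarrow> 'b set \<Rightarrow> ('b \<Rightarrow> real) \<Rightarrow>
    (complex \<Rightarrow> complex^'s \<Rightarrow> 'b::ab_group_add) \<Rightarrow> complex set \<Rightarrow> bool"
  where "bounded_analytic_on scl V nrm T \<Omega> \<longleftrightarrow>
    open \<Omega> \<and>
    (\<forall>z\<in>\<Omega>. bounded_operator scl V nrm (T z)) \<and>
    (\<forall>z\<in>\<Omega>. \<exists>D. bounded_operator scl V nrm D \<and>
       (\<forall>e>0. \<exists>\<delta>>0. \<forall>w\<in>\<Omega>. cmod (w - z) < \<delta> \<longrightarrow>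
          (\<forall>c. nrm (T w c - T z c - scl (w - z) (D c)) \<le> e * cmod (w - z) * norm c)))"

definition uniformly_strict_nevanlinna :: "(complex \<Rightarrow> complex^'s^'s) \<Rightarrow> bool"
  where "uniformly_strict_nevanlinna M \<longleftrightarrow>
    (\<forall>\<sigma> \<tau>. (\<lambda>z. M z $ \<sigma> $ \<tau>) analytic_on - \<real>) \<and>
    (\<forall>z. z \<notin> \<real> \<longrightarrow> cadj (M z) = M (cnj z) \<and>
       positive_definite (\<chi> \<sigma> \<tau>. (M z - cadj (M z)) $ \<sigma> $ \<tau> / (2 * \<i>) / complex_of_real (Im z)))"

end

theory Submission
  imports Defs
begin

text \<open>Let \<open>T = L - z\<^sub>1\<close>, the operator \<open>A\<close> below.  On the nonnegative part of the scale everything is transported from \<open>\<HH>\<^sub>0\<close> by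
  the powers of the bounded operator \<open>T\<^sup>-\<^sup>1\<^sup>/\<^sup>2\<close>; on the negative part, \<open>T\<close> maps \<open>\<HH>\<^sub>n\<^sub>+\<^sub>2\<close> isometrically onto
  \<open>\<HH>\<^sub>n\<close> by density.  Hence \<open>h\<^sub>\<sigma>\<^sub>j\<close> has sharp regularity, so that \<open>\<K>\<^sub>A\<close> is independent modulo \<open>\<HH>\<^sub>m\<close>, and
  \<open>\<langle>\<phi>\<^sub>\<sigma>, f\<rangle> = \<langle>h\<^sub>\<sigma>\<^sub>,\<^sub>m\<^sub>+\<^sub>1, T f\<rangle>\<^sub>m\<close>, which turns Green's identity into the symmetry of \<open>T\<close> in \<open>\<HH>\<^sub>m\<close> plus that
  of \<open>\<Delta>\<close>.  The restriction of \<open>B_max\<close> to \<open>ker \<Gamma>'\<^sub>0\<close> contains its adjoint, so \<open>B_min \<subseteq> B_max\<close>, and since \<open>\<Gamma>'\<close>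
  is onto a finite-dimensional space, \<open>B_max\<close> is the adjoint of \<open>B_min\<close>.  Projecting
  \<open>(f, z f) \<in> B_max\<close> onto \<open>\<HH>\<^sub>m\<close> and onto the last block of Gram coordinates gives
  the resolvent equation for the regular part and \<open>(z - \<Delta>') \<chi> = c\<close>, with \<open>\<Delta>'\<close> the matrix \<open>Delta_hat\<close>, for the
  singular part.  The Nevanlinna property is Green's identity applied to two values of the
  \<open>\<gamma>\<close>-field, because \<open>[\<gamma>(z) c, \<gamma>(z) c]\<^sub>A > 0\<close> for \<open>c \<noteq> 0\<close>.\<close>

section \<open>Hilbert spaces given by a carrier set\<close>

text \<open>Three features of the setting shape the proof. The spaces of the scale are subsets of
  one ambient space, so the Hilbert space theory is developed for carrier sets. On negative levels
  the hypotheses give only completeness, continuity of the inclusions and of \<open>L\<close>, and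
  density of \<open>H 0\<close>, so every fact there is a limit of a fact about powers of the
  inverse root. Finally \<open>ip_A\<close> may be indefinite, so \<open>B_max\<close> cannot be
  recovered from \<open>B_min\<close> by closedness; a functional that vanishes on
  \<open>B_min\<close> is represented through the boundary maps instead. The multivalued part of
  \<open>B_max\<close> absorbs all Gram coordinates outside the last block, which is why every
  identity on \<open>K_A\<close> is read off from \<open>top_row\<close>. The invertibility of the
  whole Gram matrix enters where the other coordinates of an element of \<open>B_min\<close> are
  shown to vanish. The symmetry condition on the Gram matrix is what makes \<open>Delta\<close>
  Hermitian, and positivity of \<open>G_min\<close> makes the form positive on \<open>H_min\<close>,
  where the values of the \<open>\<gamma>\<close>-field lie.\<close>

locale hilb =
  fixes V :: "'h::complex_vector set" and q :: "'h \<Rightarrow> 'h \<Rightarrow> complex"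
  assumes hilbert: "hilbert_space V q"
begin

lemma subspace: "complex_vector.subspace V"
  using hilbert by (simp add: hilbert_space_def)

lemma zero_mem [simp]: "0 \<in> V"
  and add_mem [simp]: "x \<in> V \<Longrightarrow> y \<in> V \<Longrightarrow> x + y \<in> V"
  and diff_mem [simp]: "x \<in> V \<Longrightarrow> y \<in> V \<Longrightarrow> x - y \<in> V"
  and minus_mem [simp]: "x \<in> V \<Longrightarrow> - x \<in> V"
  and scale_mem [simp]: "x \<in> V \<Longrightarrow> a *\<^sub>C x \<in> V"
  and sum_mem: "(\<And>i. i \<in> I \<Longrightarrow> w i \<in> V) \<Longrightarrow> sum w I \<in> V"
  by (rule complex_vector.subspace_0[OF subspace] complex_vector.subspace_add[OF subspace]
      complex_vector.subspace_diff[OF subspace] complex_vector.subspace_neg[OF subspace]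
      complex_vector.subspace_scale[OF subspace] complex_vector.subspace_sum[OF subspace]; assumption)+

lemma ip_add_right: "x \<in> V \<Longrightarrow> y \<in> V \<Longrightarrow> z \<in> V \<Longrightarrow> q x (y + z) = q x y + q x z"
  and ip_scale_right: "x \<in> V \<Longrightarrow> y \<in> V \<Longrightarrow> q x (a *\<^sub>C y) = a * q x y"
  and ip_commute: "x \<in> V \<Longrightarrow> y \<in> V \<Longrightarrow> q x y = cnj (q y x)"
  and ip_pos: "x \<in> V \<Longrightarrow> x \<noteq> 0 \<Longrightarrow> 0 < Re (q x x)"
  using hilbert unfolding hilbert_space_def by blast+

lemma ip_zero_right [simp]: "x \<in> V \<Longrightarrow> q x 0 = 0"
  using ip_scale_right[of x 0 0] by simp

lemma ip_zero_left [simp]: "x \<in> V \<Longrightarrow> q 0 x = 0"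
  using ip_commute[of 0 x] by simp

lemma ip_minus_right: "x \<in> V \<Longrightarrow> y \<in> V \<Longrightarrow> q x (- y) = - q x y"
  using ip_scale_right[of x y "-1"] by simp

lemma ip_diff_right: "x \<in> V \<Longrightarrow> y \<in> V \<Longrightarrow> z \<in> V \<Longrightarrow> q x (y - z) = q x y - q x z"
  using ip_add_right[of x y "-z"] by (simp add: ip_minus_right)

lemma ip_add_left: "x \<in> V \<Longrightarrow> y \<in> V \<Longrightarrow> z \<in> V \<Longrightarrow> q (x + y) z = q x z + q y z"
  by (metis add_mem complex_cnj_add ip_add_right ip_commute)

lemma ip_scale_left: "x \<in> V \<Longrightarrow> y \<in> V \<Longrightarrow> q (a *\<^sub>C x) y = cnj a * q x y"
  by (metis complex_cnj_mult ip_commute ip_scale_right scale_mem)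

lemma ip_diff_left: "x \<in> V \<Longrightarrow> y \<in> V \<Longrightarrow> z \<in> V \<Longrightarrow> q (x - y) z = q x z - q y z"
  by (metis complex_cnj_diff diff_mem ip_commute ip_diff_right)

lemma ip_sum_left: "x \<in> V \<Longrightarrow> (\<And>i. i \<in> I \<Longrightarrow> w i \<in> V) \<Longrightarrow> q (sum w I) x = (\<Sum>i\<in>I. q (w i) x)"
proof (induction I rule: infinite_finite_induct)
  case (insert i I)
  then show ?case by (simp add: ip_add_left sum_mem)
qed auto

lemma ip_self_nonneg: "x \<in> V \<Longrightarrow> 0 \<le> Re (q x x)"
  using ip_pos[of x] by (cases "x = 0") auto

lemma norm_nonneg [simp]: "x \<in> V \<Longrightarrow> 0 \<le> ipnorm q x"
  by (simp add: ipnorm_def ip_self_nonneg)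

lemma norm_square: "x \<in> V \<Longrightarrow> (ipnorm q x)\<^sup>2 = Re (q x x)"
  by (simp add: ipnorm_def ip_self_nonneg)

lemma ip_self: "x \<in> V \<Longrightarrow> q x x = of_real ((ipnorm q x)\<^sup>2)"
  using ip_commute[of x x] by (simp add: norm_square complex_eq_iff)

lemma norm_zero [simp]: "ipnorm q 0 = 0"
  by (simp add: ipnorm_def)

lemma norm_eq_zero: "x \<in> V \<Longrightarrow> ipnorm q x = 0 \<longleftrightarrow> x = 0"
  using ip_pos[of x] by (cases "x = 0") (auto simp: ipnorm_def)

lemma norm_scale: "x \<in> V \<Longrightarrow> ipnorm q (a *\<^sub>C x) = cmod a * ipnorm q x"
proof -
  assume x: "x \<in> V"
  have "q (a *\<^sub>C x) (a *\<^sub>C x) = (cnj a * a) * q x x"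
    using x by (simp add: ip_scale_left ip_scale_right)
  also have "cnj a * a = of_real ((cmod a)\<^sup>2)"
    by (metis complex_norm_square mult.commute)
  finally have "Re (q (a *\<^sub>C x) (a *\<^sub>C x)) = (cmod a)\<^sup>2 * Re (q x x)" by simp
  then show ?thesis by (simp add: ipnorm_def real_sqrt_mult)
qed

lemma norm_minus: "x \<in> V \<Longrightarrow> ipnorm q (- x) = ipnorm q x"
  using norm_scale[of x "-1"] by simp

lemma norm_diff_commute: "x \<in> V \<Longrightarrow> y \<in> V \<Longrightarrow> ipnorm q (x - y) = ipnorm q (y - x)"
  using norm_minus[of "x - y"] by simp

text \<open>This is the residual of the projection onto the line of \<open>y\<close>. Its
  nonnegativity is the Cauchy-Schwarz inequality, and its strict decrease contradicts minimality in
  the density argument.\<close>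

lemma norm_diff_projection:
  assumes x: "x \<in> V" and y: "y \<in> V" "y \<noteq> 0"
  shows "(ipnorm q (x - (q y x / q y y) *\<^sub>C y))\<^sup>2 = (ipnorm q x)\<^sup>2 - (cmod (q y x))\<^sup>2 / (ipnorm q y)\<^sup>2"
proof -
  define N where "N = Re (q y y)"
  have N: "0 < N" using ip_pos y by (simp add: N_def)
  have qyy: "q y y = of_real N" using ip_self[OF y(1)] y by (simp add: norm_square N_def)
  define p where "p = q y x"
  have qxy: "q x y = cnj p" using ip_commute[OF x y(1)] by (simp add: p_def)
  define a where "a = p / of_real N"
  have "q (x - a *\<^sub>C y) (x - a *\<^sub>C y) = q x x - a * cnj p - cnj a * (p - a * of_real N)"
    using x y by (simp add: ip_diff_left ip_diff_right ip_scale_left ip_scale_right qyy qxy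
        flip: p_def) (simp add: algebra_simps)
  also have "\<dots> = q x x - (p * cnj p) / of_real N"
    using N by (simp add: a_def)
  also have "p * cnj p = of_real ((cmod p)\<^sup>2)"
    by (simp only: complex_norm_square)
  finally have "Re (q (x - a *\<^sub>C y) (x - a *\<^sub>C y)) = Re (q x x) - (cmod p)\<^sup>2 / N"
    by (simp flip: of_real_divide of_real_power)
  moreover have "a = q y x / q y y" "(ipnorm q y)\<^sup>2 = N"
    using y by (simp_all add: a_def p_def qyy norm_square)
  ultimately show ?thesis
    using x y by (simp add: norm_square p_def)
qed

lemma Cauchy_Schwarz:
  assumes x: "x \<in> V" and y: "y \<in> V"
  shows "cmod (q x y) \<le> ipnorm q x * ipnorm q y"
proof (cases "x = 0")
  case True
  then show ?thesis using y by simp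
next
  case False
  have "0 < (ipnorm q x)\<^sup>2" using False x by (simp add: norm_square ip_pos)
  moreover have "0 \<le> (ipnorm q y)\<^sup>2 - (cmod (q x y))\<^sup>2 / (ipnorm q x)\<^sup>2"
    unfolding norm_diff_projection[OF y x False, symmetric] by simp
  ultimately have "(cmod (q x y))\<^sup>2 \<le> (ipnorm q x * ipnorm q y)\<^sup>2"
    by (simp add: power_mult_distrib pos_divide_le_eq mult.commute)
  then show ?thesis
    using x y by (simp add: power2_le_iff_abs_le)
qed

lemma norm_triangle:
  assumes x: "x \<in> V" and y: "y \<in> V"
  shows "ipnorm q (x + y) \<le> ipnorm q x + ipnorm q y"
proof -
  have "(ipnorm q (x + y))\<^sup>2 = Re (q x x) + Re (q x y) + Re (q y x) + Re (q y y)"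
    using x y by (simp add: norm_square ip_add_left ip_add_right)
  also have "Re (q y x) = Re (q x y)" using ip_commute[OF x y] by simp
  also have "Re (q x y) \<le> ipnorm q x * ipnorm q y"
    using Cauchy_Schwarz[OF x y] complex_Re_le_cmod order_trans by blast
  finally have "(ipnorm q (x + y))\<^sup>2 \<le> (ipnorm q x + ipnorm q y)\<^sup>2"
    using x y by (simp add: power2_sum norm_square)
  then show ?thesis
    using x y by (simp add: power2_le_iff_abs_le)
qed

lemma norm_triangle_diff:
  "x \<in> V \<Longrightarrow> y \<in> V \<Longrightarrow> ipnorm q (x - y) \<le> ipnorm q x + ipnorm q y"
  using norm_triangle[of x "- y"] by (simp add: norm_minus)

lemma norm_triangle_sub:
  "x \<in> V \<Longrightarrow> y \<in> V \<Longrightarrow> ipnorm q x \<le> ipnorm q y + ipnorm q (x - y)"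
  using norm_triangle[of y "x - y"] by simp

lemma dist_triangle:
  "x \<in> V \<Longrightarrow> y \<in> V \<Longrightarrow> z \<in> V \<Longrightarrow> ipnorm q (x - z) \<le> ipnorm q (x - y) + ipnorm q (y - z)"
  using norm_triangle[of "x - y" "y - z"] by simp

lemma norm_sum_le:
  "(\<And>i. i \<in> I \<Longrightarrow> w i \<in> V) \<Longrightarrow> ipnorm q (sum w I) \<le> (\<Sum>i\<in>I. ipnorm q (w i))"
proof (induction I rule: infinite_finite_induct)
  case (insert i I)
  then show ?case using norm_triangle[of "w i" "sum w I"] by (simp add: sum_mem)
qed auto

section \<open>Completeness, limits and approximation\<close>

lemma complete:
  assumes "\<And>i. X i \<in> V" and "\<And>e. e > 0 \<Longrightarrow> \<exists>N. \<forall>i\<ge>N. \<forall>k\<ge>N. ipnorm q (X i - X k) < e"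
  obtains x where "x \<in> V" "(\<lambda>i::nat. ipnorm q (X i - x)) \<longlonglongrightarrow> 0"
proof -
  have "\<forall>X::nat \<Rightarrow> 'h. range X \<subseteq> V \<and> (\<forall>e>0. \<exists>N. \<forall>i\<ge>N. \<forall>k\<ge>N. ipnorm q (X i - X k) < e) \<longrightarrow>
       (\<exists>x\<in>V. (\<lambda>i. ipnorm q (X i - x)) \<longlonglongrightarrow> 0)"
    using hilbert unfolding hilbert_space_def by blast
  then show thesis using assms that by blast
qed

lemma convergent_Cauchy:
  assumes X: "\<And>i. X i \<in> V" and x: "x \<in> V" and lim: "(\<lambda>i. ipnorm q (X i - x)) \<longlonglongrightarrow> 0" and e: "e > 0"
  shows "\<exists>N::nat. \<forall>i\<ge>N. \<forall>k\<ge>N. ipnorm q (X i - X k) < e"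
proof -
  obtain N where N: "\<And>i. i \<ge> N \<Longrightarrow> ipnorm q (X i - x) < e / 2"
    using lim[THEN LIMSEQ_D, of "e/2"] e X x by auto
  have "ipnorm q (X i - X k) < e" if "i \<ge> N" "k \<ge> N" for i k
    using dist_triangle[OF X x X, of i k] N[OF that(1)] N[OF that(2)] norm_diff_commute[OF X x, of k] by simp
  then show ?thesis by blast
qed

lemma limit_unique:
  assumes X: "\<And>i. X i \<in> V" and x: "x \<in> V" and y: "y \<in> V"
    and "(\<lambda>i::nat. ipnorm q (X i - x)) \<longlonglongrightarrow> 0" "(\<lambda>i. ipnorm q (X i - y)) \<longlonglongrightarrow> 0"
  shows "x = y"
proof -
  have "(\<lambda>i. ipnorm q (X i - x) + ipnorm q (X i - y)) \<longlonglongrightarrow> 0 + 0"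
    using assms by (intro tendsto_add)
  moreover have "ipnorm q (x - y) \<le> ipnorm q (X i - x) + ipnorm q (X i - y)" for i
    using dist_triangle[OF x X y, of i] norm_diff_commute[OF X x, of i] by simp
  ultimately have "ipnorm q (x - y) \<le> 0"
    using LIMSEQ_le_const by (metis (no_types, lifting) add.right_neutral)
  then have "ipnorm q (x - y) = 0"
    using x y by (intro antisym) auto
  then show ?thesis using x y norm_eq_zero[of "x - y"] by simp
qed

lemma tendsto_ip_left:
  assumes X: "\<And>i. X i \<in> V" and x: "x \<in> V" and y: "y \<in> V" and lim: "(\<lambda>i::nat. ipnorm q (X i - x)) \<longlonglongrightarrow> 0"
  shows "(\<lambda>i. q (X i) y) \<longlonglongrightarrow> q x y"
proof -
  have "(\<lambda>i. q (X i) y - q x y) \<longlonglongrightarrow> 0"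
  proof (rule tendsto_norm_zero_cancel, rule tendsto_sandwich)
    show "\<forall>\<^sub>F i in sequentially. 0 \<le> cmod (q (X i) y - q x y)" by simp
    show "\<forall>\<^sub>F i in sequentially. cmod (q (X i) y - q x y) \<le> ipnorm q (X i - x) * ipnorm q y"
      using X x y Cauchy_Schwarz[of "X _ - x" y] by (simp add: ip_diff_left)
    show "(\<lambda>i. ipnorm q (X i - x) * ipnorm q y) \<longlonglongrightarrow> 0"
      using tendsto_mult_left_zero[OF lim] by simp
  qed simp
  then show ?thesis by (simp add: LIM_zero_iff)
qed

lemma tendsto_ip_right:
  assumes X: "\<And>i. X i \<in> V" and x: "x \<in> V" and y: "y \<in> V" and lim: "(\<lambda>i::nat. ipnorm q (X i - x)) \<longlonglongrightarrow> 0"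
  shows "(\<lambda>i. q y (X i)) \<longlonglongrightarrow> q y x"
  using tendsto_cnj[OF tendsto_ip_left[OF assms]] ip_commute[OF y X] ip_commute[OF y x] by simp

lemma tendsto_norm:
  assumes X: "\<And>i. X i \<in> V" and x: "x \<in> V" and lim: "(\<lambda>i::nat. ipnorm q (X i - x)) \<longlonglongrightarrow> 0"
  shows "(\<lambda>i. ipnorm q (X i)) \<longlonglongrightarrow> ipnorm q x"
proof -
  have "(\<lambda>i. ipnorm q (X i) - ipnorm q x) \<longlonglongrightarrow> 0"
  proof (rule tendsto_norm_zero_cancel, rule tendsto_sandwich)
    show "\<forall>\<^sub>F i in sequentially. 0 \<le> norm (ipnorm q (X i) - ipnorm q x)" by simp
    show "\<forall>\<^sub>F i in sequentially. norm (ipnorm q (X i) - ipnorm q x) \<le> ipnorm q (X i - x)"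
    proof (intro always_eventually allI)
      fix i
      show "norm (ipnorm q (X i) - ipnorm q x) \<le> ipnorm q (X i - x)"
        using norm_triangle_sub[OF X x, of i] norm_triangle_sub[OF x X, of i]
          norm_diff_commute[OF X x, of i] by (simp add: abs_le_iff)
    qed
  qed (use lim in auto)
  then show ?thesis by (simp add: LIM_zero_iff)
qed

lemma approximating_sequence:
  assumes "u \<in> V" and "\<And>e. e > 0 \<Longrightarrow> \<exists>x\<in>D. ipnorm q (u - x) < e" and "D \<subseteq> V"
  obtains X where "\<And>i. X i \<in> D" "(\<lambda>i::nat. ipnorm q (X i - u)) \<longlonglongrightarrow> 0"
proof -
  have "\<forall>i::nat. \<exists>x\<in>D. ipnorm q (u - x) < inverse (real (Suc i))"
    using assms(2) by simp
  then obtain X where X: "\<And>i. X i \<in> D" "\<And>i::nat. ipnorm q (u - X i) < inverse (real (Suc i))"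
    by metis
  have "(\<lambda>i. ipnorm q (X i - u)) \<longlonglongrightarrow> 0"
  proof (rule tendsto_sandwich[OF _ _ tendsto_const LIMSEQ_inverse_real_of_nat])
    show "\<forall>\<^sub>F i in sequentially. 0 \<le> ipnorm q (X i - u)"
      using X(1) assms(1,3) by (intro always_eventually allI norm_nonneg diff_mem) auto
    show "\<forall>\<^sub>F i in sequentially. ipnorm q (X i - u) \<le> inverse (real (Suc i))"
      using X assms(1,3) norm_diff_commute by (auto intro!: always_eventually) (metis less_imp_le subsetD)
  qed
  then show thesis using X(1) that by blast
qed

text \<open>Projection theorem for a subspace that need not be closed: a minimising sequence for the
  distance from \<open>u\<close> converges to some \<open>x\<close> in \<open>V\<close>, the
  residual \<open>u - x\<close> is orthogonal to \<open>D\<close>, hence zero, and so the sequence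
  approximates \<open>u\<close> itself.\<close>

lemma dense_if_orthogonal_trivial:
  assumes D: "complex_vector.subspace D" "D \<subseteq> V"
    and orth: "\<And>g. g \<in> V \<Longrightarrow> (\<And>x. x \<in> D \<Longrightarrow> q x g = 0) \<Longrightarrow> g = 0"
    and u: "u \<in> V" and e: "e > 0"
  shows "\<exists>x\<in>D. ipnorm q (u - x) < e"
proof -
  have DV: "x \<in> V" if "x \<in> D" for x using D that by auto
  define d where "d = (INF x\<in>D. (ipnorm q (u - x))\<^sup>2)"
  have bdd: "bdd_below ((\<lambda>x. (ipnorm q (u - x))\<^sup>2) ` D)" by (rule bdd_belowI[of _ 0]) auto
  have ne: "D \<noteq> {}" using D(1) complex_vector.subspace_0 by blast
  have d_le: "d \<le> (ipnorm q (u - x))\<^sup>2" if "x \<in> D" for x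
    unfolding d_def using bdd that by (rule cINF_lower)
  have "\<exists>x\<in>D. (ipnorm q (u - x))\<^sup>2 < d + inverse (real (Suc i))" for i
  proof (rule ccontr)
    assume "\<not> ?thesis"
    then have "d + inverse (real (Suc i)) \<le> d"
      unfolding d_def using ne by (intro cINF_greatest) (auto simp: not_less d_def)
    then show False by simp
  qed
  then obtain X where X: "\<And>i. X i \<in> D" "\<And>i. (ipnorm q (u - X i))\<^sup>2 < d + inverse (real (Suc i))"
    by metis
  have XV: "X i \<in> V" for i using X(1) DV by blast
  have par: "(ipnorm q (a - b))\<^sup>2 + (ipnorm q (a + b))\<^sup>2 = 2 * (ipnorm q a)\<^sup>2 + 2 * (ipnorm q b)\<^sup>2"
    if "a \<in> V" "b \<in> V" for a b
    using that by (simp add: norm_square ip_add_left ip_add_right ip_diff_left ip_diff_right)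
  \<comment> \<open>Parallelogram law for \<open>u - X i\<close> and \<open>u - X k\<close>; their
    midpoint is \<open>u - ?w\<close> with \<open>?w\<close> in \<open>D\<close>, whose squared
    distance from \<open>u\<close> is at least \<open>d\<close>.\<close>
  have cl: "(ipnorm q (X i - X k))\<^sup>2 \<le> 2 * inverse (real (Suc i)) + 2 * inverse (real (Suc k))" for i k
  proof -
    let ?w = "(1/2) *\<^sub>C (X i + X k)"
    have w: "?w \<in> D" using D(1) X(1) complex_vector.subspace_add complex_vector.subspace_scale by blast
    have uw: "u - ?w \<in> V" using u DV[OF w] by simp
    have "(u - X i) + (u - X k) = 2 *\<^sub>C (u - ?w)"
      by (simp add: algebra_simps complex_vector.scale_right_diff_distrib scaleC_scaleC)
        (metis one_add_one scaleC_add_left scaleC_one)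
    then have "(ipnorm q ((u - X i) + (u - X k)))\<^sup>2 = 4 * (ipnorm q (u - ?w))\<^sup>2"
      by (simp add: norm_scale uw power_mult_distrib)
    moreover have "(u - X i) - (u - X k) = - (X i - X k)" by simp
    then have "(ipnorm q ((u - X i) - (u - X k)))\<^sup>2 = (ipnorm q (X i - X k))\<^sup>2"
      using norm_minus[of "X i - X k"] XV by simp
    ultimately show ?thesis
      using par[of "u - X i" "u - X k"] d_le[OF w] X(2)[of i] X(2)[of k] u XV by simp
  qed
  obtain x where x: "x \<in> V" "(\<lambda>i. ipnorm q (X i - x)) \<longlonglongrightarrow> 0"
  proof (rule complete[of X])
    fix e :: real assume e: "e > 0"
    then obtain N :: nat where N: "inverse (real (Suc N)) < e\<^sup>2 / 4"
      using reals_Archimedean[of "e\<^sup>2/4"] by auto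
    have "ipnorm q (X i - X k) < e" if "i \<ge> N" "k \<ge> N" for i k
    proof -
      have "inverse (real (Suc i)) \<le> inverse (real (Suc N))" "inverse (real (Suc k)) \<le> inverse (real (Suc N))"
        using that by (simp_all add: le_imp_inverse_le)
      then have "(ipnorm q (X i - X k))\<^sup>2 < e\<^sup>2" using cl[of i k] N by linarith
      then show ?thesis using e by (simp add: power2_less_imp_less)
    qed
    then show "\<exists>N. \<forall>i\<ge>N. \<forall>k\<ge>N. ipnorm q (X i - X k) < e" by blast
  qed (use XV in auto)
  have ux: "(ipnorm q (u - x))\<^sup>2 \<le> d"
  proof -
    have "(\<lambda>i. ipnorm q ((u - X i) - (u - x))) \<longlonglongrightarrow> 0"
      using x XV by (simp add: norm_diff_commute[of x])
    then have "(\<lambda>i. (ipnorm q (u - X i))\<^sup>2) \<longlonglongrightarrow> (ipnorm q (u - x))\<^sup>2"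
      using XV x u by (intro tendsto_power tendsto_norm) auto
    moreover have "(\<lambda>i. d + inverse (real (Suc i))) \<longlonglongrightarrow> d + 0"
      by (intro tendsto_add tendsto_const LIMSEQ_inverse_real_of_nat)
    ultimately have "(ipnorm q (u - x))\<^sup>2 \<le> d + 0"
      by (rule LIMSEQ_le) (use X(2) in \<open>auto intro: less_imp_le\<close>)
    then show ?thesis by simp
  qed
  \<comment> \<open>The limit \<open>x\<close> need not lie in \<open>D\<close>, so minimality is
    applied to \<open>X i + y\<close> and carried over to \<open>x + y\<close> in the limit.\<close>
  have dle: "d \<le> (ipnorm q (u - x - y))\<^sup>2" if y: "y \<in> D" for y
  proof -
    have "(\<lambda>i. ipnorm q ((u - X i - y) - (u - x - y))) \<longlonglongrightarrow> 0"
      using x XV by (simp add: norm_diff_commute[of x])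
    then have "(\<lambda>i. (ipnorm q (u - X i - y))\<^sup>2) \<longlonglongrightarrow> (ipnorm q (u - x - y))\<^sup>2"
      using XV x u DV[OF y] by (intro tendsto_power tendsto_norm) auto
    moreover have "d \<le> (ipnorm q (u - X i - y))\<^sup>2" for i
      using d_le[of "X i + y"] X(1) y D(1) complex_vector.subspace_add[OF D(1)] by (simp add: diff_diff_eq)
    ultimately show ?thesis using LIMSEQ_le_const by blast
  qed
  have "u - x = 0"
  proof (rule orth)
    show ux_mem: "u - x \<in> V" using u x by simp
    fix y assume y: "y \<in> D"
    show "q y (u - x) = 0"
    proof (cases "y = 0")
      case False
      have ay: "a *\<^sub>C y \<in> D" for a using y D(1) complex_vector.subspace_scale by blast
      have pos: "0 < (ipnorm q y)\<^sup>2" using False DV[OF y] by (simp add: norm_square ip_pos)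
      \<comment> \<open>Subtracting the projection onto \<open>y\<close> would lower the squared
        distance below its infimum \<open>d\<close> by exactly this amount.\<close>
      have "(cmod (q y (u - x)))\<^sup>2 / (ipnorm q y)\<^sup>2 \<le> 0"
        using norm_diff_projection[OF ux_mem DV[OF y] False] dle[OF ay, of "q y (u - x) / q y y"] ux
        by linarith
      then show ?thesis
        using pos by (simp add: divide_le_0_iff)
    qed (use ux_mem in auto)
  qed
  then have "x = u" by simp
  then have "(\<lambda>i. ipnorm q (X i - u)) \<longlonglongrightarrow> 0" using x by simp
  then have "\<exists>N. \<forall>n\<ge>N. norm (ipnorm q (X n - u) - 0) < e" by (rule LIMSEQ_D) fact
  then obtain N where "norm (ipnorm q (X N - u) - 0) < e" by blast
  then have "ipnorm q (X N - u) < e" by simp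
  then show ?thesis using X(1) norm_diff_commute[OF u XV] by (intro bexI[of _ "X N"]) auto
qed

end

text \<open>Needed for positive levels: with \<open>J\<close> a power of the inverse root it makes
  \<open>H n\<close> complete, where the definition of the scale provides only the set and the inner
  product.\<close>

lemma hilbert_space_transfer:
  assumes "hilb V q"
    and J: "\<And>x y. x \<in> V \<Longrightarrow> y \<in> V \<Longrightarrow> J (x + y) = J x + J y"
      "\<And>a x. x \<in> V \<Longrightarrow> J (a *\<^sub>C x) = a *\<^sub>C J x"
    and iso: "\<And>x y. x \<in> V \<Longrightarrow> y \<in> V \<Longrightarrow> q' (J x) (J y) = q x y"
  shows "hilbert_space (J ` V) q'"
proof -
  interpret hilb V q by fact
  have J0: "J 0 = 0" using J(2)[of 0 0] by simp
  have Jd: "J x - J y = J (x - y)" if "x \<in> V" "y \<in> V" for x y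
    using J(1)[of "x - y" y] that by simp
  have nJ: "ipnorm q' (J x) = ipnorm q x" if "x \<in> V" for x
    using iso that by (simp add: ipnorm_def)
  show ?thesis
    unfolding hilbert_space_def
  proof (intro conjI ballI allI impI)
    show "complex_vector.subspace (J ` V)"
      unfolding complex_vector.subspace_def
      by (auto simp: J(1)[symmetric] J(2)[symmetric] intro!: imageI) (metis J0 image_eqI zero_mem)
    fix X :: "nat \<Rightarrow> 'b"
    assume X: "range X \<subseteq> J ` V \<and> (\<forall>e>0. \<exists>N. \<forall>i\<ge>N. \<forall>k\<ge>N. ipnorm q' (X i - X k) < e)"
    then have "\<forall>i. \<exists>y. y \<in> V \<and> X i = J y" by blast
    then obtain Y where Y: "\<And>i. Y i \<in> V" "\<And>i. X i = J (Y i)" by metis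
    obtain y where y: "y \<in> V" "(\<lambda>i. ipnorm q (Y i - y)) \<longlonglongrightarrow> 0"
    proof (rule complete[of Y])
      fix e :: real assume "e > 0"
      then show "\<exists>N. \<forall>i\<ge>N. \<forall>k\<ge>N. ipnorm q (Y i - Y k) < e"
        using X Y by (simp add: Jd nJ)
    qed (use Y in auto)
    then show "\<exists>x\<in>J ` V. (\<lambda>i. ipnorm q' (X i - x)) \<longlonglongrightarrow> 0"
      using Y by (intro bexI[of _ "J y"]) (auto simp: Jd nJ)
  next
    fix x assume "x \<in> J ` V" "x \<noteq> 0"
    then show "0 < Re (q' x x)" using J0 by (auto simp: iso intro!: ip_pos)
  qed (auto simp: iso J[symmetric] ip_add_right ip_scale_right intro: ip_commute)
qed


section \<open>Self-adjoint operators and their resolvent sets\<close>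

locale selfadjoint = hilb V q for V :: "'h::complex_vector set" and q +
  fixes D :: "'h set" and T :: "'h \<Rightarrow> 'h"
  assumes selfadjoint: "selfadjoint_op V q D T"
begin

lemma graph_iff: "g \<in> D \<and> g' = T g \<longleftrightarrow> g \<in> V \<and> g' \<in> V \<and> (\<forall>f\<in>D. q f g' = q (T f) g)"
proof -
  have "(g, g') \<in> op_graph D T \<longleftrightarrow> (g, g') \<in> rel_adjoint V q (op_graph D T)"
    using selfadjoint by (simp add: selfadjoint_op_def)
  then show ?thesis unfolding op_graph_def rel_adjoint_def by auto
qed

lemma dom_mem: "f \<in> D \<Longrightarrow> f \<in> V"
  and range_mem: "f \<in> D \<Longrightarrow> T f \<in> V"
  and symmetric: "f \<in> D \<Longrightarrow> g \<in> D \<Longrightarrow> q f (T g) = q (T f) g"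
  using graph_iff[of f "T f"] graph_iff[of g "T g"] by auto

text \<open>Equality with the adjoint relation makes this test the only source of domain membership.
  Linearity of \<open>D\<close> and \<open>T\<close> is not part of \<open>selfadjoint_op\<close>;
  it is derived from the test, and so is the closedness of \<open>T\<close>.\<close>

lemma adjointI:
  "g \<in> V \<Longrightarrow> g' \<in> V \<Longrightarrow> (\<And>f. f \<in> D \<Longrightarrow> q f g' = q (T f) g) \<Longrightarrow> g \<in> D \<and> T g = g'"
  using graph_iff[of g g'] by auto

lemma op_add: "f \<in> D \<Longrightarrow> g \<in> D \<Longrightarrow> f + g \<in> D \<and> T (f + g) = T f + T g"
  by (rule adjointI) (simp_all add: dom_mem range_mem ip_add_right symmetric)

lemma op_scale: "f \<in> D \<Longrightarrow> a *\<^sub>C f \<in> D \<and> T (a *\<^sub>C f) = a *\<^sub>C T f"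
  by (rule adjointI) (simp_all add: dom_mem range_mem ip_scale_right symmetric)

lemma op_zero: "0 \<in> D \<and> T 0 = 0"
  by (rule adjointI) (simp_all add: dom_mem range_mem)

lemma op_diff: "f \<in> D \<Longrightarrow> g \<in> D \<Longrightarrow> f - g \<in> D \<and> T (f - g) = T f - T g"
  using op_add[of f "(-1) *\<^sub>C g"] op_scale[of g "-1"] by simp

lemma shift_mem [simp]: "f \<in> D \<Longrightarrow> T f - z *\<^sub>C f \<in> V"
  by (simp add: dom_mem range_mem)

text \<open>\<open>T - Re z\<close> is symmetric, so the mixed terms with the imaginary part cancel.
  The right side is unchanged under conjugation of \<open>z\<close>, and it bounds
  \<open>T - z\<close> from below for nonreal \<open>z\<close>.\<close>

lemma norm_shift:
  assumes f: "f \<in> D"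
  shows "(ipnorm q (T f - z *\<^sub>C f))\<^sup>2 =
    (ipnorm q (T f - of_real (Re z) *\<^sub>C f))\<^sup>2 + (Im z)\<^sup>2 * (ipnorm q f)\<^sup>2"
proof -
  define g where "g = T f - of_real (Re z) *\<^sub>C f"
  have fV: "f \<in> V" and g: "g \<in> V" using f by (simp_all add: g_def dom_mem)
  have fg: "q f g = q g f"
    using f by (simp add: g_def ip_diff_left ip_diff_right ip_scale_left ip_scale_right dom_mem
        range_mem symmetric)
  have "T f - z *\<^sub>C f = g - (\<i> * of_real (Im z)) *\<^sub>C f"
    using scaleC_add_left[of "of_real (Re z)" "\<i> * of_real (Im z)" f] complex_eq[of z]
    by (simp add: g_def)
  moreover have "q (g - (\<i> * of_real (Im z)) *\<^sub>C f) (g - (\<i> * of_real (Im z)) *\<^sub>C f) =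
      q g g + of_real ((Im z)\<^sup>2) * q f f"
    using fV g by (simp add: ip_diff_left ip_diff_right ip_scale_left ip_scale_right fg)
      (simp add: algebra_simps power2_eq_square)
  ultimately show ?thesis
    using fV g by (simp add: norm_square f g_def[symmetric])
qed

lemma norm_shift_cnj:
  assumes f: "f \<in> D"
  shows "ipnorm q (T f - cnj z *\<^sub>C f) = ipnorm q (T f - z *\<^sub>C f)"
  by (rule power2_eq_imp_eq) (use norm_shift[OF f, of z] norm_shift[OF f, of "cnj z"] f in auto)

text \<open>A vector orthogonal to the range is an eigenvector for \<open>cnj z\<close>, and the
  lower bound holds there too by \<open>norm_shift_cnj\<close>; so the range is dense. It is closed
  because the bound makes preimages of a convergent sequence Cauchy, and their limit passes the
  adjoint test.\<close>

lemma lower_bound_imp_bij: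
  assumes lb: "\<And>f. f \<in> D \<Longrightarrow> ipnorm q f \<le> C * ipnorm q (T f - z *\<^sub>C f)"
  shows "bij_betw (\<lambda>f. T f - z *\<^sub>C f) D V"
proof -
  let ?A = "\<lambda>f. T f - z *\<^sub>C f"
  have A_diff: "f - g \<in> D \<and> ?A (f - g) = ?A f - ?A g" if "f \<in> D" "g \<in> D" for f g
    using op_diff[OF that] by (simp add: complex_vector.scale_right_diff_distrib)
  have eq0: "f = 0" if "f \<in> D" "?A f = 0" for f
    using lb[OF that(1)] that dom_mem norm_eq_zero[of f] norm_nonneg[of f] by (simp add: antisym)
  have lb': "ipnorm q f \<le> C * ipnorm q (T f - cnj z *\<^sub>C f)" if "f \<in> D" for f
    using lb[OF that] by (simp add: norm_shift_cnj that)
  have orth: "g = 0" if g: "g \<in> V" "\<And>x. x \<in> ?A ` D \<Longrightarrow> q x g = 0" for g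
  proof -
    have "g \<in> D \<and> T g = cnj z *\<^sub>C g"
    proof (rule adjointI)
      fix f assume f: "f \<in> D"
      have "q (?A f) g = 0" using g(2) f by blast
      then show "q f (cnj z *\<^sub>C g) = q (T f) g"
        using f g(1) by (simp add: ip_diff_left ip_scale_left ip_scale_right dom_mem range_mem)
    qed (use g in auto)
    then show ?thesis using lb'[of g] g norm_eq_zero[of g] norm_nonneg[of g] by (simp add: antisym)
  qed
  have sub: "complex_vector.subspace (?A ` D)"
    unfolding complex_vector.subspace_def
  proof (intro conjI ballI allI)
    show "0 \<in> ?A ` D" using op_zero by (intro image_eqI[of _ _ 0]) auto
    show "x + y \<in> ?A ` D" if "x \<in> ?A ` D" "y \<in> ?A ` D" for x y
    proof -
      obtain f g where "f \<in> D" "g \<in> D" "x = ?A f" "y = ?A g" using \<open>x \<in> ?A ` D\<close> \<open>y \<in> ?A ` D\<close> by blast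
      then show ?thesis
        using op_add[of f g] by (intro image_eqI[of _ _ "f + g"]) (auto simp: scaleC_add_right)
    qed
    show "c *\<^sub>C x \<in> ?A ` D" if "x \<in> ?A ` D" for x c
    proof -
      obtain f where "f \<in> D" "x = ?A f" using \<open>x \<in> ?A ` D\<close> by blast
      then show ?thesis
        using op_scale[of f c] by (intro image_eqI[of _ _ "c *\<^sub>C f"])
          (auto simp: complex_vector.scale_right_diff_distrib scaleC_scaleC mult.commute)
    qed
  qed
  have "y \<in> ?A ` D" if y: "y \<in> V" for y
  proof -
    have dense: "\<exists>x\<in>?A ` D. ipnorm q (y - x) < e" if "e > 0" for e
      using sub _ orth y that by (rule dense_if_orthogonal_trivial) auto
    have range: "?A ` D \<subseteq> V" by auto
    obtain Y where Y: "\<And>i. Y i \<in> ?A ` D" and lim: "(\<lambda>i::nat. ipnorm q (Y i - y)) \<longlonglongrightarrow> 0"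
      by (rule approximating_sequence[OF y dense range]) (assumption, rule that, assumption+)
    have YV: "Y i \<in> V" for i using Y[of i] by auto
    obtain F where F: "\<And>i. F i \<in> D" "\<And>i. Y i = ?A (F i)" using Y unfolding image_iff by metis
    have FV: "F i \<in> V" for i using F dom_mem by blast
    obtain f where f: "f \<in> V" "(\<lambda>i. ipnorm q (F i - f)) \<longlonglongrightarrow> 0"
    proof (rule complete[of F])
      fix e :: real assume e: "e > 0"
      \<comment> \<open>The constant \<open>C\<close> may be zero or negative, so a positive
        majorant is used as divisor.\<close>
      have C1: "\<bar>C\<bar> + 1 > 0" by simp
      obtain N where N: "\<And>i k. i \<ge> N \<Longrightarrow> k \<ge> N \<Longrightarrow> ipnorm q (Y i - Y k) < e / (\<bar>C\<bar> + 1)"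
        using convergent_Cauchy[of Y y "e / (\<bar>C\<bar> + 1)"] YV y lim e by auto
      have "ipnorm q (F i - F k) < e" if "i \<ge> N" "k \<ge> N" for i k
      proof -
        have "ipnorm q (F i - F k) \<le> C * ipnorm q (Y i - Y k)"
          using lb[of "F i - F k"] A_diff[OF F(1) F(1), of i k] F(2) by simp
        also have "\<dots> \<le> (\<bar>C\<bar> + 1) * ipnorm q (Y i - Y k)"
          using YV by (intro mult_right_mono) auto
        also have "\<dots> < (\<bar>C\<bar> + 1) * (e / (\<bar>C\<bar> + 1))"
          using N[OF that] C1 by (rule mult_strict_left_mono)
        also have "\<dots> = e" using C1 by simp
        finally show ?thesis .
      qed
      then show "\<exists>N. \<forall>i\<ge>N. \<forall>k\<ge>N. ipnorm q (F i - F k) < e" by blast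
    qed (use FV in auto)
    have "f \<in> D \<and> T f = y + z *\<^sub>C f"
    proof (rule adjointI)
      fix g assume g: "g \<in> D"
      have "(\<lambda>i. q g (Y i) + z * q g (F i)) \<longlonglongrightarrow> q g y + z * q g f"
        using g dom_mem YV FV y f lim by (intro tendsto_intros tendsto_ip_right) auto
      moreover have "(\<lambda>i. q (T g) (F i)) \<longlonglongrightarrow> q (T g) f"
        using g range_mem FV f by (intro tendsto_ip_right) auto
      moreover have "q g (Y i) + z * q g (F i) = q (T g) (F i)" for i
        using g F FV by (simp add: dom_mem range_mem ip_diff_right ip_scale_right flip: symmetric)
      ultimately have "q g y + z * q g f = q (T g) f"
        using LIMSEQ_unique by simp
      then show "q g (y + z *\<^sub>C f) = q (T g) f"
        using g dom_mem y f by (simp add: ip_add_right ip_scale_right)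
    qed (use y f in auto)
    then show ?thesis by (intro image_eqI[of _ _ f]) auto
  qed
  moreover have "inj_on ?A D"
  proof (rule inj_onI)
    fix f g assume "f \<in> D" "g \<in> D" "?A f = ?A g"
    then show "f = g" using A_diff[of f g] eq0[of "f - g"] by simp
  qed
  ultimately show ?thesis unfolding bij_betw_def by auto
qed

text \<open>Surjectivity comes for free, so openness and the inclusion of nonreal points reduce to
  estimates.\<close>

lemma resolvent_set_iff:
  "z \<in> resolvent_set V q D T \<longleftrightarrow> (\<exists>C. \<forall>f\<in>D. ipnorm q f \<le> C * ipnorm q (T f - z *\<^sub>C f))"
  using lower_bound_imp_bij unfolding resolvent_set_def by blast

lemma nonreal_in_resolvent_set:
  assumes "Im z \<noteq> 0"
  shows "z \<in> resolvent_set V q D T"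
proof -
  have "ipnorm q f \<le> inverse \<bar>Im z\<bar> * ipnorm q (T f - z *\<^sub>C f)" if f: "f \<in> D" for f
  proof -
    have "(\<bar>Im z\<bar> * ipnorm q f)\<^sup>2 \<le> (ipnorm q (T f - z *\<^sub>C f))\<^sup>2"
      using norm_shift[OF f, of z] by (simp add: power_mult_distrib)
    then have "\<bar>Im z\<bar> * ipnorm q f \<le> ipnorm q (T f - z *\<^sub>C f)"
      using f by (simp add: power2_le_iff_abs_le)
    then show ?thesis using assms by (simp add: field_simps)
  qed
  then show ?thesis unfolding resolvent_set_iff by blast
qed

text \<open>The perturbation \<open>(w - z) *\<^sub>C f\<close> costs at most half of the norm of
  \<open>f\<close>; absorbing it on the left doubles the constant. The resulting uniformity in
  \<open>w\<close> is used again for the resolvent expansion.\<close>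

lemma lower_bound_nearby:
  assumes C: "C > 0" "\<And>f. f \<in> D \<Longrightarrow> ipnorm q f \<le> C * ipnorm q (T f - z *\<^sub>C f)"
    and w: "cmod (w - z) * C \<le> 1 / 2" and f: "f \<in> D"
  shows "ipnorm q f \<le> 2 * C * ipnorm q (T f - w *\<^sub>C f)"
proof -
  have fV: "f \<in> V" using f dom_mem by blast
  have eq: "T f - z *\<^sub>C f = (T f - w *\<^sub>C f) + (w - z) *\<^sub>C f"
    by (simp add: complex_vector.scale_left_diff_distrib)
  have "ipnorm q (T f - z *\<^sub>C f) \<le> ipnorm q (T f - w *\<^sub>C f) + cmod (w - z) * ipnorm q f"
    unfolding eq using norm_triangle[of "T f - w *\<^sub>C f" "(w - z) *\<^sub>C f"] f fV by (simp add: norm_scale)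
  then have "C * ipnorm q (T f - z *\<^sub>C f) \<le> C * (ipnorm q (T f - w *\<^sub>C f) + cmod (w - z) * ipnorm q f)"
    using C(1) by simp
  then have "ipnorm q f \<le> C * (ipnorm q (T f - w *\<^sub>C f) + cmod (w - z) * ipnorm q f)"
    using C(2)[OF f] by linarith
  moreover have "cmod (w - z) * C * ipnorm q f \<le> 1 / 2 * ipnorm q f"
    using w fV by (intro mult_right_mono) auto
  ultimately show ?thesis by (simp add: algebra_simps)
qed

lemma lower_bound_obtain:
  assumes "z \<in> resolvent_set V q D T"
  obtains C where "C > 0" "\<And>f. f \<in> D \<Longrightarrow> ipnorm q f \<le> C * ipnorm q (T f - z *\<^sub>C f)"
proof -
  obtain C where C: "\<And>f. f \<in> D \<Longrightarrow> ipnorm q f \<le> C * ipnorm q (T f - z *\<^sub>C f)"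
    using assms unfolding resolvent_set_iff by blast
  have "ipnorm q f \<le> (\<bar>C\<bar> + 1) * ipnorm q (T f - z *\<^sub>C f)" if "f \<in> D" for f
  proof -
    have "C * ipnorm q (T f - z *\<^sub>C f) \<le> (\<bar>C\<bar> + 1) * ipnorm q (T f - z *\<^sub>C f)"
      using that by (intro mult_right_mono) auto
    then show ?thesis using C[OF that] by linarith
  qed
  then show thesis using that[of "\<bar>C\<bar> + 1"] by auto
qed

lemma open_resolvent_set: "open (resolvent_set V q D T)"
  unfolding open_dist
proof (intro ballI)
  fix z assume "z \<in> resolvent_set V q D T"
  then obtain C where C: "C > 0" "\<And>f. f \<in> D \<Longrightarrow> ipnorm q f \<le> C * ipnorm q (T f - z *\<^sub>C f)"
    by (rule lower_bound_obtain) blast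
  have "w \<in> resolvent_set V q D T" if "dist w z < 1 / (2 * C)" for w
  proof -
    have "cmod (w - z) * C \<le> 1 / 2" using that C(1) by (simp add: dist_norm field_simps)
    then show ?thesis using lower_bound_nearby[OF C] unfolding resolvent_set_iff by blast
  qed
  then show "\<exists>e>0. \<forall>w. dist w z < e \<longrightarrow> w \<in> resolvent_set V q D T"
    using C(1) by (intro exI[of _ "1 / (2 * C)"]) auto
qed

end


section \<open>The scale of Hilbert spaces\<close>

locale hilbert_scale =
  fixes P :: "('h::complex_vector, 's) peak_data"
  assumes hilbert_zero: "hilbert_space (Hsp P 0) (ips P 0)"
    and selfadjoint_zero: "selfadjoint_op (Hsp P 0) (ips P 0) (Hsp P 2) (Lop P)"
    and z1_res: "z1c P \<in> res_L P"
    and scale: "is_hilbert_scale P"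
begin

abbreviation H where "H \<equiv> Hsp P"
abbreviation ip where "ip \<equiv> ips P"
abbreviation L where "L \<equiv> Lop P"

definition A :: "'h \<Rightarrow> 'h" where "A f = L f - z1c P *\<^sub>C f"

sublocale L0: selfadjoint "Hsp P 0" "ips P 0" "Hsp P 2" "Lop P"
  by unfold_locales (rule hilbert_zero, rule selfadjoint_zero)

lemma A_bij_zero: "bij_betw A (H 2) (H 0)"
  using z1_res unfolding A_def res_L_def resolvent_set_def by simp

text \<open>The root is given only as a relation, but its inverse \<open>r\<close> is a total
  function on \<open>H 0\<close>. Both signs of \<open>rel_zpower\<close> then reduce to iterates of
  \<open>r\<close>: \<open>H n\<close> is the image of \<open>r ^^ n\<close> with the transported
  inner product for \<open>n\<close> at least 0, and for negative exponents the root power is a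
  power of \<open>r\<close>.\<close>

lemma inverse_root_exists:
  "\<exists>r. (\<forall>u\<in>H 0. r u \<in> H 0) \<and> inj_on r (H 0) \<and>
    (\<forall>u\<in>H 0. \<forall>v\<in>H 0. r (u + v) = r u + r v) \<and>
    (\<forall>u\<in>H 0. \<forall>a. r (a *\<^sub>C u) = a *\<^sub>C r u) \<and>
    (\<forall>u\<in>H 0. \<forall>v\<in>H 0. ip 0 (r u) v = ip 0 u (r v)) \<and>
    (\<forall>u\<in>H 0. r (r u) \<in> H 2 \<and> A (r (r u)) = u) \<and>
    (\<forall>n. H (int n) = (r ^^ n) ` H 0) \<and>
    (\<forall>n. \<forall>u\<in>H 0. \<forall>v\<in>H 0. ip (int n) ((r ^^ n) u) ((r ^^ n) v) = ip 0 u v) \<and>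
    (\<forall>n. \<forall>u\<in>H 0. \<forall>v\<in>H 0. ip (- int n) u v = ip 0 ((r ^^ n) u) ((r ^^ n) v))"
proof -
  let ?Z = "\<lambda>S n. rel_zpower (H 0) S n"
  obtain S where S: "is_positive_sqrt (H 0) (ip 0) (op_graph (H 2) A) S"
    and dom: "\<forall>n\<ge>0. H n = Domain (?Z S n)"
    and ips: "\<forall>n. \<forall>(f, f')\<in>?Z S n. \<forall>(g, g')\<in>?Z S n. ip n f g = ip 0 f' g'"
    using scale unfolding is_hilbert_scale_def A_def[abs_def, symmetric]
    by (elim conjE exE) (rule that, assumption+)
  have ipS: "ip n f g = ip 0 f' g'" if "(f, f') \<in> ?Z S n" "(g, g') \<in> ?Z S n" for n f f' g g'
    using ips that by fast
  have sv: "\<And>f u v. (f, u) \<in> S \<Longrightarrow> (f, v) \<in> S \<Longrightarrow> u = v"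
    using S unfolding is_positive_sqrt_def single_valued_def by blast
  have adj: "(g, g') \<in> S \<longleftrightarrow> g \<in> H 0 \<and> g' \<in> H 0 \<and> (\<forall>(f, f')\<in>S. ip 0 f g' = ip 0 f' g)" for g g'
    using S unfolding is_positive_sqrt_def rel_adjoint_def by blast
  have SS: "(f, u) \<in> S O S \<longleftrightarrow> f \<in> H 2 \<and> u = A f" for f u
    using S unfolding is_positive_sqrt_def op_graph_def by auto
  have S_mem: "f \<in> H 0" "u \<in> H 0" if "(f, u) \<in> S" for f u
    using adj that by blast+
  have S_ip: "ip 0 f v = ip 0 u g" if "(f, u) \<in> S" "(g, v) \<in> S" for f u g v
    using adj[of g v] that by blast
  have S_add: "(f + g, u + v) \<in> S" if fu: "(f, u) \<in> S" and gv: "(g, v) \<in> S" for f u g v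
    unfolding adj[of "f + g"]
  proof (intro conjI ballI)
    fix p assume p: "p \<in> S"
    obtain a b where ab: "p = (a, b)" by fastforce
    show "case p of (h, h') \<Rightarrow> ip 0 h (u + v) = ip 0 h' (f + g)"
      using S_mem[OF fu] S_mem[OF gv] p S_ip[OF _ fu, of a b] S_ip[OF _ gv, of a b] S_mem[of a b]
      by (simp add: ab L0.ip_add_right)
  qed (use S_mem fu gv in auto)
  have S_scale: "(a *\<^sub>C f, a *\<^sub>C u) \<in> S" if fu: "(f, u) \<in> S" for a f u
    unfolding adj[of "a *\<^sub>C f"]
  proof (intro conjI ballI)
    fix p assume p: "p \<in> S"
    obtain b c where bc: "p = (b, c)" by fastforce
    show "case p of (h, h') \<Rightarrow> ip 0 h (a *\<^sub>C u) = ip 0 h' (a *\<^sub>C f)"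
      using S_mem[OF fu] p S_ip[OF _ fu, of b c] S_mem[of b c]
      by (simp add: bc L0.ip_scale_right)
  qed (use S_mem fu in auto)
  \<comment> \<open>\<open>S O S\<close> is the graph of \<open>A\<close> on \<open>H 2\<close>,
    which maps onto \<open>H 0\<close>; so every \<open>u\<close> is a value of the second
    factor.\<close>
  have S_surj: "\<exists>f. (f, u) \<in> S" if "u \<in> H 0" for u
  proof -
    have "u \<in> A ` H 2" using that bij_betw_imp_surj_on[OF A_bij_zero] by simp
    then obtain h where "h \<in> H 2" "A h = u" by blast
    then have "(h, u) \<in> S O S" using SS by simp
    then show ?thesis by blast
  qed
  have zero: "(0, 0) \<in> S" using S_surj[of 0] S_scale[of _ _ 0] by force
  \<comment> \<open>A kernel vector of \<open>S\<close> is sent to 0 by \<open>S O S\<close> as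
    well, hence by the injective operator \<open>A\<close>.\<close>
  have S_inj: "f = g" if "(f, u) \<in> S" "(g, u) \<in> S" for f g u
  proof -
    have "(f - g, 0) \<in> S" using S_add[OF that(1) S_scale[OF that(2), of "-1"]] by simp
    then have "(f - g, 0) \<in> S O S" "(0, 0) \<in> S O S" using zero by blast+
    then have "f - g \<in> H 2" "A (f - g) = A 0" "0 \<in> H 2" unfolding SS by auto
    then have "f - g = 0" using A_bij_zero unfolding bij_betw_def inj_on_def by blast
    then show ?thesis by simp
  qed
  define r where "r u = (THE f. (f, u) \<in> S)" for u
  have rS: "(f, u) \<in> S \<longleftrightarrow> u \<in> H 0 \<and> f = r u" for f u
  proof
    assume fu: "(f, u) \<in> S"
    then have "r u = f" unfolding r_def using S_inj by blast
    then show "u \<in> H 0 \<and> f = r u" using S_mem fu by blast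
  next
    assume fu: "u \<in> H 0 \<and> f = r u"
    then obtain g where g: "(g, u) \<in> S" using S_surj by blast
    then have "r u = g" unfolding r_def using S_inj by blast
    then show "(f, u) \<in> S" using g fu by simp
  qed
  have r_mem: "r u \<in> H 0" if "u \<in> H 0" for u using rS S_mem that by blast
  have rn_mem: "(r ^^ n) u \<in> H 0" if "u \<in> H 0" for u n using that by (induction n) (auto intro: r_mem)
  \<comment> \<open>The graph is parametrised by its values: its pairs are
    \<open>((r ^^ n) u, u)\<close>. Reading them in the other order gives the negative
    powers.\<close>
  have pow: "(f, u) \<in> Id_on (H 0) O (S ^^ n) \<longleftrightarrow> u \<in> H 0 \<and> f = (r ^^ n) u" for f u n
  proof (induction n arbitrary: f u)
    case (Suc n)
    have "(f, u) \<in> Id_on (H 0) O (S ^^ Suc n) \<longleftrightarrow> (\<exists>y. (f, y) \<in> Id_on (H 0) O (S ^^ n) \<and> (y, u) \<in> S)"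
      by auto
    also have "\<dots> \<longleftrightarrow> u \<in> H 0 \<and> f = (r ^^ n) (r u)"
      unfolding Suc rS using r_mem by blast
    finally show ?case by (simp add: funpow_swap1)
  qed auto
  have zp: "(f, u) \<in> rel_zpower (H 0) S (int n) \<longleftrightarrow> u \<in> H 0 \<and> f = (r ^^ n) u" for f u n
    using pow by (simp add: rel_zpower_def)
  have zpm: "(u, f) \<in> rel_zpower (H 0) S (- int n) \<longleftrightarrow> u \<in> H 0 \<and> f = (r ^^ n) u" for f u n
    using pow by (cases "n = 0") (auto simp: rel_zpower_def)
  show ?thesis
  proof (intro exI[of _ r] conjI ballI allI)
    show "inj_on r (H 0)"
      using rS sv by (metis inj_onI)
    show "r (u + v) = r u + r v" if "u \<in> H 0" "v \<in> H 0" for u v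
      using S_add rS that by metis
    show "r (a *\<^sub>C u) = a *\<^sub>C r u" if "u \<in> H 0" for a u
      using S_scale rS that by metis
    show "ip 0 (r u) v = ip 0 u (r v)" if "u \<in> H 0" "v \<in> H 0" for u v
      using S_ip rS that by blast
    have rr: "(r (r u), u) \<in> S O S" if "u \<in> H 0" for u
      using rS r_mem that by blast
    show "r (r u) \<in> H 2" "A (r (r u)) = u" if "u \<in> H 0" for u
      using rr[OF that] unfolding SS by auto
    show "H (int n) = (r ^^ n) ` H 0" for n
      using dom[rule_format, of "int n"] zp by (auto simp: Domain_iff)
    show "ip (int n) ((r ^^ n) u) ((r ^^ n) v) = ip 0 u v" if "u \<in> H 0" "v \<in> H 0" for n u v
      using ipS zp that by blast
    show "ip (- int n) u v = ip 0 ((r ^^ n) u) ((r ^^ n) v)" if "u \<in> H 0" "v \<in> H 0" for n u v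
      using ipS zpm that by blast
  qed (use r_mem in auto)
qed

text \<open>The inverse of \<open>(L - z\<^sub>1)\<^sup>1\<^sup>/\<^sup>2\<close> in \<open>\<HH>\<^sub>0\<close>.\<close>

definition R :: "'h \<Rightarrow> 'h" where
  "R = (SOME r. (\<forall>u\<in>H 0. r u \<in> H 0) \<and> inj_on r (H 0) \<and>
    (\<forall>u\<in>H 0. \<forall>v\<in>H 0. r (u + v) = r u + r v) \<and>
    (\<forall>u\<in>H 0. \<forall>a. r (a *\<^sub>C u) = a *\<^sub>C r u) \<and>
    (\<forall>u\<in>H 0. \<forall>v\<in>H 0. ip 0 (r u) v = ip 0 u (r v)) \<and>
    (\<forall>u\<in>H 0. r (r u) \<in> H 2 \<and> A (r (r u)) = u) \<and>
    (\<forall>n. H (int n) = (r ^^ n) ` H 0) \<and>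
    (\<forall>n. \<forall>u\<in>H 0. \<forall>v\<in>H 0. ip (int n) ((r ^^ n) u) ((r ^^ n) v) = ip 0 u v) \<and>
    (\<forall>n. \<forall>u\<in>H 0. \<forall>v\<in>H 0. ip (- int n) u v = ip 0 ((r ^^ n) u) ((r ^^ n) v)))"

lemmas R_spec = someI_ex[OF inverse_root_exists, folded R_def]

lemmas R_mem = R_spec[THEN conjunct1, rule_format]
lemmas inj_R = R_spec[THEN conjunct2, THEN conjunct1, rule_format]
lemmas R_add = R_spec[THEN conjunct2, THEN conjunct2, THEN conjunct1, rule_format]
lemmas R_scale = R_spec[THEN conjunct2, THEN conjunct2, THEN conjunct2, THEN conjunct1, rule_format]
lemmas R_symmetric = R_spec[THEN conjunct2, THEN conjunct2, THEN conjunct2, THEN conjunct2, THEN conjunct1, rule_format]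
lemmas RR = R_spec[THEN conjunct2, THEN conjunct2, THEN conjunct2, THEN conjunct2, THEN conjunct2, THEN conjunct1, rule_format]
lemmas H_nat = R_spec[THEN conjunct2, THEN conjunct2, THEN conjunct2, THEN conjunct2, THEN conjunct2, THEN conjunct2, THEN conjunct1, rule_format]
lemmas ip_nat = R_spec[THEN conjunct2, THEN conjunct2, THEN conjunct2, THEN conjunct2, THEN conjunct2, THEN conjunct2, THEN conjunct2, THEN conjunct1, rule_format]
lemmas ip_neg = R_spec[THEN conjunct2, THEN conjunct2, THEN conjunct2, THEN conjunct2, THEN conjunct2, THEN conjunct2, THEN conjunct2, THEN conjunct2, rule_format]

section \<open>Powers of the inverse root\<close>

lemma RR_mem: "u \<in> H 0 \<Longrightarrow> R (R u) \<in> H 2"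
  and A_RR: "u \<in> H 0 \<Longrightarrow> A (R (R u)) = u"
  using RR by simp_all

lemma Rn_mem: "u \<in> H 0 \<Longrightarrow> (R ^^ n) u \<in> H 0"
  by (induction n) (auto intro: R_mem)

lemma Rn_mem_H: "u \<in> H 0 \<Longrightarrow> (R ^^ n) u \<in> H (int n)"
  by (simp add: H_nat)

lemma inj_Rn: "inj_on (R ^^ n) (H 0)"
proof (induction n)
  case (Suc n)
  show ?case
  proof (rule inj_onI)
    fix u v assume "u \<in> H 0" "v \<in> H 0" "(R ^^ Suc n) u = (R ^^ Suc n) v"
    then show "u = v"
      using inj_onD[OF inj_R, of "(R ^^ n) u" "(R ^^ n) v"] inj_onD[OF Suc, of u v] Rn_mem by simp
  qed
qed simp

lemma Rn_add: "u \<in> H 0 \<Longrightarrow> v \<in> H 0 \<Longrightarrow> (R ^^ n) (u + v) = (R ^^ n) u + (R ^^ n) v"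
  by (induction n) (simp_all add: R_add Rn_mem)

lemma Rn_scale: "u \<in> H 0 \<Longrightarrow> (R ^^ n) (a *\<^sub>C u) = a *\<^sub>C (R ^^ n) u"
  by (induction n) (simp_all add: R_scale Rn_mem)

lemma Rn_diff: "u \<in> H 0 \<Longrightarrow> v \<in> H 0 \<Longrightarrow> (R ^^ n) (u - v) = (R ^^ n) u - (R ^^ n) v"
  using Rn_add[of u "(-1) *\<^sub>C v" n] Rn_scale[of v n "-1"] by simp

lemma Rn_symmetric: "u \<in> H 0 \<Longrightarrow> v \<in> H 0 \<Longrightarrow> ip 0 ((R ^^ n) u) v = ip 0 u ((R ^^ n) v)"
proof (induction n arbitrary: v)
  case (Suc n)
  have "ip 0 ((R ^^ Suc n) u) v = ip 0 ((R ^^ n) u) (R v)"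
    using Suc.prems by (simp add: R_symmetric Rn_mem)
  also have "\<dots> = ip 0 u ((R ^^ n) (R v))"
    using Suc R_mem by blast
  finally show ?case by (simp add: funpow_swap1)
qed simp

lemma norm_nat: "u \<in> H 0 \<Longrightarrow> ipnorm (ip (int n)) ((R ^^ n) u) = ipnorm (ip 0) u"
  by (simp add: ipnorm_def ip_nat)

lemma norm_neg: "u \<in> H 0 \<Longrightarrow> ipnorm (ip (- int n)) u = ipnorm (ip 0) ((R ^^ n) u)"
  by (simp add: ipnorm_def ip_neg)

section \<open>Completeness and inclusions at all levels\<close>

lemma hilbert_H: "hilbert_space (H n) (ip n)"
proof (cases "0 \<le> n")
  case True
  then obtain k where k: "n = int k" using nonneg_int_cases by blast
  have "hilbert_space ((R ^^ k) ` H 0) (ip (int k))"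
    using L0.hilb_axioms by (rule hilbert_space_transfer) (simp_all add: Rn_add Rn_scale ip_nat)
  then show ?thesis by (simp add: k H_nat)
next
  case False
  then show ?thesis using scale unfolding is_hilbert_scale_def by auto
qed

sublocale H: hilb "Hsp P n" "ips P n" for n
  by unfold_locales (rule hilbert_H)

lemma H_Suc_subset: "H (n + 1) \<subseteq> H n"
proof (cases "0 \<le> n")
  case True
  then obtain k where k: "n = int k" using nonneg_int_cases by blast
  have "H (int (Suc k)) \<subseteq> H (int k)"
    unfolding H_nat[of "Suc k"] H_nat[of k] using R_mem by (auto simp: funpow_swap1)
  then show ?thesis by (simp add: k add.commute)
next
  case False
  then show ?thesis using scale unfolding is_hilbert_scale_def by auto
qed

lemma H_mono: "k \<le> n \<Longrightarrow> H n \<subseteq> H k"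
proof -
  have "H (k + int j) \<subseteq> H k" for j
  proof (induction j)
    case (Suc j)
    then show ?case using H_Suc_subset[of "k + int j"] by (auto simp: algebra_simps)
  qed simp
  then show "k \<le> n \<Longrightarrow> H n \<subseteq> H k" by (metis zle_iff_zadd)
qed

text \<open>By symmetry the square of the norm of \<open>R u\<close> is the inner product of
  \<open>u\<close> with \<open>R (R u)\<close>, and \<open>R\<close> composed with itself inverts
  \<open>A\<close>, which is bounded because \<open>z1\<close> is in the resolvent set. Hence the
  constant \<open>sqrt C\<close>.\<close>

lemma R_bounded: "\<exists>C. \<forall>u\<in>H 0. ipnorm (ip 0) (R u) \<le> C * ipnorm (ip 0) u"
proof -
  obtain C where C: "C > 0" "\<And>f. f \<in> H 2 \<Longrightarrow> ipnorm (ip 0) f \<le> C * ipnorm (ip 0) (A f)"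
    using L0.lower_bound_obtain[of "z1c P"] z1_res unfolding res_L_def A_def by blast
  have "ipnorm (ip 0) (R u) \<le> sqrt C * ipnorm (ip 0) u" if u: "u \<in> H 0" for u
  proof -
    have "(ipnorm (ip 0) (R u))\<^sup>2 = Re (ip 0 u (R (R u)))"
      using u by (simp add: L0.norm_square R_mem R_symmetric)
    also have "\<dots> \<le> ipnorm (ip 0) u * ipnorm (ip 0) (R (R u))"
      using u by (intro order_trans[OF complex_Re_le_cmod L0.Cauchy_Schwarz] R_mem)
    also have "\<dots> \<le> ipnorm (ip 0) u * (C * ipnorm (ip 0) u)"
      using C(2)[OF RR_mem[OF u]] u by (intro mult_left_mono) (simp_all add: A_RR)
    also have "\<dots> = (sqrt C * ipnorm (ip 0) u)\<^sup>2"
      using C(1) by (simp add: power_mult_distrib power2_eq_square)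
    finally have "(ipnorm (ip 0) (R u))\<^sup>2 \<le> (sqrt C * ipnorm (ip 0) u)\<^sup>2" .
    then show ?thesis
      by (rule power2_le_imp_le) (use u C(1) in simp)
  qed
  then show ?thesis by (intro exI[of _ "sqrt C"]) simp
qed

lemma norm_Suc_bounded: "\<exists>C. \<forall>f\<in>H (n + 1). ipnorm (ip n) f \<le> C * ipnorm (ip (n + 1)) f"
proof (cases "0 \<le> n")
  case True
  then obtain k where k: "n = int k" using nonneg_int_cases by blast
  then have k1: "n + 1 = int (Suc k)" by simp
  obtain C where C: "\<And>u. u \<in> H 0 \<Longrightarrow> ipnorm (ip 0) (R u) \<le> C * ipnorm (ip 0) u"
    using R_bounded by blast
  have "ipnorm (ip (int k)) f \<le> C * ipnorm (ip (int (Suc k))) f" if f: "f \<in> H (int (Suc k))" for f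
  proof -
    obtain u where u: "u \<in> H 0" "f = (R ^^ Suc k) u" using f H_nat by blast
    have "ipnorm (ip (int k)) f = ipnorm (ip 0) (R u)"
      using norm_nat[OF R_mem[OF u(1)], of k] u(2) by (simp add: funpow_swap1)
    moreover have "ipnorm (ip (int (Suc k))) f = ipnorm (ip 0) u"
      unfolding u(2) using u(1) by (rule norm_nat)
    ultimately show ?thesis using C[OF u(1)] by simp
  qed
  then show ?thesis unfolding k1 unfolding k by blast
next
  case False
  then show ?thesis using scale unfolding is_hilbert_scale_def by auto
qed

lemma norm_add2_bounded: "\<exists>C. \<forall>f\<in>H (n + 2). ipnorm (ip n) f \<le> C * ipnorm (ip (n + 2)) f"
proof -
  obtain C where C: "\<And>f. f \<in> H (n + 1) \<Longrightarrow> ipnorm (ip n) f \<le> C * ipnorm (ip (n + 1)) f"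
    using norm_Suc_bounded by blast
  obtain C' where C': "\<And>f. f \<in> H (n + 2) \<Longrightarrow> ipnorm (ip (n + 1)) f \<le> C' * ipnorm (ip (n + 2)) f"
    using norm_Suc_bounded[of "n + 1"] by (auto simp: algebra_simps)
  have "ipnorm (ip n) f \<le> (\<bar>C\<bar> * C') * ipnorm (ip (n + 2)) f" if f: "f \<in> H (n + 2)" for f
  proof -
    have f1: "f \<in> H (n + 1)" using H_mono[of "n + 1" "n + 2"] f by auto
    have "ipnorm (ip n) f \<le> \<bar>C\<bar> * ipnorm (ip (n + 1)) f"
      using C[OF f1] f1 by (smt (verit) H.norm_nonneg mult_right_mono)
    also have "\<dots> \<le> \<bar>C\<bar> * (C' * ipnorm (ip (n + 2)) f)"
      using C'[OF f] by (intro mult_left_mono) auto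
    finally show ?thesis by simp
  qed
  then show ?thesis by blast
qed

section \<open>The action of \<open>L\<close> and of \<open>A\<close> on the scale\<close>

lemma L_mem: "f \<in> H (n + 2) \<Longrightarrow> L f \<in> H n"
  using scale unfolding is_hilbert_scale_def by blast

lemma L_add: "f \<in> H n \<Longrightarrow> g \<in> H n \<Longrightarrow> L (f + g) = L f + L g"
proof -
  have "\<forall>f\<in>H (n - 2 + 2). \<forall>g\<in>H (n - 2 + 2). L (f + g) = L f + L g"
    using scale unfolding is_hilbert_scale_def by blast
  then show "f \<in> H n \<Longrightarrow> g \<in> H n \<Longrightarrow> L (f + g) = L f + L g" by simp
qed

lemma L_scale: "f \<in> H n \<Longrightarrow> L (a *\<^sub>C f) = a *\<^sub>C L f"
proof -
  have "\<forall>f\<in>H (n - 2 + 2). \<forall>a. L (a *\<^sub>C f) = a *\<^sub>C L f"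
    using scale unfolding is_hilbert_scale_def by blast
  then show "f \<in> H n \<Longrightarrow> L (a *\<^sub>C f) = a *\<^sub>C L f" by simp
qed

lemma L_diff: "f \<in> H n \<Longrightarrow> g \<in> H n \<Longrightarrow> L (f - g) = L f - L g"
  using L_add[of f n "(-1) *\<^sub>C g"] L_scale[of g n "-1"] by simp

lemma L_bounded: "\<exists>C. \<forall>f\<in>H (n + 2). ipnorm (ip n) (L f) \<le> C * ipnorm (ip (n + 2)) f"
  using scale unfolding is_hilbert_scale_def by blast

lemma H_add2: "f \<in> H (n + 2) \<Longrightarrow> f \<in> H n"
  using H_mono[of n "n + 2"] by auto

lemma shift_mem: "f \<in> H (n + 2) \<Longrightarrow> L f - z *\<^sub>C f \<in> H n"
  by (rule H.diff_mem[OF L_mem H.scale_mem[OF H_add2]])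

lemma shift_add:
  "f \<in> H n \<Longrightarrow> g \<in> H n \<Longrightarrow> L (f + g) - z *\<^sub>C (f + g) = (L f - z *\<^sub>C f) + (L g - z *\<^sub>C g)"
  using L_add by (simp add: scaleC_add_right)

lemma shift_diff:
  "f \<in> H n \<Longrightarrow> g \<in> H n \<Longrightarrow> L (f - g) - z *\<^sub>C (f - g) = (L f - z *\<^sub>C f) - (L g - z *\<^sub>C g)"
  using L_diff by (simp add: complex_vector.scale_right_diff_distrib)

lemma shift_scale:
  "f \<in> H n \<Longrightarrow> L (a *\<^sub>C f) - z *\<^sub>C (a *\<^sub>C f) = a *\<^sub>C (L f - z *\<^sub>C f)"
  using L_scale by (simp add: complex_vector.scale_right_diff_distrib scaleC_scaleC mult.commute)

lemmas A_mem = shift_mem[where z = "z1c P", folded A_def]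
lemmas A_add = shift_add[where z = "z1c P", folded A_def]
lemmas A_diff = shift_diff[where z = "z1c P", folded A_def]
lemmas A_scale = shift_scale[where z = "z1c P", folded A_def]

lemma A_bounded: "\<exists>C. \<forall>f\<in>H (n + 2). ipnorm (ip n) (A f) \<le> C * ipnorm (ip (n + 2)) f"
proof -
  obtain C where C: "\<And>f. f \<in> H (n + 2) \<Longrightarrow> ipnorm (ip n) (L f) \<le> C * ipnorm (ip (n + 2)) f"
    using L_bounded by blast
  obtain C' where C': "\<And>f. f \<in> H (n + 2) \<Longrightarrow> ipnorm (ip n) f \<le> C' * ipnorm (ip (n + 2)) f"
    using norm_add2_bounded by blast
  have "ipnorm (ip n) (A f) \<le> (C + \<bar>z1 P\<bar> * C') * ipnorm (ip (n + 2)) f" if f: "f \<in> H (n + 2)" for f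
  proof -
    have "ipnorm (ip n) (A f) \<le> ipnorm (ip n) (L f) + \<bar>z1 P\<bar> * ipnorm (ip n) f"
      unfolding A_def using H.norm_triangle_diff[of "L f" n "z1c P *\<^sub>C f"] L_mem[OF f] H_add2[OF f]
      by (simp add: H.norm_scale)
    also have "\<dots> \<le> C * ipnorm (ip (n + 2)) f + \<bar>z1 P\<bar> * (C' * ipnorm (ip (n + 2)) f)"
      using C[OF f] C'[OF f] by (intro add_mono mult_left_mono) auto
    finally show ?thesis by (simp add: algebra_simps)
  qed
  then show ?thesis by blast
qed

lemma A_Rn: "u \<in> H 0 \<Longrightarrow> A ((R ^^ (n + 2)) u) = (R ^^ n) u"
proof -
  assume u: "u \<in> H 0"
  have "(R ^^ (n + 2)) u = R (R ((R ^^ n) u))" by simp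
  then show ?thesis using A_RR[OF Rn_mem[OF u, of n]] by simp
qed

text \<open>For \<open>g\<close> orthogonal to the range of the symmetric injective operator
  \<open>R ^^ n\<close>, test with its value at \<open>(R ^^ n) g\<close>: this gives norm zero for
  \<open>(R ^^ n) g\<close>.\<close>

lemma Rn_range_dense:
  assumes u: "u \<in> H 0" and e: "e > 0"
  shows "\<exists>v\<in>H 0. ipnorm (ip 0) (u - (R ^^ n) v) < e"
proof -
  have "\<exists>x\<in>(R ^^ n) ` H 0. ipnorm (ip 0) (u - x) < e"
  proof (rule L0.dense_if_orthogonal_trivial[OF _ _ _ u e])
    show "complex_vector.subspace ((R ^^ n) ` H 0)" using H.subspace[of "int n"] by (simp add: H_nat)
    fix g assume g: "g \<in> H 0" "\<And>x. x \<in> (R ^^ n) ` H 0 \<Longrightarrow> ip 0 x g = 0"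
    have "ip 0 ((R ^^ n) ((R ^^ n) g)) g = 0" using g Rn_mem by blast
    then have "ip 0 ((R ^^ n) g) ((R ^^ n) g) = 0" using g(1) by (simp add: Rn_symmetric Rn_mem)
    then have "(R ^^ n) g = 0" using L0.ip_pos[OF Rn_mem[OF g(1)], of n] by auto
    moreover have "(R ^^ n) 0 = 0" using Rn_scale[of 0 n 0] by simp
    ultimately show "g = 0" using inj_Rn[of n] g(1) L0.zero_mem unfolding inj_on_def by metis
  qed (use Rn_mem in auto)
  then show ?thesis by blast
qed

text \<open>The levels \<open>j\<close> are those of the form \<open>n + 2\<close> with
  \<open>n < 0\<close>, as needed to extend the isometry of \<open>A\<close>. For
  \<open>j = - k\<close> the space \<open>H 0\<close> is dense by hypothesis, and on it the norm is
  that of \<open>(R ^^ k) g\<close> in \<open>H 0\<close>; approximating this vector by some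
  \<open>(R ^^ (k + 2)) v\<close> amounts to approximating \<open>g\<close> by
  \<open>R (R v)\<close>, which lies in \<open>H 2\<close>.\<close>

lemma H2_dense:
  assumes j: "j \<le> 1" and f: "f \<in> H j" and e: "e > 0"
  shows "\<exists>g\<in>H 2. ipnorm (ip j) (f - g) < e"
proof (cases "j = 1")
  case True
  then obtain v where v: "v \<in> H 0" "f = R v" using f H_nat[of 1] by auto
  obtain w where w: "w \<in> H 0" "ipnorm (ip 0) (v - R w) < e"
    using Rn_range_dense[OF v(1) e, of 1] by auto
  have "ipnorm (ip j) (f - R (R w)) = ipnorm (ip 0) (v - R w)"
    using norm_nat[of "v - R w" 1] Rn_diff[of v "R w" 1] v w True R_mem by simp
  then show ?thesis using w RR_mem by (intro bexI[of _ "R (R w)"]) auto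
next
  case False
  then obtain k where k: "j = - int k" using j by (metis add.inverse_inverse linorder_not_le
        nonneg_int_cases zle_add1_eq_le add.commute neg_0_le_iff_le order_less_le zless_imp_add1_zle
        add_0)
  obtain g0 where g0: "g0 \<in> H 0" "ipnorm (ip j) (f - g0) < e / 2"
  proof (cases "k = 0")
    case True
    then show thesis using that[of f] f e k by auto
  next
    case False
    have "\<forall>n<0. \<forall>f\<in>H n. \<forall>e>0. \<exists>g\<in>H 0. ipnorm (ip n) (f - g) < e"
      using scale unfolding is_hilbert_scale_def by blast
    moreover have "j < 0" "e / 2 > 0" using k False e by auto
    ultimately show thesis using that f by blast
  qed
  obtain v where v: "v \<in> H 0" "ipnorm (ip 0) ((R ^^ k) g0 - (R ^^ (k + 2)) v) < e / 2"
    using Rn_range_dense[OF Rn_mem[OF g0(1)], of "e/2" k "k + 2"] e by auto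
  let ?g = "R (R v)"
  have g: "?g \<in> H 2" "?g \<in> H 0" using v RR_mem R_mem by auto
  have sub: "H 0 \<subseteq> H j" using H_mono[of j 0] k by simp
  have "(R ^^ (k + 2)) v = (R ^^ k) ?g"
    by (simp add: funpow_swap1)
  then have "ipnorm (ip j) (g0 - ?g) < e / 2"
    using v norm_neg[of "g0 - ?g" k] g0 g k by (simp add: Rn_diff)
  then have "ipnorm (ip j) (f - ?g) < e"
    using g0(2) H.dist_triangle[OF f subsetD[OF sub g0(1)] subsetD[OF sub g(2)]] by simp
  then show ?thesis using g by blast
qed

text \<open>With \<open>f = R (R u)\<close> both sides are the norm of the same power of
  \<open>R\<close> at \<open>u\<close>. The case \<open>n = -1\<close> is separate because
  \<open>n + 2\<close> is then positive, and its norm is read off from a preimage under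
  \<open>R\<close> instead of an image.\<close>

lemma A_isometric_H2:
  assumes n: "n < 0" and f: "f \<in> H 2"
  shows "ipnorm (ip n) (A f) = ipnorm (ip (n + 2)) f"
proof -
  obtain u where u: "u \<in> H 0" "f = R (R u)" using f H_nat[of 2] by (auto simp: numeral_2_eq_2)
  have Af: "A f = u" using u A_RR by simp
  obtain k where k: "n = - int (Suc k)" using n by (metis int_cases not_le of_nat_0_le_iff)
  have lhs: "ipnorm (ip n) (A f) = ipnorm (ip 0) ((R ^^ Suc k) u)"
    using norm_neg[OF u(1), of "Suc k"] Af k by simp
  show ?thesis
  proof (cases k)
    case 0
    then have "ipnorm (ip (n + 2)) f = ipnorm (ip 0) (R u)"
      using norm_nat[OF R_mem[OF u(1)], of 1] u k by simp
    then show ?thesis using lhs 0 by simp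
  next
    case (Suc j)
    then have "n + 2 = - int j" using k by simp
    then have "ipnorm (ip (n + 2)) f = ipnorm (ip 0) ((R ^^ j) f)"
      using norm_neg[of f j] u R_mem by simp
    also have "(R ^^ j) f = (R ^^ Suc k) u" using u(2) Suc by (simp add: funpow_swap1)
    finally show ?thesis using lhs by simp
  qed
qed

text \<open>On negative levels \<open>L\<close> is known only as a continuous extension, so the
  identity is extended from \<open>H 2\<close> by density.\<close>

lemma A_isometric_neg:
  assumes n: "n < 0" and f: "f \<in> H (n + 2)"
  shows "ipnorm (ip n) (A f) = ipnorm (ip (n + 2)) f"
proof -
  have sub: "H 2 \<subseteq> H (n + 2)" using H_mono[of "n + 2" 2] n by simp
  have dense: "\<exists>g\<in>H 2. ipnorm (ip (n + 2)) (f - g) < e" if "e > 0" for e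
    using H2_dense[OF _ f that] n by simp
  obtain X where X: "\<And>i. X i \<in> H 2" "(\<lambda>i::nat. ipnorm (ip (n + 2)) (X i - f)) \<longlonglongrightarrow> 0"
    by (rule H.approximating_sequence[OF f dense sub]) (assumption, rule that, assumption+)
  have Xn: "X i \<in> H (n + 2)" for i using X sub by blast
  obtain C where C: "\<And>f. f \<in> H (n + 2) \<Longrightarrow> ipnorm (ip n) (A f) \<le> C * ipnorm (ip (n + 2)) f"
    using A_bounded by blast
  have "(\<lambda>i. ipnorm (ip n) (A (X i) - A f)) \<longlonglongrightarrow> 0"
  proof (rule tendsto_sandwich)
    show "\<forall>\<^sub>F i in sequentially. ipnorm (ip n) (A (X i) - A f) \<le> C * ipnorm (ip (n + 2)) (X i - f)"
      using C[of "X _ - f"] Xn f by (simp add: A_diff[OF Xn f])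
    show "\<forall>\<^sub>F i in sequentially. 0 \<le> ipnorm (ip n) (A (X i) - A f)"
      using Xn f by (simp add: A_mem)
    show "(\<lambda>i. C * ipnorm (ip (n + 2)) (X i - f)) \<longlonglongrightarrow> 0"
      using tendsto_mult_right_zero[OF X(2)] by simp
  qed simp
  then have "(\<lambda>i. ipnorm (ip n) (A (X i))) \<longlonglongrightarrow> ipnorm (ip n) (A f)"
    using Xn f by (intro H.tendsto_norm) (auto intro: A_mem)
  moreover have "(\<lambda>i. ipnorm (ip n) (A (X i))) \<longlonglongrightarrow> ipnorm (ip (n + 2)) f"
    using H.tendsto_norm[OF Xn f X(2)] A_isometric_H2[OF n X(1)] by simp
  ultimately show ?thesis using LIMSEQ_unique by blast
qed

lemma A_isometric: "f \<in> H (n + 2) \<Longrightarrow> ipnorm (ip n) (A f) = ipnorm (ip (n + 2)) f"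
proof (cases "0 \<le> n")
  case True
  assume f: "f \<in> H (n + 2)"
  obtain k where k: "n = int k" using True nonneg_int_cases by blast
  then have k2: "n + 2 = int (k + 2)" by simp
  obtain u where u: "u \<in> H 0" "f = (R ^^ (k + 2)) u" using f unfolding k2 H_nat by blast
  have "A f = (R ^^ k) u" using A_Rn[OF u(1)] u(2) by simp
  then have "ipnorm (ip n) (A f) = ipnorm (ip 0) u" unfolding k using norm_nat[OF u(1)] by simp
  moreover have "ipnorm (ip (n + 2)) f = ipnorm (ip 0) u"
    unfolding k2 u(2) using u(1) by (rule norm_nat)
  ultimately show ?thesis by simp
qed (use A_isometric_neg in auto)

text \<open>Injectivity is the isometry. For surjectivity on a negative level, approximate the
  target from \<open>H 0\<close>, where preimages are explicit, and let the isometry transport the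
  Cauchy property to them.\<close>

lemma A_bij: "bij_betw A (H (n + 2)) (H n)"
proof -
  have "inj_on A (H (n + 2))"
  proof (rule inj_onI)
    fix f g assume fg: "f \<in> H (n + 2)" "g \<in> H (n + 2)" "A f = A g"
    then have "ipnorm (ip (n + 2)) (f - g) = 0"
      using A_isometric[of "f - g" n] A_diff[of f "n + 2" g] by simp
    then show "f = g" using H.norm_eq_zero[of "f - g" "n + 2"] fg by simp
  qed
  moreover have "u \<in> A ` H (n + 2)" if u: "u \<in> H n" for u
  proof (cases "0 \<le> n")
    case True
    then obtain k where k: "n = int k" using nonneg_int_cases by blast
    then have k2: "n + 2 = int (k + 2)" by simp
    obtain v where v: "v \<in> H 0" "u = (R ^^ k) v" using u unfolding k H_nat by blast
    then show ?thesis using A_Rn[OF v(1), of k] Rn_mem_H[OF v(1), of "k + 2"] unfolding k2 by force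
  next
    case False
    then have n: "n < 0" by simp
    have sub: "H 0 \<subseteq> H n" using H_mono[of n 0] n by simp
    have sub2: "H 2 \<subseteq> H (n + 2)" using H_mono[of "n + 2" 2] n by simp
    have "\<forall>n<0. \<forall>f\<in>H n. \<forall>e>0. \<exists>g\<in>H 0. ipnorm (ip n) (f - g) < e"
      using scale unfolding is_hilbert_scale_def by blast
    then have dense: "\<exists>g\<in>H 0. ipnorm (ip n) (u - g) < e" if "e > 0" for e
      using n u that by blast
    obtain X where X: "\<And>i. X i \<in> H 0" "(\<lambda>i::nat. ipnorm (ip n) (X i - u)) \<longlonglongrightarrow> 0"
      by (rule H.approximating_sequence[OF u dense sub]) (assumption, rule that, assumption+)
    have Xn: "X i \<in> H n" for i using X sub by blast
    define F where "F i = R (R (X i))" for i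
    have F: "F i \<in> H (n + 2)" "A (F i) = X i" for i
      using RR_mem[OF X(1), of i] sub2 A_RR[OF X(1)] by (auto simp: F_def)
    have Fd: "ipnorm (ip (n + 2)) (F i - f) = ipnorm (ip n) (X i - A f)" if "f \<in> H (n + 2)" for i f
      using A_isometric[of "F i - f" n] A_diff[OF F(1) that] F that by simp
    obtain f where f: "f \<in> H (n + 2)" "(\<lambda>i. ipnorm (ip (n + 2)) (F i - f)) \<longlonglongrightarrow> 0"
    proof (rule H.complete[of F "n + 2"])
      fix e :: real assume "e > 0"
      then show "\<exists>N. \<forall>i\<ge>N. \<forall>k\<ge>N. ipnorm (ip (n + 2)) (F i - F k) < e"
        using H.convergent_Cauchy[OF Xn u X(2)] Fd[OF F(1)] F(2) by simp
    qed (use F in auto)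
    then have "(\<lambda>i. ipnorm (ip n) (X i - A f)) \<longlonglongrightarrow> 0" using Fd by simp
    then have "A f = u" using H.limit_unique[OF Xn A_mem[OF f(1)] u _ X(2)] by simp
    then show ?thesis using f by blast
  qed
  ultimately show ?thesis unfolding bij_betw_def using A_mem by blast
qed

end


section \<open>Resolvents on the scale and the duality pairing\<close>

context hilbert_scale begin

text \<open>Intertwining with \<open>R ^^ k\<close> makes \<open>L\<close> at level \<open>k\<close>
  unitarily equivalent to \<open>L\<close> at level 0; self-adjointness and resolvent bounds are
  carried over by it.\<close>

lemma L_Rn:
  assumes f: "f \<in> H 2"
  shows "(R ^^ k) f \<in> H (int k + 2)" "L ((R ^^ k) f) = (R ^^ k) (L f)"
proof -
  obtain u where u: "u \<in> H 0" "f = R (R u)" using f H_nat[of 2] by (auto simp: numeral_2_eq_2)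
  have f0: "f \<in> H 0" using u R_mem by simp
  have f': "(R ^^ k) f = (R ^^ (k + 2)) u" using u(2) by (simp add: funpow_swap1)
  then show "(R ^^ k) f \<in> H (int k + 2)" using Rn_mem_H[OF u(1), of "k + 2"]
    by (simp add: add.commute)
  have "A ((R ^^ k) f) = (R ^^ k) (A f)" unfolding f' A_Rn[OF u(1)] using u A_RR by simp
  then show "L ((R ^^ k) f) = (R ^^ k) (L f)"
    using f0 L0.range_mem[OF f] by (simp add: A_def Rn_diff Rn_scale)
qed

lemma H_nat_add2: "H (int k + 2) = (R ^^ k) ` H 2"
proof
  show "H (int k + 2) \<subseteq> (R ^^ k) ` H 2"
  proof
    fix f assume "f \<in> H (int k + 2)"
    then have "f \<in> H (int (k + 2))" by (simp add: add.commute)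
    then obtain u where u: "u \<in> H 0" "f = (R ^^ (k + 2)) u" unfolding H_nat by blast
    then have "f = (R ^^ k) (R (R u))" by (simp add: funpow_swap1)
    then show "f \<in> (R ^^ k) ` H 2" using RR_mem[OF u(1)] by blast
  qed
qed (use L_Rn in blast)

lemma selfadjoint_H: "selfadjoint (H (int k)) (ip (int k)) (H (int k + 2)) L"
proof unfold_locales
  have mem2: "f \<in> H 0" if "f \<in> H 2" for f using that by (rule L0.dom_mem)
  have ipL: "ip (int k) ((R ^^ k) f) ((R ^^ k) v) = ip 0 f v"
    "ip (int k) (L ((R ^^ k) f)) ((R ^^ k) v) = ip 0 (L f) v" if "f \<in> H 2" "v \<in> H 0" for f v
    using that mem2 L_Rn L0.range_mem ip_nat by simp_all
  have "(g, g') \<in> op_graph (H (int k + 2)) L \<longleftrightarrow>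
      (g, g') \<in> rel_adjoint (H (int k)) (ip (int k)) (op_graph (H (int k + 2)) L)" (is "?l = ?r") for g g'
  proof
    assume ?l
    then obtain f where f: "f \<in> H 2" "g = (R ^^ k) f" "g' = L ((R ^^ k) f)"
      unfolding op_graph_def H_nat_add2 by auto
    have "ip (int k) ((R ^^ k) h) g' = ip (int k) (L ((R ^^ k) h)) g" if h: "h \<in> H 2" for h
      using ipL[OF h mem2[OF f(1)]] ipL[OF h L0.range_mem[OF f(1)]] f L_Rn[OF f(1)]
        L0.symmetric[OF h f(1)] by simp
    moreover have "g \<in> H (int k)" "g' \<in> H (int k)"
      using f L_Rn[OF f(1)] mem2 L0.range_mem Rn_mem_H by simp_all
    ultimately show ?r unfolding rel_adjoint_def op_graph_def H_nat_add2 by auto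
  next
    assume r: ?r
    then have "g \<in> H (int k)" "g' \<in> H (int k)"
      and adj: "\<And>h. h \<in> H (int k + 2) \<Longrightarrow> ip (int k) h g' = ip (int k) (L h) g"
      unfolding rel_adjoint_def op_graph_def by auto
    then obtain u v where uv: "u \<in> H 0" "g = (R ^^ k) u" "v \<in> H 0" "g' = (R ^^ k) v"
      unfolding H_nat by blast
    have "u \<in> H 2 \<and> L u = v"
    proof (rule L0.adjointI)
      fix f assume f: "f \<in> H 2"
      show "ip 0 f v = ip 0 (L f) u"
        using adj[OF L_Rn(1)[OF f]] ipL[OF f uv(1)] ipL[OF f uv(3)] uv by simp
    qed (use uv in auto)
    then show ?l unfolding op_graph_def using uv L_Rn[of u k] by auto
  qed
  then show "selfadjoint_op (H (int k)) (ip (int k)) (H (int k + 2)) L"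
    unfolding selfadjoint_op_def by auto
qed

text \<open>The same constant serves all nonnegative levels because the equivalence by
  \<open>R ^^ k\<close> is isometric.\<close>

lemma lower_bound_H:
  assumes "z \<in> res_L P"
  obtains C where "C > 0"
    "\<And>k f. f \<in> H (int k + 2) \<Longrightarrow> ipnorm (ip (int k)) f \<le> C * ipnorm (ip (int k)) (L f - z *\<^sub>C f)"
proof -
  obtain C where C: "C > 0" "\<And>f. f \<in> H 2 \<Longrightarrow> ipnorm (ip 0) f \<le> C * ipnorm (ip 0) (L f - z *\<^sub>C f)"
    using assms unfolding res_L_def by (rule L0.lower_bound_obtain) blast
  have "ipnorm (ip (int k)) f \<le> C * ipnorm (ip (int k)) (L f - z *\<^sub>C f)" if f: "f \<in> H (int k + 2)" for k f
  proof -
    obtain g where g: "g \<in> H 2" "f = (R ^^ k) g" using f H_nat_add2 by blast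
    have g0: "g \<in> H 0" "L g \<in> H 0" using g(1) L0.dom_mem L0.range_mem by auto
    have "L f - z *\<^sub>C f = (R ^^ k) (L g - z *\<^sub>C g)"
      using g g0 L_Rn[OF g(1), of k] by (simp add: Rn_diff Rn_scale)
    then show ?thesis
      using C(2)[OF g(1)] g g0 norm_nat[of g k] norm_nat[of "L g - z *\<^sub>C g" k] by simp
  qed
  then show thesis using that C(1) by blast
qed

text \<open>Nonnegative levels follow from self-adjointness. To descend from level
  \<open>n + 2\<close> to level \<open>n\<close>, conjugate with the bijection \<open>A\<close>,
  which commutes with \<open>L - z\<close>.\<close>

lemma shift_bij:
  assumes z: "z \<in> res_L P"
  shows "bij_betw (\<lambda>f. L f - z *\<^sub>C f) (H (n + 2)) (H n)"
proof -
  let ?B = "\<lambda>f. L f - z *\<^sub>C f"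
  obtain C where C: "C > 0"
    "\<And>k f. f \<in> H (int k + 2) \<Longrightarrow> ipnorm (ip (int k)) f \<le> C * ipnorm (ip (int k)) (?B f)"
    using z by (rule lower_bound_H) blast
  have nonneg: "bij_betw ?B (H (int k + 2)) (H (int k))" for k
    using selfadjoint_H C(2) by (rule selfadjoint.lower_bound_imp_bij)
  have down: "bij_betw ?B (H (n + 2)) (H n)" if b: "bij_betw ?B (H (n + 2 + 2)) (H (n + 2))" for n
  proof -
    have comm: "?B (A f) = A (?B f)" if f: "f \<in> H (n + 2 + 2)" for f
    proof -
      have f2: "f \<in> H (n + 2)" "L f \<in> H (n + 2)" using H_add2[OF f] L_mem[OF f] by auto
      have "L (A f) = L (L f) - z1c P *\<^sub>C L f" "L (?B f) = L (L f) - z *\<^sub>C L f"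
        using f2 by (simp_all add: A_def L_diff[of _ "n + 2"] L_scale[of _ "n + 2"])
      then show ?thesis
        by (simp add: A_def complex_vector.scale_right_diff_distrib scaleC_scaleC mult.commute)
    qed
    have A1: "A ` H (n + 2 + 2) = H (n + 2)" and A2: "A ` H (n + 2) = H n"
      and B1: "?B ` H (n + 2 + 2) = H (n + 2)"
      using A_bij b bij_betw_imp_surj_on by blast+
    have "?B ` H (n + 2) = ?B ` A ` H (n + 2 + 2)" using A1 by simp
    also have "\<dots> = A ` ?B ` H (n + 2 + 2)" unfolding image_image using comm by (rule image_cong[OF refl])
    also have "\<dots> = H n" using A2 B1 by simp
    finally have img: "?B ` H (n + 2) = H n" .
    have "inj_on ?B (H (n + 2))"
    proof (rule inj_onI)
      fix f g assume fg: "f \<in> H (n + 2)" "g \<in> H (n + 2)" "?B f = ?B g"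
      obtain f' g' where f': "f' \<in> H (n + 2 + 2)" "f = A f'" and g': "g' \<in> H (n + 2 + 2)" "g = A g'"
        using fg A1 by blast
      have "A (?B f') = A (?B g')" using fg comm f' g' by simp
      then have "?B f' = ?B g'"
        using bij_betw_imp_inj_on[OF A_bij[of n]] shift_mem[OF f'(1)] shift_mem[OF g'(1)]
        unfolding inj_on_def by blast
      then have "f' = g'" using bij_betw_imp_inj_on[OF b] f' g' unfolding inj_on_def by blast
      then show "f = g" using f' g' by simp
    qed
    then show ?thesis using img unfolding bij_betw_def by blast
  qed
  \<comment> \<open>Each use of \<open>down\<close> lowers the level by two, so \<open>j\<close>
    uses reach \<open>n\<close> from \<open>n + 2 * int j\<close>; the choice
    \<open>j = nat (- n)\<close> makes that starting level nonnegative for every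
    \<open>n\<close>.\<close>
  have "\<forall>n. 0 \<le> n + 2 * int j \<longrightarrow> bij_betw ?B (H (n + 2)) (H n)" for j
  proof (induction j)
    case 0
    then show ?case using nonneg by (auto elim!: nonneg_int_cases)
  next
    case (Suc j)
    show ?case
    proof (intro allI impI)
      fix n assume "0 \<le> n + 2 * int (Suc j)"
      then have "bij_betw ?B (H (n + 2 + 2)) (H (n + 2))" using Suc[rule_format, of "n + 2"] by simp
      then show "bij_betw ?B (H (n + 2)) (H n)" by (rule down)
    qed
  qed
  from this[of "nat (- n)", rule_format, of n] show ?thesis by simp
qed

section \<open>The resolvent as one map on the union of the scale\<close>

lemma inj_shift:
  assumes z: "z \<in> res_L P"
  shows "inj_on (\<lambda>f. L f - z *\<^sub>C f) (\<Union>n. H n)"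
proof (rule inj_onI)
  fix f g assume fg: "f \<in> (\<Union>n. H n)" "g \<in> (\<Union>n. H n)" "L f - z *\<^sub>C f = L g - z *\<^sub>C g"
  then obtain a b where "f \<in> H a" "g \<in> H b" by blast
  then have "f \<in> H (min a b - 2 + 2)" "g \<in> H (min a b - 2 + 2)"
    using H_mono[of "min a b" a] H_mono[of "min a b" b] by auto
  then show "f = g" using bij_betw_imp_inj_on[OF shift_bij[OF z]] fg(3) unfolding inj_on_def by blast
qed

lemma resolv_eqI:
  assumes "z \<in> res_L P" "f \<in> H n" "L f - z *\<^sub>C f = g"
  shows "resolv P z g = f"
  unfolding resolv_def using assms by (intro the_inv_into_f_eq inj_shift) auto

lemma resolv:
  assumes z: "z \<in> res_L P" and g: "g \<in> H n"
  shows resolv_mem: "resolv P z g \<in> H (n + 2)"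
    and shift_resolv: "L (resolv P z g) - z *\<^sub>C resolv P z g = g"
proof -
  have "g \<in> (\<lambda>f. L f - z *\<^sub>C f) ` H (n + 2)"
    using bij_betw_imp_surj_on[OF shift_bij[OF z]] g by simp
  then obtain f where f: "f \<in> H (n + 2)" "L f - z *\<^sub>C f = g" by blast
  then have "resolv P z g = f" by (intro resolv_eqI z)
  then show "resolv P z g \<in> H (n + 2)" "L (resolv P z g) - z *\<^sub>C resolv P z g = g" using f by simp_all
qed

lemma resolv_add:
  assumes z: "z \<in> res_L P" and f: "f \<in> H n" and g: "g \<in> H n"
  shows "resolv P z (f + g) = resolv P z f + resolv P z g"
  by (rule resolv_eqI[OF z, of _ "n + 2"])
    (simp_all add: resolv[OF z f] resolv[OF z g] shift_add[OF resolv_mem[OF z f] resolv_mem[OF z g]])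

lemma resolv_scale:
  assumes z: "z \<in> res_L P" and f: "f \<in> H n"
  shows "resolv P z (a *\<^sub>C f) = a *\<^sub>C resolv P z f"
  by (rule resolv_eqI[OF z, of _ "n + 2"])
    (simp_all only: H.scale_mem resolv[OF z f] shift_scale[OF resolv_mem[OF z f]])

lemma resolvent_identity:
  assumes z: "z \<in> res_L P" and w: "w \<in> res_L P" and g: "g \<in> H n"
  shows "resolv P w g - resolv P z g = (w - z) *\<^sub>C resolv P w (resolv P z g)"
proof -
  have zg: "resolv P z g \<in> H (n + 2)" and wg: "resolv P w g \<in> H (n + 2)"
    using resolv_mem z w g by auto
  have "resolv P w ((w - z) *\<^sub>C resolv P z g) = resolv P w g - resolv P z g"
  proof (rule resolv_eqI[OF w, of _ "n + 2"])
    show "L (resolv P w g - resolv P z g) - w *\<^sub>C (resolv P w g - resolv P z g) = (w - z) *\<^sub>C resolv P z g"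
      using shift_resolv[OF z g] shift_resolv[OF w g] unfolding shift_diff[OF wg zg]
      by (simp add: complex_vector.scale_left_diff_distrib algebra_simps)
  qed (use zg wg in simp)
  then show ?thesis using resolv_scale[OF w zg] by simp
qed

text \<open>Two uses of the resolvent identity give the remainder \<open>(w - z)\<close> squared
  times \<open>resolv P w (resolv P z u)\<close> with \<open>u = resolv P z g\<close>. The bound is
  in terms of \<open>u\<close>, not \<open>g\<close>, because \<open>g\<close> is only required to
  lie in \<open>H (k - 2)\<close>, as for the vectors \<open>hvec P \<sigma> m\<close> when
  \<open>k = mm P\<close>. The constant is \<open>C\<close> for the resolvent at \<open>z\<close>
  times \<open>2 * C\<close> for the one at \<open>w\<close>.\<close>

lemma resolv_expansion:
  assumes z: "z \<in> res_L P"
  shows "\<exists>C\<ge>0. \<exists>\<delta>>0. \<forall>w\<in>res_L P. cmod (w - z) < \<delta> \<longrightarrow> (\<forall>g\<in>H (int k - 2).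
    ipnorm (ip (int k)) (resolv P w g - resolv P z g - (w - z) *\<^sub>C resolv P z (resolv P z g))
      \<le> C * (cmod (w - z))\<^sup>2 * ipnorm (ip (int k)) (resolv P z g))"
proof -
  interpret S: selfadjoint "H (int k)" "ip (int k)" "H (int k + 2)" L by (rule selfadjoint_H)
  obtain C where C: "C > 0"
    "\<And>k f. f \<in> H (int k + 2) \<Longrightarrow> ipnorm (ip (int k)) f \<le> C * ipnorm (ip (int k)) (L f - z *\<^sub>C f)"
    using z by (rule lower_bound_H) blast
  let ?n = "ipnorm (ip (int k))"
  have bz: "?n (resolv P z g) \<le> C * ?n g" if g: "g \<in> H (int k)" for g
    using C(2)[OF resolv_mem[OF z g]] shift_resolv[OF z g] by simp
  have bw: "?n (resolv P w g) \<le> 2 * C * ?n g"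
    if g: "g \<in> H (int k)" and w: "w \<in> res_L P" "cmod (w - z) * C \<le> 1 / 2" for g w
    using S.lower_bound_nearby[OF C(1) C(2) w(2) resolv_mem[OF w(1) g]] shift_resolv[OF w(1) g] by simp
  have "?n (resolv P w g - resolv P z g - (w - z) *\<^sub>C resolv P z (resolv P z g))
      \<le> 2 * C * C * (cmod (w - z))\<^sup>2 * ?n (resolv P z g)"
    if w: "w \<in> res_L P" "cmod (w - z) < 1 / (2 * C)" and g: "g \<in> H (int k - 2)" for w g
  proof -
    define u where "u = resolv P z g"
    have u: "u \<in> H (int k)" using resolv_mem[OF z g] by (simp add: u_def)
    have zu: "resolv P z u \<in> H (int k)" using resolv_mem[OF z u] H_add2 by blast
    have wu: "resolv P w (resolv P z u) \<in> H (int k)" using resolv_mem[OF w(1) zu] H_add2 by blast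
    have small: "cmod (w - z) * C \<le> 1 / 2" using w(2) C(1) by (simp add: field_simps)
    have "resolv P w g - resolv P z g - (w - z) *\<^sub>C resolv P z u =
        (w - z) *\<^sub>C (resolv P w u - resolv P z u)"
      using resolvent_identity[OF z w(1) g]
      by (simp add: u_def complex_vector.scale_right_diff_distrib)
    also have "\<dots> = (w - z) *\<^sub>C ((w - z) *\<^sub>C resolv P w (resolv P z u))"
      using resolvent_identity[OF z w(1) u] by simp
    finally have "?n (resolv P w g - resolv P z g - (w - z) *\<^sub>C resolv P z u) =
        (cmod (w - z))\<^sup>2 * ?n (resolv P w (resolv P z u))"
      using wu by (simp add: H.norm_scale power2_eq_square norm_mult)
    also have "\<dots> \<le> (cmod (w - z))\<^sup>2 * (2 * C * (C * ?n u))"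
    proof (intro mult_left_mono)
      have "?n (resolv P w (resolv P z u)) \<le> 2 * C * ?n (resolv P z u)"
        using bw[OF zu w(1) small] .
      also have "\<dots> \<le> 2 * C * (C * ?n u)" using bz[OF u] C(1) by (intro mult_left_mono) auto
      finally show "?n (resolv P w (resolv P z u)) \<le> 2 * C * (C * ?n u)" .
    qed simp
    finally show ?thesis by (simp add: u_def mult_ac)
  qed
  then show ?thesis
    using C(1) by (intro exI[of _ "2 * C * C"] conjI exI[of _ "1 / (2 * C)"]) auto
qed

lemma nonreal_in_res: "Im z \<noteq> 0 \<Longrightarrow> z \<in> res_L P"
  unfolding res_L_def by (rule L0.nonreal_in_resolvent_set)

lemma open_res: "open (res_L P)"
  unfolding res_L_def by (rule L0.open_resolvent_set)

lemma A_symmetric: "f \<in> H (int k + 2) \<Longrightarrow> g \<in> H (int k + 2) \<Longrightarrow> ip (int k) f (A g) = ip (int k) (A f) g"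
proof -
  interpret S: selfadjoint "H (int k)" "ip (int k)" "H (int k + 2)" L by (rule selfadjoint_H)
  show "f \<in> H (int k + 2) \<Longrightarrow> g \<in> H (int k + 2) \<Longrightarrow> ip (int k) f (A g) = ip (int k) (A f) g"
    by (simp add: A_def H.ip_diff_left H.ip_diff_right H.ip_scale_left H.ip_scale_right S.dom_mem
        S.range_mem S.symmetric)
qed

lemma A_ip:
  assumes "f \<in> H (int k + 2)" "g \<in> H (int k + 2)"
  shows "ip (int k) (A f) (A g) = ip (int k + 2) f g"
proof -
  have k2: "int k + 2 = int (k + 2)" by simp
  obtain u v where u: "u \<in> H 0" "f = (R ^^ (k + 2)) u" and v: "v \<in> H 0" "g = (R ^^ (k + 2)) v"
    using assms unfolding k2 H_nat by blast
  have "ip (int k + 2) f g = ip 0 u v" unfolding k2 u(2) v(2) using u(1) v(1) by (rule ip_nat)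
  moreover have "A f = (R ^^ k) u" "A g = (R ^^ k) v" using A_Rn u v by auto
  ultimately show ?thesis using ip_nat u(1) v(1) by simp
qed

section \<open>Powers of \<open>A\<close>, the vectors \<open>hvec\<close> and the duality
  pairing\<close>

lemma An_mem: "f \<in> H n \<Longrightarrow> (A ^^ j) f \<in> H (n - 2 * int j)"
proof (induction j)
  case (Suc j)
  then show ?case using A_mem[of "(A ^^ j) f" "n - 2 * int j - 2"] by (simp add: algebra_simps)
qed simp

lemma An_diff: "f \<in> H n \<Longrightarrow> g \<in> H n \<Longrightarrow> (A ^^ j) (f - g) = (A ^^ j) f - (A ^^ j) g"
  by (induction j) (simp_all add: A_diff[OF An_mem An_mem])

lemma An_surj: "g \<in> H n \<Longrightarrow> \<exists>f\<in>H (n + 2 * int j). (A ^^ j) f = g"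
proof (induction j arbitrary: n g)
  case (Suc j)
  have "g \<in> A ` H (n + 2)" using bij_betw_imp_surj_on[OF A_bij] Suc.prems by simp
  then obtain f where f: "f \<in> H (n + 2)" "A f = g" by blast
  obtain f' where "f' \<in> H (n + 2 + 2 * int j)" "(A ^^ j) f' = f" using Suc.IH[OF f(1)] by blast
  then show ?case using f by (intro bexI[of _ f']) (simp_all add: algebra_simps)
qed auto

lemma An_isometric: "f \<in> H n \<Longrightarrow> ipnorm (ip (n - 2 * int j)) ((A ^^ j) f) = ipnorm (ip n) f"
proof (induction j)
  case (Suc j)
  have "ipnorm (ip (n - 2 * int j - 2)) (A ((A ^^ j) f)) = ipnorm (ip (n - 2 * int j - 2 + 2)) ((A ^^ j) f)"
    using An_mem[OF Suc.prems, of j] by (intro A_isometric) simp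
  then show ?case using Suc by (simp add: algebra_simps)
qed simp

lemma inj_A: "inj_on A (\<Union>n. H n)"
  unfolding A_def by (rule inj_shift[OF z1_res])

lemma inj_An: "inj_on (A ^^ j) (\<Union>n. H n)"
proof (induction j)
  case (Suc j)
  show ?case
  proof (rule inj_onI)
    fix f g assume fg: "f \<in> (\<Union>n. H n)" "g \<in> (\<Union>n. H n)" "(A ^^ Suc j) f = (A ^^ Suc j) g"
    have "(A ^^ j) f \<in> (\<Union>n. H n)" "(A ^^ j) g \<in> (\<Union>n. H n)" using fg An_mem by blast+
    then have "(A ^^ j) f = (A ^^ j) g" using inj_onD[OF inj_A] fg(3) by simp
    then show "f = g" using inj_onD[OF Suc] fg by blast
  qed
qed simp

lemma b_op_eq: "b_op P j = A ^^ j"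
  by (simp add: b_op_def A_def[abs_def])

lemma hvec:
  assumes "phi P \<sigma> \<in> H n"
  shows hvec_mem: "hvec P \<sigma> j \<in> H (n + 2 * int j)" and An_hvec: "(A ^^ j) (hvec P \<sigma> j) = phi P \<sigma>"
proof -
  obtain f where f: "f \<in> H (n + 2 * int j)" "(A ^^ j) f = phi P \<sigma>" using An_surj[OF assms] by blast
  have "hvec P \<sigma> j = f"
    unfolding hvec_def b_op_eq using f by (intro the_inv_into_f_eq inj_An) auto
  then show "hvec P \<sigma> j \<in> H (n + 2 * int j)" "(A ^^ j) (hvec P \<sigma> j) = phi P \<sigma>" using f by simp_all
qed

lemma A_hvec:
  assumes "phi P \<sigma> \<in> H n"
  shows "A (hvec P \<sigma> (Suc j)) = hvec P \<sigma> j"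
proof -
  have mem: "A (hvec P \<sigma> (Suc j)) \<in> H (n + 2 * int j)"
    using hvec_mem[OF assms, of "Suc j"] by (intro A_mem) (simp add: algebra_simps)
  have "(A ^^ j) (A (hvec P \<sigma> (Suc j))) = (A ^^ j) (hvec P \<sigma> j)"
    using An_hvec[OF assms, of "Suc j"] An_hvec[OF assms, of j] by (simp add: funpow_swap1)
  then show ?thesis using inj_onD[OF inj_An] mem hvec_mem[OF assms, of j] by blast
qed

text \<open>\<open>A ^^ k\<close> maps \<open>H k\<close> isometrically to \<open>H (- k)\<close>,
  so convergence of \<open>X i\<close> there is convergence of its preimages in \<open>H k\<close>.
  For \<open>X i\<close> in \<open>H 0\<close> the preimage is \<open>R\<close> applied
  \<open>2 * k\<close> times, and symmetry of \<open>R ^^ k\<close> turns its inner product with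
  \<open>f\<close> in \<open>H k\<close> into the one of \<open>X i\<close> with \<open>f\<close> in
  \<open>H 0\<close>.\<close>

lemma duality_An:
  assumes w: "w \<in> H (int k)" and f: "f \<in> H (int k)" and k: "0 < k"
  shows "duality P (int k) ((A ^^ k) w) f = ip (int k) w f"
proof -
  obtain v where v: "v \<in> H 0" "f = (R ^^ k) v" using f H_nat by blast
  have mk: "int k - 2 * int k = - int k" by simp
  have lim: "(\<lambda>i. ip 0 (X i) f) \<longlonglongrightarrow> ip (int k) w f"
    if X: "range X \<subseteq> H 0" "(\<lambda>i. ipnorm (ip (- int k)) (X i - (A ^^ k) w)) \<longlonglongrightarrow> 0" for X :: "nat \<Rightarrow> 'h"
  proof -
    have X0: "X i \<in> H 0" for i using X(1) by auto
    define W where "W i = (R ^^ k) ((R ^^ k) (X i))" for i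
    have W: "W i \<in> H (int k)" for i using Rn_mem_H[OF Rn_mem[OF X0]] by (simp add: W_def)
    have AR: "(A ^^ j) ((R ^^ (j + j)) u) = u" if "u \<in> H 0" for u j
      using that
    proof (induction j)
      case (Suc j)
      have "(A ^^ Suc j) ((R ^^ (Suc j + Suc j)) u) = (A ^^ j) (A ((R ^^ (j + j + 2)) u))"
        by (simp add: funpow_swap1)
      also have "\<dots> = (A ^^ j) ((R ^^ (j + j)) u)" using A_Rn[OF Suc.prems] by simp
      finally show ?case using Suc by simp
    qed simp
    have AW: "(A ^^ k) (W i) = X i" for i using AR[OF X0, of k i] by (simp add: W_def funpow_add)
    have "ipnorm (ip (int k)) (W i - w) = ipnorm (ip (- int k)) (X i - (A ^^ k) w)" for i
      using An_isometric[of "W i - w" "int k" k] An_diff[OF W w, of k i] AW W w unfolding mk by simp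
    then have "(\<lambda>i. ip (int k) (W i) f) \<longlonglongrightarrow> ip (int k) w f"
      using X(2) by (intro H.tendsto_ip_left W w f) simp
    moreover have "ip (int k) (W i) f = ip 0 (X i) f" for i
      using ip_nat[OF Rn_mem[OF X0] v(1), of k k i] Rn_symmetric[OF X0 v(1), of k i] v(2)
      by (simp add: W_def)
    ultimately show ?thesis by simp
  qed
  have uH: "(A ^^ k) w \<in> H (- int k)" using An_mem[OF w, of k] by simp
  have sub: "H 0 \<subseteq> H (- int k)" by (rule H_mono) simp
  have "\<forall>n<0. \<forall>f\<in>H n. \<forall>e>0. \<exists>g\<in>H 0. ipnorm (ip n) (f - g) < e"
    using scale unfolding is_hilbert_scale_def by blast
  then have dense: "\<exists>g\<in>H 0. ipnorm (ip (- int k)) ((A ^^ k) w - g) < e" if "e > 0" for e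
    using uH that k by simp
  \<comment> \<open>If no sequence approximated the functional, every number would satisfy the
    description in \<open>duality\<close>; this one makes the value unique.\<close>
  obtain X where X: "\<And>i. X i \<in> H 0" "(\<lambda>i::nat. ipnorm (ip (- int k)) (X i - (A ^^ k) w)) \<longlonglongrightarrow> 0"
    by (rule H.approximating_sequence[OF uH dense sub]) (assumption, rule that, assumption+)
  show ?thesis
    unfolding duality_def
  proof (rule the_equality)
    fix a assume "\<forall>X. range X \<subseteq> H 0 \<and> (\<lambda>i. ipnorm (ip (- int k)) (X i - (A ^^ k) w)) \<longlonglongrightarrow> 0 \<longrightarrow>
      (\<lambda>i. ip 0 (X i) f) \<longlonglongrightarrow> a"
    then have "(\<lambda>i. ip 0 (X i) f) \<longlonglongrightarrow> a" using X by blast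
    moreover have "(\<lambda>i. ip 0 (X i) f) \<longlonglongrightarrow> ip (int k) w f" using X by (intro lim) auto
    ultimately show "a = ip (int k) w f" by (rule LIMSEQ_unique)
  qed (use lim in blast)
qed

end


section \<open>Matrices\<close>

lemma cdot_add_right: "cdot x (y + z) = cdot x y + cdot x z"
  and cdot_diff_right: "cdot x (y - z) = cdot x y - cdot x z"
  and cdot_add_left: "cdot (x + y) z = cdot x z + cdot y z"
  and cdot_diff_left: "cdot (x - y) z = cdot x z - cdot y z"
  and cdot_scale_right: "cdot x (a *s y) = a * cdot x y"
  and cdot_zero_left [simp]: "cdot 0 y = 0"
  and cdot_zero_right [simp]: "cdot x 0 = 0"
  by (simp_all add: cdot_def sum.distrib sum_subtractf sum_distrib_left algebra_simps)

lemma cdot_commute: "cdot x y = cnj (cdot y x)"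
  by (simp add: cdot_def mult.commute)

lemma cdot_matrix_vector: "cdot x (A *v y) = cdot (cadj A *v x) y"
proof -
  have "cdot x (A *v y) = (\<Sum>\<sigma>\<in>UNIV. \<Sum>\<tau>\<in>UNIV. cnj (x $ \<sigma>) * (A $ \<sigma> $ \<tau> * y $ \<tau>))"
    by (simp add: cdot_def matrix_vector_mult_def sum_distrib_left)
  also have "\<dots> = (\<Sum>\<tau>\<in>UNIV. \<Sum>\<sigma>\<in>UNIV. cnj (x $ \<sigma>) * (A $ \<sigma> $ \<tau> * y $ \<tau>))"
    by (rule sum.swap)
  also have "\<dots> = cdot (cadj A *v x) y"
    by (simp add: cdot_def cadj_def matrix_vector_mult_def sum_distrib_left sum_distrib_right mult_ac)
  finally show ?thesis .
qed

lemma cdot_axis_left: "cdot (axis \<sigma> 1) y = y $ \<sigma>"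
proof -
  have "cdot (axis \<sigma> 1) y = (\<Sum>\<tau>\<in>UNIV. if \<tau> = \<sigma> then y $ \<tau> else 0)"
    unfolding cdot_def by (intro sum.cong) (auto simp: axis_def)
  then show ?thesis by simp
qed

lemma matrix_vector_mult_axis: "(A *v axis \<tau> (1::complex)) $ \<sigma> = A $ \<sigma> $ \<tau>"
proof -
  have "(A *v axis \<tau> 1) $ \<sigma> = (\<Sum>j\<in>UNIV. if j = \<tau> then A $ \<sigma> $ j else 0)"
    unfolding matrix_vector_mult_def vec_lambda_beta by (intro sum.cong) (auto simp: axis_def)
  then show ?thesis by simp
qed

lemma cdot_eqI: "(\<And>x. cdot x y = cdot x z) \<Longrightarrow> y = z"
  by (metis cdot_axis_left vec_eq_iff)

text \<open>The representing vector consists of the values at the unit vectors. It serves to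
  represent a functional that depends on the boundary values alone.\<close>

lemma conjugate_linear_functional:
  fixes l :: "complex^'s \<Rightarrow> complex"
  assumes add: "\<And>x y. l (x + y) = l x + l y" and scale: "\<And>a x. l (a *s x) = cnj a * l x"
  shows "\<exists>a. \<forall>x. l x = cdot x a"
proof (intro exI allI)
  fix x
  have l0: "l 0 = 0" using scale[of 0 0] by simp
  have "l (\<Sum>\<sigma>\<in>I. (x $ \<sigma>) *s axis \<sigma> 1) = (\<Sum>\<sigma>\<in>I. cnj (x $ \<sigma>) * l (axis \<sigma> 1))" for I
    by (induction I rule: infinite_finite_induct) (simp_all add: l0 add scale)
  from this[of UNIV] show "l x = cdot x (\<chi> \<sigma>. l (axis \<sigma> 1))"
    by (simp add: basis_expansion cdot_def)
qed

lemma invertible_iff_ker: "invertible (A::complex^'n^'n) \<longleftrightarrow> (\<forall>x. A *v x = 0 \<longrightarrow> x = 0)"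
  by (simp add: invertible_left_inverse matrix_left_invertible_ker)

lemma matrix_inv_mult:
  assumes "invertible (A::complex^'n^'n)"
  shows "A *v (matrix_inv A *v x) = x" and "matrix_inv A *v (A *v x) = x"
proof -
  have "A ** matrix_inv A = mat 1 \<and> matrix_inv A ** A = mat 1"
    using assms unfolding invertible_def matrix_inv_def by (rule someI_ex)
  then show "A *v (matrix_inv A *v x) = x" "matrix_inv A *v (A *v x) = x"
    by (simp_all add: matrix_vector_mul_assoc)
qed

lemma matrix_inv_eqI: "invertible (A::complex^'n^'n) \<Longrightarrow> A *v y = x \<Longrightarrow> matrix_inv A *v x = y"
  using matrix_inv_mult(2) by metis

lemma mat_mult_vec: "mat z *v x = z *s (x::complex^'n)"
  by (simp add: vec_eq_iff mat_def matrix_vector_mult_def if_distrib[of "\<lambda>a. a * _"] cong: if_cong)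

section \<open>Holomorphic matrix functions and their derivatives\<close>

lemma det_holomorphic:
  assumes "\<And>i j. (\<lambda>z. F z $ i $ j) holomorphic_on S"
  shows "(\<lambda>z. det (F z :: complex^'n^'n)) holomorphic_on S"
  unfolding det_def by (intro holomorphic_intros assms)

lemma shift_entry_holomorphic: "(\<lambda>z. (A - mat z :: complex^'n^'n) $ i $ j) holomorphic_on S"
  by (cases "i = j") (auto simp: mat_def intro!: holomorphic_intros)

lemma open_matrix_res: "open (matrix_res (A::complex^'s^'s))"
proof -
  have "matrix_res A = {z. det (A - mat z) \<noteq> 0}"
    by (simp add: matrix_res_def invertible_det_nz)
  moreover have "continuous_on UNIV (\<lambda>z. det (A - mat z))"
    by (intro holomorphic_on_imp_continuous_on det_holomorphic shift_entry_holomorphic)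
  then have "open {z. det (A - mat z) \<noteq> 0}"
    by (intro open_Collect_neq continuous_on_const)
  ultimately show ?thesis by simp
qed

text \<open>Cramer's rule for the column \<open>axis \<tau> 1\<close>: the entry is a quotient of
  two determinants that are polynomial in \<open>z\<close>, with denominator nonzero on
  \<open>matrix_res A\<close>.\<close>

lemma matrix_inv_entry_holomorphic:
  "(\<lambda>z. matrix_inv (A - mat z) $ \<sigma> $ \<tau>) holomorphic_on matrix_res (A::complex^'s^'s)"
proof (rule holomorphic_transform)
  let ?C = "\<lambda>z. \<chi> i j. if j = \<sigma> then (axis \<tau> 1 :: complex^'s) $ i else (A - mat z) $ i $ j"
  have "(\<lambda>z. ?C z $ i $ j) holomorphic_on matrix_res A" for i j
    using shift_entry_holomorphic[of A i j] by (cases "j = \<sigma>") auto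
  then show "(\<lambda>z. det (?C z) / det (A - mat z)) holomorphic_on matrix_res A"
    by (intro holomorphic_on_divide det_holomorphic shift_entry_holomorphic)
      (auto simp: matrix_res_def invertible_det_nz)
  fix z assume "z \<in> matrix_res A"
  then have inv: "invertible (A - mat z)" and d: "det (A - mat z) \<noteq> 0"
    by (simp_all add: matrix_res_def invertible_det_nz)
  have "(A - mat z) *v (matrix_inv (A - mat z) *v axis \<tau> 1) = axis \<tau> 1"
    by (rule matrix_inv_mult[OF inv])
  then have "matrix_inv (A - mat z) *v axis \<tau> 1 = (\<chi> k. det (\<chi> i j. if j = k then
      (axis \<tau> 1 :: complex^'s) $ i else (A - mat z) $ i $ j) / det (A - mat z))"
    unfolding cramer[OF d] .
  then have "(matrix_inv (A - mat z) *v axis \<tau> 1) $ \<sigma> = det (?C z) / det (A - mat z)"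
    by simp
  then show "det (?C z) / det (A - mat z) = matrix_inv (A - mat z) $ \<sigma> $ \<tau>"
    by (simp add: matrix_vector_mult_axis)
qed

lemma bounded_operator_matrix: "bounded_operator (*s) UNIV norm ((*v) (A::complex^'s^'s))"
  unfolding bounded_operator_def
proof (intro conjI)
  show "Vector_Spaces.linear (*s) (*s) ((*v) A)" by (rule matrix_vector_mul_linear_gen)
  have "bounded_linear ((*v) A)" by (rule matrix_vector_mul_bounded_linear)
  then obtain K where "\<forall>c. norm (A *v c) \<le> norm c * K" using bounded_linear.bounded by blast
  then show "\<exists>C. \<forall>c. norm (A *v c) \<le> C * norm c" by (metis mult.commute)
qed simp

lemma bounded_analytic_matrix:
  fixes Q :: "complex \<Rightarrow> complex^'s^'s"
  assumes \<Omega>: "open \<Omega>"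
    and T: "\<And>z. z \<in> \<Omega> \<Longrightarrow> T z = (*v) (Q z)"
    and Q: "\<And>\<sigma> \<tau>. (\<lambda>z. Q z $ \<sigma> $ \<tau>) holomorphic_on \<Omega>"
  shows "bounded_analytic_on (*s) UNIV norm T \<Omega>"
  unfolding bounded_analytic_on_def
proof (intro conjI ballI \<Omega>)
  fix z assume z: "z \<in> \<Omega>"
  show "bounded_operator (*s) UNIV norm (T z)" using T[OF z] bounded_operator_matrix by simp
  have "\<exists>d. ((\<lambda>z. Q z $ \<sigma> $ \<tau>) has_field_derivative d) (at z)" for \<sigma> \<tau>
    using Q[of \<sigma> \<tau>] \<Omega> z holomorphic_on_open by blast
  then obtain d where d: "\<And>\<sigma> \<tau>. ((\<lambda>z. Q z $ \<sigma> $ \<tau>) has_field_derivative d \<sigma> \<tau>) (at z)" by metis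
  define D :: "complex^'s^'s" where "D = (\<chi> \<sigma> \<tau>. d \<sigma> \<tau>)"
  show "\<exists>D. bounded_operator (*s) UNIV norm D \<and> (\<forall>e>0. \<exists>\<delta>>0. \<forall>w\<in>\<Omega>. cmod (w - z) < \<delta> \<longrightarrow>
      (\<forall>c. norm (T w c - T z c - (w - z) *s D c) \<le> e * cmod (w - z) * norm c))"
  proof (intro exI[of _ "(*v) D"] conjI bounded_operator_matrix allI impI)
    fix e :: real assume e: "e > 0"
    define N where "N = real CARD('s)"
    have N: "N > 0" by (simp add: N_def)
    \<comment> \<open>One factor \<open>N\<close> is spent on the sum over a row, the other on
      bounding the norm of a vector by the sum of its components.\<close>
    define e' where "e' = e / (N * N)"
    have e': "e' > 0" using e N by (simp add: e'_def)
    have "\<forall>\<sigma> \<tau>. \<exists>\<delta>>0. \<forall>w. cmod (w - z) < \<delta> \<longrightarrow>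
        cmod (Q w $ \<sigma> $ \<tau> - Q z $ \<sigma> $ \<tau> - d \<sigma> \<tau> * (w - z)) \<le> e' * cmod (w - z)"
      using d e' unfolding has_field_derivative_def has_derivative_at_alt by blast
    then obtain \<delta> where \<delta>: "\<And>\<sigma> \<tau>. \<delta> \<sigma> \<tau> > 0"
      "\<And>\<sigma> \<tau> w. cmod (w - z) < \<delta> \<sigma> \<tau> \<Longrightarrow>
        cmod (Q w $ \<sigma> $ \<tau> - Q z $ \<sigma> $ \<tau> - d \<sigma> \<tau> * (w - z)) \<le> e' * cmod (w - z)" by metis
    define \<delta>0 where "\<delta>0 = Min (range (\<lambda>(\<sigma>, \<tau>). \<delta> \<sigma> \<tau>))"
    have \<delta>0: "\<delta>0 > 0" unfolding \<delta>0_def using \<delta>(1) by (subst Min_gr_iff) auto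
    have \<delta>0_le: "\<delta>0 \<le> \<delta> \<sigma> \<tau>" for \<sigma> \<tau>
      unfolding \<delta>0_def by (rule Min_le) (auto intro: rev_image_eqI[of "(\<sigma>, \<tau>)"])
    have "norm (T w c - T z c - (w - z) *s (D *v c)) \<le> e * cmod (w - z) * norm c"
      if w: "w \<in> \<Omega>" "cmod (w - z) < \<delta>0" for w c
    proof -
      define v where "v = T w c - T z c - (w - z) *s (D *v c)"
      have "cmod (v $ \<sigma>) \<le> N * (e' * cmod (w - z) * norm c)" for \<sigma>
      proof -
        have "v $ \<sigma> = (\<Sum>\<tau>\<in>UNIV. (Q w $ \<sigma> $ \<tau> - Q z $ \<sigma> $ \<tau> - d \<sigma> \<tau> * (w - z)) * c $ \<tau>)"
          by (simp add: v_def T[OF w(1)] T[OF z] matrix_vector_mult_def D_def sum_distrib_left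
              sum_subtractf sum.distrib algebra_simps)
        also have "cmod \<dots> \<le> (\<Sum>\<tau>\<in>(UNIV::'s set). e' * cmod (w - z) * norm c)"
        proof (rule sum_norm_le)
          fix \<tau>
          have "cmod (Q w $ \<sigma> $ \<tau> - Q z $ \<sigma> $ \<tau> - d \<sigma> \<tau> * (w - z)) \<le> e' * cmod (w - z)"
            using w(2) \<delta>0_le[of \<sigma> \<tau>] by (intro \<delta>(2)) simp
          then show "cmod ((Q w $ \<sigma> $ \<tau> - Q z $ \<sigma> $ \<tau> - d \<sigma> \<tau> * (w - z)) * c $ \<tau>)
              \<le> e' * cmod (w - z) * norm c"
            unfolding norm_mult using Finite_Cartesian_Product.norm_nth_le[of c \<tau>] e' by (intro mult_mono) auto
        qed
        finally show ?thesis by (simp add: N_def)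
      qed
      then have "norm v \<le> (\<Sum>\<sigma>\<in>(UNIV::'s set). N * (e' * cmod (w - z) * norm c))"
        unfolding norm_vec_def by (intro order_trans[OF L2_set_le_sum] sum_mono) auto
      also have "\<dots> = e * cmod (w - z) * norm c"
        using N by (simp add: e'_def N_def)
      finally show ?thesis by (simp add: v_def)
    qed
    then show "\<exists>\<delta>>0. \<forall>w\<in>\<Omega>. cmod (w - z) < \<delta> \<longrightarrow>
      (\<forall>c. norm (T w c - T z c - (w - z) *s (D *v c)) \<le> e * cmod (w - z) * norm c)"
      using \<delta>0 by blast
  qed
qed

text \<open>Brings the estimate of \<open>resolv_expansion\<close> into the form of a complex
  derivative.\<close>

lemma field_differentiable_quadratic_remainder:
  fixes F :: "complex \<Rightarrow> complex"
  assumes "open S" "z \<in> S" "\<delta> > 0" "K \<ge> 0"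
    and rem: "\<And>w. w \<in> S \<Longrightarrow> cmod (w - z) < \<delta> \<Longrightarrow> cmod (F w - F z - (w - z) * d) \<le> K * (cmod (w - z))\<^sup>2"
  shows "F field_differentiable at z"
proof -
  obtain r where r: "r > 0" "\<And>w. cmod (w - z) < r \<Longrightarrow> w \<in> S"
    using assms(1,2) unfolding open_dist dist_norm by blast
  have "(F has_field_derivative d) (at z)"
    unfolding has_field_derivative_def has_derivative_at_alt
  proof (intro conjI bounded_linear_mult_right allI impI)
    fix e :: real assume e: "e > 0"
    \<comment> \<open>\<open>K + 1\<close> keeps the quotient defined when \<open>K = 0\<close>, and
      \<open>r\<close> keeps \<open>w\<close> inside \<open>S\<close>.\<close>
    define \<delta>' where "\<delta>' = min (min r \<delta>) (e / (K + 1))"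
    have "cmod (F w - F z - d * (w - z)) \<le> e * cmod (w - z)" if w: "cmod (w - z) < \<delta>'" for w
    proof -
      have "K * cmod (w - z) \<le> (K + 1) * (e / (K + 1))"
        using w assms(4) by (intro mult_mono) (auto simp: \<delta>'_def)
      then have "K * (cmod (w - z))\<^sup>2 \<le> e * cmod (w - z)"
        using assms(4) mult_right_mono[of "K * cmod (w - z)" e "cmod (w - z)"]
        by (simp add: power2_eq_square)
      then show ?thesis
        using rem[of w] r(2)[of w] w by (simp add: \<delta>'_def mult.commute)
    qed
    moreover have "\<delta>' > 0" using e r(1) assms(3,4) by (simp add: \<delta>'_def)
    ultimately show "\<exists>\<delta>>0. \<forall>w. cmod (w - z) < \<delta> \<longrightarrow> cmod (F w - F z - d * (w - z)) \<le> e * cmod (w - z)"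
      by blast
  qed
  then show ?thesis unfolding field_differentiable_def by blast
qed


section \<open>The space \<open>\<H>\<^sub>A\<close>\<close>

locale peak_model = hilbert_scale P
  for P :: "('h::complex_vector, 's::finite) peak_data" +
  assumes m_pos: "1 \<le> mm P"
    and phi_mem: "\<And>\<sigma>. phi P \<sigma> \<in> Hsp P (- int (mm P) - 2)"
    and phi_independent: "\<And>c :: complex^'s.
      (\<Sum>\<sigma>\<in>UNIV. (c $ \<sigma>) *\<^sub>C phi P \<sigma>) \<in> Hsp P (- int (mm P) - 1) \<Longrightarrow> c = 0"
    and Gram_invertible: "invertible_on (idx P) (Gram P)"
    and Gram_hermitian: "hermitian_on (idx P) (Gram P)"
    and Gram_condition: "\<And>\<sigma> \<tau>. 2 \<le> mm P \<Longrightarrow>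
      Gram P (\<sigma>, mm P - 1) (\<tau>, mm P) = Gram P (\<sigma>, mm P) (\<tau>, mm P - 1)"
    and G_min_positive: "positive_definite (G_min P)"
begin

abbreviation m where "m \<equiv> mm P"
abbreviation h where "h \<equiv> hvec P"
abbreviation hs where "hs \<equiv> hsum P"
abbreviation ipm where "ipm \<equiv> ip (int m)"
abbreviation nrm where "nrm \<equiv> ipnorm (ip (int m))"

text \<open>The inverse of the coordinate map. Calculations run on \<open>ksum a\<close>, where the
  coordinates are explicit, rather than on the definite description \<open>dcoord\<close>; values of
  \<open>a\<close> outside \<open>idx P\<close> do not affect it.\<close>

definition ksum :: "('s \<times> nat \<Rightarrow> complex) \<Rightarrow> 'h" where
  "ksum a = (\<Sum>i\<in>idx P. a i *\<^sub>C h (fst i) (snd i))"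

definition col :: "('s \<times> nat \<Rightarrow> complex) \<Rightarrow> nat \<Rightarrow> complex^'s" where
  "col a j = (\<chi> \<sigma>. a (\<sigma>, j))"

lemma finite_idx [simp]: "finite (idx P)"
  by (simp add: idx_def)

lemma idx_top [simp]: "(\<sigma>, m) \<in> idx P"
  using m_pos by (simp add: idx_def)

lemma h_mem: "h \<sigma> j \<in> H (- int m - 2 + 2 * int j)"
  using hvec_mem[OF phi_mem] .

lemma hs_mem: "hs j c \<in> H (- int m - 2 + 2 * int j)"
  unfolding hsum_def by (intro H.sum_mem H.scale_mem h_mem)

lemma h_top_mem: "h \<sigma> (m + 1) \<in> H (int m)"
  using h_mem[of \<sigma> "m + 1"] by simp

lemma hs_top_mem [simp]: "hs (m + 1) c \<in> H (int m)"
  using hs_mem[of "m + 1" c] by simp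

lemma hs_top_mem' [simp]: "hs (Suc m) c \<in> H (int m)"
  using hs_top_mem by simp

lemma hs_m_mem: "hs m c \<in> H (int m - 2)"
  using hs_mem[of m c] by simp

lemma hs_add: "hs j (c + d) = hs j c + hs j d"
  by (simp add: hsum_def scaleC_add_left sum.distrib)

lemma hs_scale: "hs j (a *s c) = a *\<^sub>C hs j c"
  by (simp add: hsum_def scaleC_scaleC complex_vector.scale_sum_right)

lemma hs_diff: "hs j (c - d) = hs j c - hs j d"
  by (simp add: hsum_def complex_vector.scale_left_diff_distrib sum_subtractf)

lemma hs_zero [simp]: "hs j 0 = 0"
  by (simp add: hsum_def)

lemma A_sum: "(\<And>i. i \<in> I \<Longrightarrow> w i \<in> H n) \<Longrightarrow> A (sum w I) = (\<Sum>i\<in>I. A (w i))"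
proof (induction I rule: infinite_finite_induct)
  case (insert i I)
  then show ?case by (simp add: A_add[of _ n] H.sum_mem)
qed (use A_scale[of 0 n 0] in auto)

lemma A_hs: "A (hs (Suc j) c) = hs j c"
proof -
  have mem: "h \<sigma> (Suc j) \<in> H (- int m + 2 * int j)" for \<sigma>
    using h_mem[of \<sigma> "Suc j"] by simp
  have "A (hs (Suc j) c) = (\<Sum>\<sigma>\<in>UNIV. A ((c $ \<sigma>) *\<^sub>C h \<sigma> (Suc j)))"
    unfolding hsum_def using mem by (intro A_sum H.scale_mem)
  also have "\<dots> = hs j c"
    by (simp add: hsum_def A_scale[OF mem] A_hvec[OF phi_mem])
  finally show ?thesis .
qed

lemma A_hs_top: "A (hs (m + 1) c) = hs m c"
  using A_hs[of m c] by simp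

lemma An_hs: "(A ^^ j) (hs j c) = (\<Sum>\<sigma>\<in>UNIV. (c $ \<sigma>) *\<^sub>C phi P \<sigma>)"
proof (induction j)
  case 0
  have "h \<sigma> 0 = phi P \<sigma>" for \<sigma> using An_hvec[OF phi_mem, of 0] by simp
  then show ?case by (simp add: hsum_def)
next
  case (Suc j)
  then show ?case by (simp only: funpow_Suc_right comp_apply A_hs)
qed

text \<open>\<open>A ^^ j\<close> takes off exactly \<open>2 * j\<close> orders of regularity and
  sends the combination back to the functionals, which are independent modulo
  \<open>H (- m - 1)\<close>.\<close>

lemma hs_independent:
  assumes "hs j c \<in> H (- int m - 1 + 2 * int j)"
  shows "c = 0"
  using An_mem[OF assms, of j] by (intro phi_independent) (simp add: An_hs)

lemma ksum_cong: "(\<And>i. i \<in> idx P \<Longrightarrow> a i = b i) \<Longrightarrow> ksum a = ksum b"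
  unfolding ksum_def by (intro sum.cong) auto

lemma ksum_add: "ksum (\<lambda>i. a i + b i) = ksum a + ksum b"
  by (simp add: ksum_def scaleC_add_left sum.distrib)

lemma ksum_scale: "ksum (\<lambda>i. x * a i) = x *\<^sub>C ksum a"
  by (simp add: ksum_def scaleC_scaleC complex_vector.scale_sum_right)

lemma ksum_diff: "ksum (\<lambda>i. a i - b i) = ksum a - ksum b"
  by (simp add: ksum_def complex_vector.scale_left_diff_distrib sum_subtractf)

lemma ksum_zero [simp]: "ksum (\<lambda>i. 0) = 0"
  by (simp add: ksum_def)

lemma sum_idx: "(\<Sum>i\<in>idx P. F i) = (\<Sum>j\<in>{1..m}. \<Sum>\<sigma>\<in>UNIV. F (\<sigma>, j))"
  unfolding idx_def by (subst sum.swap) (simp add: sum.cartesian_product)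

lemma ksum_levels: "ksum a = (\<Sum>j\<in>{1..m}. hs j (col a j))"
  by (simp add: ksum_def sum_idx hsum_def col_def)

lemma ksum_eta: "ksum (eta P x) = hs m x"
proof -
  have "hs j (col (eta P x) j) = (if j = m then hs m x else 0)" for j
    by (simp add: col_def eta_def hsum_def)
  then show ?thesis using m_pos by (simp add: ksum_levels)
qed

text \<open>Among the blocks not yet known to vanish, the lowest is the least regular; all later
  ones are smoother by two orders, so that block inherits the regularity of the whole sum and must
  vanish. Taking \<open>J = m\<close> gives independence modulo \<open>H m\<close>, and
  \<open>J = m - 1\<close> determines \<open>K_min\<close>.\<close>

lemma ksum_independent:
  assumes a: "ksum a \<in> H (- int m - 1 + 2 * int J)" and J: "J \<le> m" and j: "j \<in> {1..J}"
  shows "col a j = 0"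
  using j
proof (induction j rule: less_induct)
  case (less j)
  have split: "{1..m} = {1..<j} \<union> ({j} \<union> {j<..m})" using less.prems J by auto
  have low: "(\<Sum>i\<in>{1..<j}. hs i (col a i)) = 0"
    using less by (intro sum.neutral) auto
  have "ksum a = hs j (col a j) + (\<Sum>i\<in>{j<..m}. hs i (col a i))"
    unfolding ksum_levels split by (subst sum.union_disjoint) (auto simp: low[simplified])
  then have "hs j (col a j) = ksum a - (\<Sum>i\<in>{j<..m}. hs i (col a i))" by simp
  moreover have "ksum a \<in> H (- int m - 1 + 2 * int j)"
    using H_mono[of "- int m - 1 + 2 * int j" "- int m - 1 + 2 * int J"] a less.prems by auto
  moreover have "(\<Sum>i\<in>{j<..m}. hs i (col a i)) \<in> H (- int m - 1 + 2 * int j)"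
  proof (intro H.sum_mem)
    fix i assume "i \<in> {j<..m}"
    then have "H (- int m - 2 + 2 * int i) \<subseteq> H (- int m - 1 + 2 * int j)" by (intro H_mono) auto
    then show "hs i (col a i) \<in> H (- int m - 1 + 2 * int j)" using hs_mem by blast
  qed
  ultimately show ?case by (intro hs_independent[of j]) simp
qed

lemma ksum_inj_mod:
  assumes "ksum a \<in> H (int m)" "i \<in> idx P"
  shows "a i = 0"
proof -
  obtain \<sigma> j where i: "i = (\<sigma>, j)" "j \<in> {1..m}" using assms(2) by (auto simp: idx_def)
  have "ksum a \<in> H (- int m - 1 + 2 * int m)"
    using H_mono[of "- int m - 1 + 2 * int m" "int m"] assms(1) by auto
  then have "col a j = 0" using i by (intro ksum_independent[of a m]) auto
  then have "col a j $ \<sigma> = 0" by simp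
  then show ?thesis by (simp add: col_def i)
qed

lemma K_A_eq: "K_A P = range ksum"
proof
  have "complex_vector.subspace (range ksum)"
    unfolding complex_vector.subspace_def
    by (auto simp flip: ksum_add ksum_scale) (metis ksum_zero rangeI)
  moreover have "{h \<sigma> j |\<sigma> j. (\<sigma>, j) \<in> idx P} \<subseteq> range ksum"
  proof (clarify)
    fix \<sigma> j assume "(\<sigma>, j) \<in> idx P"
    then have "h \<sigma> j = ksum (\<lambda>i. if i = (\<sigma>, j) then 1 else 0)"
      by (simp add: ksum_def if_distrib[of "\<lambda>a. a *\<^sub>C _"] scaleC_one cong: if_cong)
    then show "h \<sigma> j \<in> range ksum" by blast
  qed
  ultimately show "K_A P \<subseteq> range ksum"
    unfolding K_A_def by (intro complex_vector.span_minimal)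
  show "range ksum \<subseteq> K_A P"
  proof clarify
    fix a
    have "h (fst i) (snd i) \<in> {h \<sigma> j |\<sigma> j. (\<sigma>, j) \<in> idx P}" if "i \<in> idx P" for i
      using that by (cases i) auto
    then show "ksum a \<in> K_A P"
      unfolding K_A_def ksum_def
      by (intro complex_vector.span_sum complex_vector.span_scale complex_vector.span_base)
  qed
qed

lemma decomposition_unique:
  assumes "f \<in> H (int m)" "g \<in> H (int m)" "f + ksum a = g + ksum b"
  shows "f = g" and "i \<in> idx P \<Longrightarrow> a i = b i"
proof -
  have "ksum (\<lambda>i. a i - b i) = g - f" using assms(3) by (simp add: ksum_diff algebra_simps)
  then have "ksum (\<lambda>i. a i - b i) \<in> H (int m)" using assms by simp
  from ksum_inj_mod[OF this] have ab: "\<And>i. i \<in> idx P \<Longrightarrow> a i = b i" by simp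
  then show "i \<in> idx P \<Longrightarrow> a i = b i" .
  have "ksum a = ksum b" by (rule ksum_cong) (rule ab)
  then show "f = g" using assms(3) by simp
qed

lemma dcoord_ksum:
  assumes "i \<in> idx P"
  shows "dcoord P (ksum a) i = a i"
proof -
  let ?a = "\<lambda>i. if i \<in> idx P then a i else 0"
  have eq: "(\<Sum>(\<sigma>, j)\<in>idx P. b (\<sigma>, j) *\<^sub>C h \<sigma> j) = ksum b" for b
    unfolding ksum_def by (intro sum.cong) auto
  have "dcoord P (ksum a) = ?a"
    unfolding dcoord_def eq
  proof (rule the_equality)
    show "(\<forall>i. i \<notin> idx P \<longrightarrow> ?a i = 0) \<and> ksum a = ksum ?a"
      using ksum_cong[of a ?a] by auto
    fix b assume b: "(\<forall>i. i \<notin> idx P \<longrightarrow> b i = 0) \<and> ksum a = ksum b"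
    then have "i \<in> idx P \<Longrightarrow> a i = b i" for i
      using decomposition_unique(2)[of 0 0 a b] by simp
    then show "b = ?a" using b by auto
  qed
  then show ?thesis using assms by simp
qed

section \<open>Components and inner product of \<open>H_A\<close>\<close>

lemma H_A_iff: "u \<in> H_A P \<longleftrightarrow> (\<exists>f a. f \<in> H (int m) \<and> u = f + ksum a)"
  unfolding H_A_def K_A_eq by auto

lemma H_A_mem: "f \<in> H (int m) \<Longrightarrow> f + ksum a \<in> H_A P"
  unfolding H_A_iff by blast

lemma regular_part_eq:
  assumes "f \<in> H (int m)"
  shows "regular_part P (f + ksum a) = f"
  unfolding regular_part_def K_A_eq
proof (rule the_equality)
  fix g assume "g \<in> H (int m) \<and> (\<exists>k\<in>range ksum. f + ksum a = g + k)"
  then obtain b where "g \<in> H (int m)" "f + ksum a = g + ksum b" by blast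
  then show "g = f" using decomposition_unique(1)[of f g a b] assms by simp
qed (use assms in blast)

lemma singular_part_eq:
  assumes "f \<in> H (int m)"
  shows "singular_part P (f + ksum a) = ksum a"
  unfolding singular_part_def K_A_eq
proof (rule the_equality)
  fix k assume "k \<in> range ksum \<and> (\<exists>g\<in>H (int m). f + ksum a = g + k)"
  then obtain g b where gb: "k = ksum b" "g \<in> H (int m)" "f + ksum a = g + ksum b" by blast
  then have "f = g" using decomposition_unique(1)[of f g a b] assms by simp
  then show "k = ksum a" using gb by simp
qed (use assms in blast)

definition gf :: "('s \<times> nat \<Rightarrow> complex) \<Rightarrow> ('s \<times> nat \<Rightarrow> complex) \<Rightarrow> complex" where
  "gf a b = (\<Sum>i\<in>idx P. \<Sum>k\<in>idx P. cnj (a i) * Gram P i k * b k)"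

text \<open>The component \<open>[G\<^sub>A b]\<^sub>m\<close> of the image of \<open>b\<close> under the Gram matrix.\<close>

definition top_row :: "('s \<times> nat \<Rightarrow> complex) \<Rightarrow> complex^'s" where
  "top_row b = (\<chi> \<sigma>. \<Sum>k\<in>idx P. Gram P (\<sigma>, m) k * b k)"

lemma ip_A_eq:
  assumes "f \<in> H (int m)" "g \<in> H (int m)"
  shows "ip_A P (f + ksum a) (g + ksum b) = ipm f g + gf a b"
  using assms unfolding ip_A_def gf_def
  by (simp add: regular_part_eq singular_part_eq dcoord_ksum cong: sum.cong)

lemma Gram_cnj: "i \<in> idx P \<Longrightarrow> k \<in> idx P \<Longrightarrow> cnj (Gram P i k) = Gram P k i"
proof -
  assume "i \<in> idx P" "k \<in> idx P"
  then have "Gram P k i = cnj (Gram P i k)" using Gram_hermitian unfolding hermitian_on_def by blast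
  then show "cnj (Gram P i k) = Gram P k i" by simp
qed

lemma gf_commute: "gf a b = cnj (gf b a)"
proof -
  have "cnj (gf b a) = (\<Sum>i\<in>idx P. \<Sum>k\<in>idx P. cnj (a k) * cnj (Gram P i k) * b i)"
    by (simp add: gf_def mult_ac)
  also have "\<dots> = (\<Sum>i\<in>idx P. \<Sum>k\<in>idx P. cnj (a k) * Gram P k i * b i)"
    by (intro sum.cong) (auto simp: Gram_cnj)
  also have "\<dots> = gf a b" unfolding gf_def by (rule sum.swap)
  finally show ?thesis by simp
qed

lemma gf_add_right: "gf a (\<lambda>i. b i + c i) = gf a b + gf a c"
  by (simp add: gf_def algebra_simps sum.distrib)

lemma gf_scale_right: "gf a (\<lambda>i. x * b i) = x * gf a b"
  by (simp add: gf_def sum_distrib_left mult_ac)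

text \<open>A vector of \<open>K_min\<close> pairs only with the last block of Gram coordinates.
  Since first components of \<open>B_max\<close> have their singular part in \<open>K_min\<close>,
  this is the only Gram information that \<open>B_max\<close> sees.\<close>

lemma gf_eta: "gf (eta P x) b = cdot x (top_row b)"
proof -
  have "(\<Sum>\<sigma>\<in>UNIV. \<Sum>k\<in>idx P. cnj (eta P x (\<sigma>, j)) * Gram P (\<sigma>, j) k * b k) =
      (if j = m then cdot x (top_row b) else 0)" for j
    by (simp add: eta_def cdot_def top_row_def sum_distrib_left mult_ac)
  then show ?thesis using m_pos by (simp add: gf_def sum_idx[of "\<lambda>i. \<Sum>k\<in>idx P. _ i k"])
qed

lemma top_row_add: "top_row (\<lambda>i. a i + b i) = top_row a + top_row b"
  by (simp add: top_row_def vec_eq_iff algebra_simps sum.distrib)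

lemma top_row_diff: "top_row (\<lambda>i. a i - b i) = top_row a - top_row b"
  by (simp add: top_row_def vec_eq_iff algebra_simps sum_subtractf)

lemma top_row_scale: "top_row (\<lambda>i. x * a i) = x *s top_row a"
  by (simp add: top_row_def vec_eq_iff sum_distrib_left mult_ac)

lemma top_row_zero [simp]: "top_row (\<lambda>i. 0) = 0"
  by (simp add: top_row_def vec_eq_iff)

lemma top_row_cong: "(\<And>i. i \<in> idx P \<Longrightarrow> a i = b i) \<Longrightarrow> top_row a = top_row b"
  by (simp add: top_row_def)

lemma sum_idx_eta: "(\<Sum>i\<in>idx P. F i * eta P x i) = (\<Sum>\<sigma>\<in>UNIV. F (\<sigma>, m) * x $ \<sigma>)"
proof -
  have "(\<Sum>\<sigma>\<in>UNIV. F (\<sigma>, j) * eta P x (\<sigma>, j)) = (if j = m then (\<Sum>\<sigma>\<in>UNIV. F (\<sigma>, m) * x $ \<sigma>) else 0)" for j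
    by (simp add: eta_def)
  then show ?thesis using m_pos by (simp add: sum_idx)
qed

lemma top_row_eta: "top_row (eta P x) = G_min P *v x"
  by (simp add: top_row_def vec_eq_iff sum_idx_eta G_min_def matrix_vector_mult_def)

definition Md :: "complex^'s \<Rightarrow> 's \<times> nat \<Rightarrow> complex" where
  "Md x i = (\<Sum>l\<in>idx P. M_d P i l * eta P x l)"

lemma Md_eq: "Md x i = (\<Sum>\<sigma>\<in>UNIV. M_d P i (\<sigma>, m) * x $ \<sigma>)"
  by (simp add: Md_def sum_idx_eta)

lemma Md_add: "Md (x + y) i = Md x i + Md y i"
  by (simp add: Md_eq algebra_simps sum.distrib)

lemma Md_scale: "Md (a *s x) i = a * Md x i"
  by (simp add: Md_eq sum_distrib_left mult_ac)

lemma eta_add: "eta P (x + y) i = eta P x i + eta P y i"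
  by (cases i) (simp add: eta_def)

lemma eta_scale: "eta P (a *s x) i = a * eta P x i"
  by (cases i) (simp add: eta_def)

lemma top_row_Md: "top_row (Md x) = Delta P *v x"
proof -
  have "(\<Sum>k\<in>idx P. Gram P (\<sigma>, m) k * (\<Sum>\<tau>\<in>UNIV. M_d P k (\<tau>, m) * x $ \<tau>)) =
      (\<Sum>\<tau>\<in>UNIV. (\<Sum>k\<in>idx P. Gram P (\<sigma>, m) k * M_d P k (\<tau>, m)) * x $ \<tau>)" for \<sigma>
    unfolding sum_distrib_left sum_distrib_right by (subst sum.swap) (simp add: mult_ac)
  then show ?thesis
    by (simp add: top_row_def vec_eq_iff Md_eq Delta_def matrix_vector_mult_def)
qed

text \<open>Column \<open>m\<close> of the shift matrix has \<open>z1\<close> in row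
  \<open>m\<close> and 1 in row \<open>m - 1\<close>. The latter produces the Gram entry with
  indices \<open>m\<close> and \<open>m - 1\<close>, which the symmetry condition exchanges.\<close>

lemma Delta_eq:
  "Delta P $ \<sigma> $ \<tau> = z1c P * G_min P $ \<sigma> $ \<tau> + (if 2 \<le> m then Gram P (\<sigma>, m - 1) (\<tau>, m) else 0)"
proof -
  have inner: "(\<Sum>\<rho>\<in>UNIV. Gram P (\<sigma>, m) (\<rho>, j) * M_d P (\<rho>, j) (\<tau>, m)) =
      Gram P (\<sigma>, m) (\<tau>, j) * (if j = m then z1c P else if m = j + 1 then 1 else 0)" for j
  proof -
    have "(\<Sum>\<rho>\<in>UNIV. Gram P (\<sigma>, m) (\<rho>, j) * M_d P (\<rho>, j) (\<tau>, m)) =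
        (\<Sum>\<rho>\<in>UNIV. if \<rho> = \<tau> then Gram P (\<sigma>, m) (\<tau>, j) * (if j = m then z1c P else if m = j + 1 then 1 else 0) else 0)"
      by (intro sum.cong) (auto simp: M_d_def)
    then show ?thesis by simp
  qed
  have "Delta P $ \<sigma> $ \<tau> = (\<Sum>j\<in>{1..m}. (if j = m then z1c P * Gram P (\<sigma>, m) (\<tau>, j) else 0) +
      (if j = m - 1 then Gram P (\<sigma>, m) (\<tau>, j) else 0))"
    unfolding Delta_def sum_idx vec_lambda_beta inner by (intro sum.cong) auto
  \<comment> \<open>For \<open>m = 1\<close> the index \<open>m - 1\<close> is 0 and lies outside
    the range of summation, so the second part is empty.\<close>
  also have "\<dots> = z1c P * Gram P (\<sigma>, m) (\<tau>, m) + (if 2 \<le> m then Gram P (\<sigma>, m) (\<tau>, m - 1) else 0)"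
    using m_pos by (auto simp: sum.distrib)
  finally show ?thesis using Gram_condition[of \<sigma> \<tau>] by (simp add: G_min_def)
qed

lemma G_min_hermitian: "cadj (G_min P) = G_min P"
  by (simp add: cadj_def vec_eq_iff G_min_def Gram_cnj)

text \<open>Conjugation swaps the two index pairs because the Gram matrix is Hermitian; the symmetry
  condition swaps the levels \<open>m - 1\<close> and \<open>m\<close> back.\<close>

lemma Delta_hermitian: "cadj (Delta P) = Delta P"
proof -
  have G: "cnj (G_min P $ \<tau> $ \<sigma>) = G_min P $ \<sigma> $ \<tau>" for \<sigma> \<tau>
    using arg_cong[OF G_min_hermitian, of "\<lambda>A. A $ \<sigma> $ \<tau>"] by (simp add: cadj_def)
  have "cnj (Gram P (\<tau>, m - 1) (\<sigma>, m)) = Gram P (\<sigma>, m - 1) (\<tau>, m)" if "2 \<le> m" for \<sigma> \<tau>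
  proof -
    have "(\<sigma>, m - 1) \<in> idx P" "(\<tau>, m - 1) \<in> idx P" using that by (auto simp: idx_def)
    then have "cnj (Gram P (\<tau>, m - 1) (\<sigma>, m)) = Gram P (\<sigma>, m) (\<tau>, m - 1)"
      by (simp add: Gram_cnj)
    then show ?thesis using Gram_condition[OF that] by simp
  qed
  then show ?thesis by (simp add: cadj_def vec_eq_iff Delta_eq G)
qed

lemma cdot_Delta: "cdot x (Delta P *v y) = cdot (Delta P *v x) y"
  by (subst cdot_matrix_vector) (simp add: Delta_hermitian)

lemma cdot_G_min: "cdot x (G_min P *v y) = cdot (G_min P *v x) y"
  by (subst cdot_matrix_vector) (simp add: G_min_hermitian)

lemma G_min_invertible: "invertible (G_min P)"
  unfolding invertible_iff_ker
proof (intro allI impI)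
  fix x assume "G_min P *v x = 0"
  then have "cdot x (G_min P *v x) = 0" by simp
  then show "x = 0" using G_min_positive unfolding positive_definite_def by force
qed

lemma K_min_eq: "K_min P = range (hs m)"
proof
  show "K_min P \<subseteq> range (hs m)"
  proof
    fix k assume "k \<in> K_min P"
    then obtain a where a: "k = ksum a" "ksum a \<in> H (int m - 2)"
      unfolding K_min_def K_A_eq by auto
    \<comment> \<open>With \<open>J = m - 1\<close> the independence lemma asks for membership in
      \<open>H (m - 3)\<close> only, and it removes every block except the last.\<close>
    have "H (int m - 2) \<subseteq> H (- int m - 1 + 2 * int (m - 1))" using m_pos by (intro H_mono) auto
    then have mem: "ksum a \<in> H (- int m - 1 + 2 * int (m - 1))" using a by blast
    have "hs j (col a j) = (if j = m then hs m (col a m) else 0)" if "j \<in> {1..m}" for j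
    proof (cases "j = m")
      case False
      then have "col a j = 0" using that by (intro ksum_independent[OF mem]) auto
      then show ?thesis using False by simp
    qed simp
    then have "ksum a = (\<Sum>j\<in>{1..m}. if j = m then hs m (col a m) else 0)"
      unfolding ksum_levels by (intro sum.cong refl)
    then have "ksum a = hs m (col a m)" using m_pos by simp
    then show "k \<in> range (hs m)" using a by simp
  qed
  show "range (hs m) \<subseteq> K_min P"
  proof clarify
    fix x
    have "hs m x \<in> range ksum" using ksum_eta[of x] by (metis rangeI)
    then show "hs m x \<in> K_min P" unfolding K_min_def K_A_eq using hs_m_mem by blast
  qed
qed

lemma H_min_iff: "u \<in> H_min P \<longleftrightarrow> (\<exists>f x. f \<in> H (int m) \<and> u = f + ksum (eta P x))"
  unfolding H_min_def K_min_eq ksum_eta by auto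

text \<open>Orthogonality to \<open>H m\<close> removes the regular part, since the form is positive
  there; orthogonality to \<open>K_min\<close> removes the last block of Gram coordinates and leaves
  the others free.\<close>

lemma H_perp_iff: "u \<in> H_perp P \<longleftrightarrow> (\<exists>b. top_row b = 0 \<and> u = ksum b)"
proof
  assume u: "u \<in> H_perp P"
  then obtain f b where f: "f \<in> H (int m)" "u = f + ksum b"
    unfolding H_perp_def H_A_iff by blast
  have orth: "ipm g f + cdot x (top_row b) = 0" if "g \<in> H (int m)" for g x
  proof -
    have "g + ksum (eta P x) \<in> H_min P" unfolding H_min_iff using that by blast
    then have "ip_A P (g + ksum (eta P x)) u = 0" using u unfolding H_perp_def by blast
    then show ?thesis using f that by (simp add: ip_A_eq gf_eta)
  qed
  have "ipm f f = 0" using orth[OF f(1), of 0] by simp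
  then have "f = 0" using H.ip_pos[OF f(1)] by force
  moreover have "top_row b = 0"
    using orth[of 0] f(1) by (intro cdot_eqI) simp
  ultimately show "\<exists>b. top_row b = 0 \<and> u = ksum b" using f by auto
next
  assume "\<exists>b. top_row b = 0 \<and> u = ksum b"
  then obtain b where b: "top_row b = 0" "u = 0 + ksum b" by auto
  have "ip_A P v (0 + ksum b) = 0" if v: "v \<in> H_min P" for v
  proof -
    obtain f x where "f \<in> H (int m)" "v = f + ksum (eta P x)" using v unfolding H_min_iff by blast
    then show ?thesis using b(1) ip_A_eq[of f 0 "eta P x" b] by (simp add: gf_eta)
  qed
  then show "u \<in> H_perp P"
    unfolding H_perp_def b(2) using H_A_mem[of 0 b] by simp
qed

lemma norm_A_le:
  assumes "f \<in> H (int m)"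
  shows "norm_A P (f + ksum a) \<le> nrm f + (\<Sum>i\<in>idx P. cmod (a i))"
proof -
  have "(\<Sum>i\<in>idx P. (cmod (a i))\<^sup>2) = (L2_set (\<lambda>i. cmod (a i)) (idx P))\<^sup>2"
    by (simp add: L2_set_def sum_nonneg)
  then have "norm_A P (f + ksum a) = sqrt ((nrm f)\<^sup>2 + (L2_set (\<lambda>i. cmod (a i)) (idx P))\<^sup>2)"
    using assms by (simp add: norm_A_def regular_part_eq singular_part_eq dcoord_ksum cong: sum.cong)
  also have "\<dots> \<le> nrm f + L2_set (\<lambda>i. cmod (a i)) (idx P)"
    using assms by (intro sqrt_sum_squares_le_sum) (auto simp: L2_set_nonneg)
  also have "L2_set (\<lambda>i. cmod (a i)) (idx P) \<le> (\<Sum>i\<in>idx P. cmod (a i))"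
    by (rule L2_set_le_sum) simp
  finally show ?thesis by simp
qed

lemma norm_A_eta_le:
  assumes "f \<in> H (int m)"
  shows "norm_A P (f + hs m x) \<le> nrm f + real CARD('s) * norm x"
proof -
  have "(\<Sum>\<sigma>\<in>UNIV. cmod (eta P x (\<sigma>, j))) = (if j = m then \<Sum>\<sigma>\<in>UNIV. cmod (x $ \<sigma>) else 0)" for j
    by (simp add: eta_def)
  then have "(\<Sum>i\<in>idx P. cmod (eta P x i)) = (\<Sum>\<sigma>\<in>UNIV. cmod (x $ \<sigma>))"
    using m_pos by (simp add: sum_idx)
  also have "\<dots> \<le> (\<Sum>\<sigma>\<in>(UNIV::'s set). norm x)"
    by (intro sum_mono Finite_Cartesian_Product.norm_nth_le)
  finally show ?thesis using norm_A_le[OF assms, of "eta P x"] by (simp add: ksum_eta)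
qed

text \<open>The functional is \<open>A ^^ (m + 2)\<close> applied to
  \<open>h \<sigma> (m + 2)\<close>, so \<open>duality_An\<close> evaluates it as an inner product
  in \<open>H (m + 2)\<close>. One more application of \<open>A\<close> on both sides moves this to
  \<open>H m\<close> and lowers the index to \<open>m + 1\<close>.\<close>

lemma phi_vec_eq:
  assumes "f \<in> H (int m + 2)"
  shows "phi_vec P f $ \<sigma> = ipm (h \<sigma> (m + 1)) (A f)"
proof -
  have m2: "int (m + 2) = int m + 2" by simp
  have w: "h \<sigma> (m + 2) \<in> H (int m + 2)" using h_mem[of \<sigma> "m + 2"] by (simp add: add.commute)
  have "phi_vec P f $ \<sigma> = duality P (int (m + 2)) ((A ^^ (m + 2)) (h \<sigma> (m + 2))) f"
    by (simp add: phi_vec_def An_hvec[OF phi_mem] add.commute del: funpow.simps)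
  also have "\<dots> = ip (int (m + 2)) (h \<sigma> (m + 2)) f"
    using assms w unfolding m2[symmetric] by (intro duality_An) auto
  also have "\<dots> = ipm (A (h \<sigma> (m + 2))) (A f)"
    using A_ip[OF w assms] unfolding m2 by simp
  finally show ?thesis using A_hvec[OF phi_mem, of \<sigma> "m + 1"] by simp
qed

lemma cdot_phi_vec:
  assumes "f \<in> H (int m + 2)"
  shows "cdot c (phi_vec P f) = ipm (hs (m + 1) c) (A f)"
  using assms unfolding hsum_def
  by (subst H.ip_sum_left) (simp_all add: A_mem h_top_mem H.ip_scale_left cdot_def phi_vec_eq del: One_nat_def add_Suc_right)

end


section \<open>The boundary triple\<close>

context peak_model begin

text \<open>First component of the general element of \<open>B_max\<close>, bracketed as regular
  part plus \<open>ksum\<close>, so that uniqueness of the decomposition and \<open>ip_A_eq\<close>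
  apply directly.\<close>

definition bfst :: "'h \<Rightarrow> complex^'s \<Rightarrow> complex^'s \<Rightarrow> 'h" where
  "bfst f c x = (f + hs (m + 1) c) + ksum (eta P x)"

text \<open>The singular terms are merged into one coordinate function. Here \<open>b\<close> holds
  the coordinates of the component in \<open>H_perp\<close>, so it is always accompanied by
  \<open>top_row b = 0\<close>.\<close>

definition bsnd :: "'h \<Rightarrow> complex^'s \<Rightarrow> complex^'s \<Rightarrow> ('s \<times> nat \<Rightarrow> complex) \<Rightarrow> 'h" where
  "bsnd f c x b = (L f + z1c P *\<^sub>C hs (m + 1) c) + ksum (\<lambda>i. Md x i + eta P c i + b i)"

lemma H2_mem: "f \<in> H (int m + 2) \<Longrightarrow> f \<in> H (int m)"
  by (rule H_add2)

lemma regular_mem: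
  assumes "f \<in> H (int m + 2)"
  shows "f + hs (m + 1) c \<in> H (int m)" and "L f + z1c P *\<^sub>C hs (m + 1) c \<in> H (int m)"
  using H2_mem[OF assms] L_mem[OF assms] by simp_all

lemma B_repr_iff:
  "B_repr P fh f c x k' kp \<longleftrightarrow> f \<in> H (int m + 2) \<and> k' = ksum (\<lambda>i. Md x i + eta P c i) \<and>
    (\<exists>b. top_row b = 0 \<and> kp = ksum b \<and> fh = (bfst f c x, bsnd f c x b))"
proof -
  have pair: "fh = (f + hs (m + 1) c + hs m x, L f + z1c P *\<^sub>C hs (m + 1) c + k' + kp) \<longleftrightarrow>
      fh = (bfst f c x, bsnd f c x b)" if "k' = ksum (\<lambda>i. Md x i + eta P c i)" "kp = ksum b" for b
    using that ksum_add[of "\<lambda>i. Md x i + eta P c i" b] by (simp add: bfst_def bsnd_def ksum_eta add.assoc)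
  have "k' \<in> K_A P \<and> (\<forall>i\<in>idx P. dcoord P k' i = (\<Sum>l\<in>idx P. M_d P i l * eta P x l) + eta P c i) \<longleftrightarrow>
      k' = ksum (\<lambda>i. Md x i + eta P c i)" (is "?l \<longleftrightarrow> ?r")
  proof
    assume l: ?l
    then obtain a where "k' = ksum a" unfolding K_A_eq by auto
    then show ?r using l by (auto simp: dcoord_ksum Md_def intro!: ksum_cong)
  next
    assume ?r
    then show ?l unfolding K_A_eq by (auto simp: dcoord_ksum Md_def)
  qed
  then show ?thesis
    unfolding B_repr_def H_perp_iff using pair by blast
qed

lemma H_min_mem: "f \<in> H (int m) \<Longrightarrow> f + ksum (eta P x) \<in> H_min P"
  unfolding H_min_iff by blast

text \<open>\<open>h_{m+1}(c)\<close> already lies in \<open>H m\<close>, so restricting the first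
  component to \<open>H_min\<close> constrains only \<open>k\<close>, which becomes
  \<open>hs m x\<close>.\<close>

lemma B_max_iff:
  "fh \<in> B_max P \<longleftrightarrow> (\<exists>f c x b. f \<in> H (int m + 2) \<and> top_row b = 0 \<and> fh = (bfst f c x, bsnd f c x b))"
proof
  assume "fh \<in> B_max P"
  then obtain u u' kp where fh: "fh = (u, u' + kp)" "(u, u') \<in> A_max P" "u \<in> H_min P" "kp \<in> H_perp P"
    unfolding B_max_def cw_sum_def by auto
  then obtain f c k k' where f: "f \<in> H (int m + 2)" "k \<in> K_A P" "k' \<in> K_A P"
    and u: "u = f + hs (m + 1) c + k" and u': "u' = L f + z1c P *\<^sub>C hs (m + 1) c + k'"
    and d: "\<forall>i\<in>idx P. dcoord P k' i = (\<Sum>l\<in>idx P. M_d P i l * dcoord P k l) + eta P c i"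
    unfolding A_max_def by auto
  obtain a where a: "k = ksum a" using f(2) unfolding K_A_eq by auto
  obtain g x where g: "g \<in> H (int m)" "u = g + ksum (eta P x)" using fh(3) unfolding H_min_iff by blast
  have ax: "a i = eta P x i" if "i \<in> idx P" for i
    using decomposition_unique(2)[OF regular_mem(1)[OF f(1)] g(1)] u a g(2) that by simp
  have k: "k = ksum (eta P x)" unfolding a by (rule ksum_cong) (rule ax)
  have d': "\<forall>i\<in>idx P. dcoord P k' i = (\<Sum>l\<in>idx P. M_d P i l * eta P x l) + eta P c i"
    using d unfolding k by (simp add: dcoord_ksum cong: sum.cong)
  have "B_repr P fh f c x k' kp"
    unfolding B_repr_def using f fh(1,4) u u' d' k by (simp add: ksum_eta add.assoc)
  then show "\<exists>f c x b. f \<in> H (int m + 2) \<and> top_row b = 0 \<and> fh = (bfst f c x, bsnd f c x b)"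
    unfolding B_repr_iff by blast
next
  assume "\<exists>f c x b. f \<in> H (int m + 2) \<and> top_row b = 0 \<and> fh = (bfst f c x, bsnd f c x b)"
  then obtain f c x b where f: "f \<in> H (int m + 2)" and b: "top_row b = 0"
    and fh: "fh = (bfst f c x, bsnd f c x b)" by blast
  let ?k' = "ksum (\<lambda>i. Md x i + eta P c i)"
  let ?u' = "L f + z1c P *\<^sub>C hs (m + 1) c + ?k'"
  have "(bfst f c x, ?u') \<in> A_max P"
    unfolding A_max_def bfst_def mem_Collect_eq
    by (intro exI[of _ f] exI[of _ c] exI[of _ "ksum (eta P x)"] exI[of _ ?k'])
      (auto simp: f K_A_eq dcoord_ksum Md_def)
  moreover have "bfst f c x \<in> H_min P"
    unfolding bfst_def using regular_mem(1)[OF f] by (rule H_min_mem)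
  moreover have "?u' \<in> H_A P" using regular_mem(2)[OF f] by (rule H_A_mem)
  moreover have "ksum b \<in> H_perp P" unfolding H_perp_iff using b by blast
  moreover have "fh = (bfst f c x + 0, ?u' + ksum b)"
    by (simp add: fh bsnd_def ksum_add add.assoc)
  ultimately show "fh \<in> B_max P" unfolding B_max_def cw_sum_def by blast
qed

lemma B_max_mem: "f \<in> H (int m + 2) \<Longrightarrow> top_row b = 0 \<Longrightarrow> (bfst f c x, bsnd f c x b) \<in> B_max P"
  unfolding B_max_iff by blast

lemma B_max_eq: "B_max P = {fh. \<exists>f c x k' kp. B_repr P fh f c x k' kp}"
proof (intro set_eqI iffI)
  fix fh assume "fh \<in> B_max P"
  then obtain f c x b where "f \<in> H (int m + 2)" "top_row b = 0" "fh = (bfst f c x, bsnd f c x b)"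
    unfolding B_max_iff by blast
  then have "B_repr P fh f c x (ksum (\<lambda>i. Md x i + eta P c i)) (ksum b)"
    unfolding B_repr_iff by blast
  then show "fh \<in> {fh. \<exists>f c x k' kp. B_repr P fh f c x k' kp}" by blast
next
  fix fh assume "fh \<in> {fh. \<exists>f c x k' kp. B_repr P fh f c x k' kp}"
  then obtain f c x k' kp where "B_repr P fh f c x k' kp" by blast
  then show "fh \<in> B_max P" unfolding B_repr_iff B_max_iff by blast
qed

text \<open>The singular coordinates give \<open>x\<close>. In the regular part,
  \<open>hs (m + 1)\<close> of a nonzero vector is not in \<open>H (m + 1)\<close>, whereas
  \<open>f\<close> is in \<open>H (m + 2)\<close>, which separates \<open>c\<close> from
  \<open>f\<close>. So the first component alone fixes both boundary values.\<close>

lemma bfst_inj: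
  assumes "f \<in> H (int m + 2)" "f' \<in> H (int m + 2)" "bfst f c x = bfst f' c' x'"
  shows "f = f'" "c = c'" "x = x'"
proof -
  note d = decomposition_unique[OF regular_mem(1)[OF assms(1)] regular_mem(1)[OF assms(2)]
      assms(3)[unfolded bfst_def]]
  show x: "x = x'" using d(2)[OF idx_top] by (simp add: eta_def vec_eq_iff)
  have "hs (m + 1) (c - c') = f' - f" using d(1) by (simp add: hs_diff algebra_simps)
  then have "hs (m + 1) (c - c') \<in> H (int m + 2)" using assms by simp
  then have "hs (m + 1) (c - c') \<in> H (- int m - 1 + 2 * int (m + 1))"
    using H_mono[of "- int m - 1 + 2 * int (m + 1)" "int m + 2"] by auto
  then have "c - c' = 0" by (rule hs_independent)
  then show c: "c = c'" by simp
  show "f = f'" using d(1) c by simp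
qed

lemma Gamma_eq:
  assumes "B_repr P fh f c x k' kp"
  shows "Gamma0 P fh = c" and "Gamma1 P fh = phi_vec P f - G_min P *v x"
proof -
  have uniq: "f' = f \<and> c' = c \<and> x' = x" if "B_repr P fh f' c' x' k'' kp'" for f' c' x' k'' kp'
    using that assms bfst_inj[of f' f c' x' c x] unfolding B_repr_iff by auto
  show "Gamma0 P fh = c"
    unfolding Gamma0_def by (rule the_equality) (use assms uniq in blast)+
  show "Gamma1 P fh = phi_vec P f - G_min P *v x"
    unfolding Gamma1_def by (rule the_equality) (use assms uniq in blast)+
qed

lemma Gamma_bpair:
  assumes "f \<in> H (int m + 2)" "top_row b = 0"
  shows "Gamma0 P (bfst f c x, bsnd f c x b) = c"
    and "Gamma1 P (bfst f c x, bsnd f c x b) = phi_vec P f - G_min P *v x"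
  using assms Gamma_eq[of "(bfst f c x, bsnd f c x b)" f c x "ksum (\<lambda>i. Md x i + eta P c i)" "ksum b"]
  unfolding B_repr_iff by blast+

section \<open>Linearity of the boundary maps and Green's identity\<close>

lemma phi_vec_add:
  assumes "f \<in> H (int m + 2)" "g \<in> H (int m + 2)"
  shows "phi_vec P (f + g) = phi_vec P f + phi_vec P g"
  using assms A_mem h_top_mem
  by (simp add: vec_eq_iff phi_vec_eq A_add[OF assms] H.ip_add_right)

lemma phi_vec_scale:
  assumes "f \<in> H (int m + 2)"
  shows "phi_vec P (a *\<^sub>C f) = a *s phi_vec P f"
  using assms A_mem h_top_mem
  by (simp add: vec_eq_iff phi_vec_eq A_scale[OF assms] H.ip_scale_right)

lemma phi_vec_zero [simp]: "phi_vec P 0 = 0"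
  using phi_vec_scale[of 0 0] by simp

lemma bfst_lin: "a *\<^sub>C bfst f c x + b *\<^sub>C bfst g d y = bfst (a *\<^sub>C f + b *\<^sub>C g) (a *s c + b *s d) (a *s x + b *s y)"
  by (simp add: bfst_def ksum_eta scaleC_add_right hs_add hs_scale algebra_simps)

lemma bsnd_lin:
  assumes "f \<in> H (int m + 2)" "g \<in> H (int m + 2)"
  shows "a *\<^sub>C bsnd f c x k + b *\<^sub>C bsnd g d y l =
    bsnd (a *\<^sub>C f + b *\<^sub>C g) (a *s c + b *s d) (a *s x + b *s y) (\<lambda>i. a * k i + b * l i)"
proof -
  have "ksum (\<lambda>i. Md (a *s x + b *s y) i + eta P (a *s c + b *s d) i + (a * k i + b * l i)) =
      ksum (\<lambda>i. a * (Md x i + eta P c i + k i) + b * (Md y i + eta P d i + l i))"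
    by (rule ksum_cong) (simp add: Md_add Md_scale eta_add eta_scale algebra_simps)
  also have "\<dots> = a *\<^sub>C ksum (\<lambda>i. Md x i + eta P c i + k i) + b *\<^sub>C ksum (\<lambda>i. Md y i + eta P d i + l i)"
    by (simp only: ksum_add[of "\<lambda>i. a * _ i"] ksum_scale)
  finally show ?thesis
    using L_add[of "a *\<^sub>C f" "int m + 2" "b *\<^sub>C g"] L_scale[OF assms(1)] L_scale[OF assms(2)] assms
    by (simp add: bsnd_def scaleC_add_right hs_add hs_scale scaleC_scaleC mult.commute algebra_simps)
qed

lemma top_row_lin:
  "top_row k = 0 \<Longrightarrow> top_row l = 0 \<Longrightarrow> top_row (\<lambda>i. a * k i + b * l i) = 0"
  using top_row_add[of "\<lambda>i. a * k i" "\<lambda>i. b * l i"] by (simp add: top_row_scale)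

lemma B_max_linear:
  assumes "(f, f') \<in> B_max P" "(g, g') \<in> B_max P"
  shows "(a *\<^sub>C f + b *\<^sub>C g, a *\<^sub>C f' + b *\<^sub>C g') \<in> B_max P"
    "Gamma0 P (a *\<^sub>C f + b *\<^sub>C g, a *\<^sub>C f' + b *\<^sub>C g') = a *s Gamma0 P (f, f') + b *s Gamma0 P (g, g')"
    "Gamma1 P (a *\<^sub>C f + b *\<^sub>C g, a *\<^sub>C f' + b *\<^sub>C g') = a *s Gamma1 P (f, f') + b *s Gamma1 P (g, g')"
proof -
  obtain u c x k where u: "u \<in> H (int m + 2)" "top_row k = 0" "f = bfst u c x" "f' = bsnd u c x k"
    using assms(1) unfolding B_max_iff by blast
  obtain v d y l where v: "v \<in> H (int m + 2)" "top_row l = 0" "g = bfst v d y" "g' = bsnd v d y l"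
    using assms(2) unfolding B_max_iff by blast
  have w: "a *\<^sub>C u + b *\<^sub>C v \<in> H (int m + 2)" using u v by simp
  show "(a *\<^sub>C f + b *\<^sub>C g, a *\<^sub>C f' + b *\<^sub>C g') \<in> B_max P"
    "Gamma0 P (a *\<^sub>C f + b *\<^sub>C g, a *\<^sub>C f' + b *\<^sub>C g') = a *s Gamma0 P (f, f') + b *s Gamma0 P (g, g')"
    unfolding u(3,4) v(3,4) bfst_lin bsnd_lin[OF u(1) v(1)]
    using B_max_mem[OF w top_row_lin[OF u(2) v(2)]] Gamma_bpair[OF w top_row_lin[OF u(2) v(2)]]
      Gamma_bpair[OF u(1,2)] Gamma_bpair[OF v(1,2)] by simp_all
  show "Gamma1 P (a *\<^sub>C f + b *\<^sub>C g, a *\<^sub>C f' + b *\<^sub>C g') = a *s Gamma1 P (f, f') + b *s Gamma1 P (g, g')"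
    unfolding u(3,4) v(3,4) bfst_lin bsnd_lin[OF u(1) v(1)]
      Gamma_bpair[OF w top_row_lin[OF u(2) v(2)]] Gamma_bpair[OF u(1,2)] Gamma_bpair[OF v(1,2)]
    using u(1) v(1)
    by (simp add: phi_vec_add phi_vec_scale matrix_vector_right_distrib vec.scale vector_smult_assoc
        vec.scale_right_diff_distrib vector_scalar_commute)
qed

lemma ip_A_commute: "u \<in> H_A P \<Longrightarrow> v \<in> H_A P \<Longrightarrow> ip_A P u v = cnj (ip_A P v u)"
proof -
  assume "u \<in> H_A P" "v \<in> H_A P"
  then obtain f a g b where "f \<in> H (int m)" "u = f + ksum a" "g \<in> H (int m)" "v = g + ksum b"
    unfolding H_A_iff by blast
  then show ?thesis
    using gf_commute[of a b] H.ip_commute[of f "int m" g] by (simp add: ip_A_eq)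
qed

lemma H_A_lin: "u \<in> H_A P \<Longrightarrow> v \<in> H_A P \<Longrightarrow> a *\<^sub>C u + b *\<^sub>C v \<in> H_A P"
proof -
  assume "u \<in> H_A P" "v \<in> H_A P"
  then obtain f k g l where fg: "f \<in> H (int m)" "u = f + ksum k" "g \<in> H (int m)" "v = g + ksum l"
    unfolding H_A_iff by blast
  have "a *\<^sub>C u + b *\<^sub>C v = (a *\<^sub>C f + b *\<^sub>C g) + ksum (\<lambda>i. a * k i + b * l i)"
    using ksum_add[of "\<lambda>i. a * k i" "\<lambda>i. b * l i"] fg
    by (simp add: ksum_scale scaleC_add_right algebra_simps)
  then show ?thesis using fg H_A_mem[of "a *\<^sub>C f + b *\<^sub>C g"] by simp
qed

lemma ip_A_lin_right:
  assumes "w \<in> H_A P" "u \<in> H_A P" "v \<in> H_A P"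
  shows "ip_A P w (a *\<^sub>C u + b *\<^sub>C v) = a * ip_A P w u + b * ip_A P w v"
proof -
  obtain f k g l e j where fg: "f \<in> H (int m)" "u = f + ksum k" "g \<in> H (int m)" "v = g + ksum l"
      "e \<in> H (int m)" "w = e + ksum j"
    using assms unfolding H_A_iff by blast
  have "a *\<^sub>C u + b *\<^sub>C v = (a *\<^sub>C f + b *\<^sub>C g) + ksum (\<lambda>i. a * k i + b * l i)"
    using ksum_add[of "\<lambda>i. a * k i" "\<lambda>i. b * l i"] fg
    by (simp add: ksum_scale scaleC_add_right algebra_simps)
  then have "ip_A P w (a *\<^sub>C u + b *\<^sub>C v) = ipm e (a *\<^sub>C f + b *\<^sub>C g) + gf j (\<lambda>i. a * k i + b * l i)"
    using fg ip_A_eq[of e "a *\<^sub>C f + b *\<^sub>C g"] by simp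
  then show ?thesis
    using fg gf_add_right[of j "\<lambda>i. a * k i" "\<lambda>i. b * l i"]
    by (simp add: ip_A_eq H.ip_add_right H.ip_scale_right gf_scale_right algebra_simps)
qed

lemma ip_A_diff_right:
  "w \<in> H_A P \<Longrightarrow> u \<in> H_A P \<Longrightarrow> v \<in> H_A P \<Longrightarrow> ip_A P w (u - v) = ip_A P w u - ip_A P w v"
  using ip_A_lin_right[of w u v 1 "-1"] by (simp add: scaleC_one)

lemma ip_A_lin_left:
  assumes "w \<in> H_A P" "u \<in> H_A P" "v \<in> H_A P"
  shows "ip_A P (a *\<^sub>C u + b *\<^sub>C v) w = cnj a * ip_A P u w + cnj b * ip_A P v w"
  using ip_A_commute[OF H_A_lin[OF assms(2,3)] assms(1), of a b] ip_A_lin_right[OF assms, of a b]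
    ip_A_commute[OF assms(2,1)] ip_A_commute[OF assms(3,1)] by simp

lemma bfst_mem: "f \<in> H (int m + 2) \<Longrightarrow> bfst f c x \<in> H_A P"
  unfolding bfst_def by (intro H_A_mem regular_mem)

lemma bsnd_mem: "f \<in> H (int m + 2) \<Longrightarrow> bsnd f c x b \<in> H_A P"
  unfolding bsnd_def by (intro H_A_mem regular_mem)

lemma B_max_H_A: "(f, f') \<in> B_max P \<Longrightarrow> f \<in> H_A P \<and> f' \<in> H_A P"
  unfolding B_max_iff using bfst_mem bsnd_mem by auto

lemma top_row_bsnd: "top_row b = 0 \<Longrightarrow>
  top_row (\<lambda>i. Md x i + eta P c i + b i) = Delta P *v x + G_min P *v c"
  using top_row_add[of "\<lambda>i. Md x i + eta P c i" b] top_row_add[of "Md x" "eta P c"]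
  by (simp add: top_row_Md top_row_eta)

lemma ip_A_bfst_bsnd:
  assumes f: "f \<in> H (int m + 2)" and g: "g \<in> H (int m + 2)" and b: "top_row b = 0"
  shows "ip_A P (bfst f c x) (bsnd g d y b) =
    ipm (f + hs (m + 1) c) (L g + z1c P *\<^sub>C hs (m + 1) d) + cdot x (Delta P *v y + G_min P *v d)"
  unfolding bfst_def bsnd_def ip_A_eq[OF regular_mem(1)[OF f] regular_mem(2)[OF g]] gf_eta
    top_row_bsnd[OF b] ..

text \<open>After the \<open>z1\<close> terms, the pairing of the smooth parts and the
  \<open>Delta\<close> terms cancel by symmetry, what remains is the pairing of
  \<open>hs (m + 1) c\<close> with \<open>A v\<close>, its mirror image, and the mixed
  \<open>G_min\<close> terms. The former are the functionals by \<open>cdot_phi_vec\<close>; the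
  latter supply the second summand of \<open>Gamma1\<close>.\<close>

lemma Green_identity:
  assumes "(f, f') \<in> B_max P" "(g, g') \<in> B_max P"
  shows "ip_A P f g' - ip_A P f' g =
    cdot (Gamma0 P (f, f')) (Gamma1 P (g, g')) - cdot (Gamma1 P (f, f')) (Gamma0 P (g, g'))"
proof -
  obtain u c x k where u: "u \<in> H (int m + 2)" "top_row k = 0" "f = bfst u c x" "f' = bsnd u c x k"
    using assms(1) unfolding B_max_iff by blast
  obtain v d y l where v: "v \<in> H (int m + 2)" "top_row l = 0" "g = bfst v d y" "g' = bsnd v d y l"
    using assms(2) unfolding B_max_iff by blast
  define C D where C_def: "C = hs (m + 1) c" and D_def: "D = hs (m + 1) d"
  note mem = H2_mem[OF u(1)] H2_mem[OF v(1)] hs_top_mem[of c, folded C_def D_def] hs_top_mem[of d, folded C_def D_def] A_mem[OF u(1)] A_mem[OF v(1)]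
  \<comment> \<open>This form isolates \<open>z1\<close> times the regular part of the first
    component, a real multiple that contributes equally to both sides.\<close>
  have Lu: "L u + z1c P *\<^sub>C C = A u + z1c P *\<^sub>C (u + C)" and Lv: "L v + z1c P *\<^sub>C D = A v + z1c P *\<^sub>C (v + D)"
    by (simp_all add: A_def scaleC_add_right)
  have 1: "ip_A P f g' = ipm (u + C) (A v) + z1c P * ipm (u + C) (v + D) + cdot x (Delta P *v y + G_min P *v d)"
    unfolding u(3) v(4) ip_A_bfst_bsnd[OF u(1) v(1,2), of c x d y, folded C_def D_def] Lv
    using mem by (simp add: H.ip_add_right[of "u + C" "int m" "A v"] H.ip_scale_right)
  have "ip_A P g f' = ipm (v + D) (A u) + z1c P * ipm (v + D) (u + C) + cdot y (Delta P *v x + G_min P *v c)"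
    unfolding u(4) v(3) ip_A_bfst_bsnd[OF v(1) u(1,2), of d y c x, folded C_def D_def] Lu
    using mem by (simp add: H.ip_add_right[of "v + D" "int m" "A u"] H.ip_scale_right)
  then have 2: "ip_A P f' g = ipm (A u) (v + D) + z1c P * ipm (u + C) (v + D) + cdot (Delta P *v x + G_min P *v c) y"
    using ip_A_commute[of f' g] bsnd_mem[OF u(1)] bfst_mem[OF v(1)] mem u(4) v(3)
      H.ip_commute[of "A u" "int m" "v + D"] H.ip_commute[of "u + C" "int m" "v + D"]
      cdot_commute[of "Delta P *v x + G_min P *v c" y] by simp
  have "ipm u (A v) = ipm (A u) v" using A_symmetric u(1) v(1) by blast
  moreover have "cdot c (phi_vec P v) = ipm C (A v)" using cdot_phi_vec[OF v(1), of c, folded C_def D_def] .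
  moreover have "cdot (phi_vec P u) d = ipm (A u) D"
    using cdot_phi_vec[OF u(1), of d, folded C_def D_def] cdot_commute[of "phi_vec P u" d] H.ip_commute[of "A u" "int m" D] mem by simp
  ultimately have "ip_A P f g' - ip_A P f' g = cdot c (phi_vec P v) - cdot (phi_vec P u) d
      + cdot x (Delta P *v y + G_min P *v d) - cdot (Delta P *v x + G_min P *v c) y"
    unfolding 1 2 using mem by (simp add: H.ip_add_left H.ip_add_right)
  also have "\<dots> = cdot c (phi_vec P v - G_min P *v y) - cdot (phi_vec P u - G_min P *v x) d"
    by (simp add: cdot_add_left cdot_add_right cdot_diff_left cdot_diff_right cdot_Delta cdot_G_min)
  finally show ?thesis
    unfolding u(3,4) v(3,4) Gamma_bpair[OF u(1,2)] Gamma_bpair[OF v(1,2)] .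
qed

text \<open>A right inverse of the pair of boundary maps. Taking the smooth part zero leaves
  \<open>- G_min *v x\<close> as second boundary value, hence this choice of
  \<open>x\<close>.\<close>

definition lift :: "complex^'s \<Rightarrow> complex^'s \<Rightarrow> 'h \<times> 'h" where
  "lift c v = (let x = - (matrix_inv (G_min P) *v v) in (bfst 0 c x, bsnd 0 c x (\<lambda>i. 0)))"

lemma lift: "lift c v \<in> B_max P" "Gamma0 P (lift c v) = c" "Gamma1 P (lift c v) = v"
proof -
  let ?x = "- (matrix_inv (G_min P) *v v)"
  have l: "lift c v = (bfst 0 c ?x, bsnd 0 c ?x (\<lambda>i. 0))" by (simp add: lift_def Let_def)
  have "G_min P *v ?x = - v"
    using matrix_inv_mult(1)[OF G_min_invertible, of v]
    by (metis diff_0 matrix_vector_mult_0_right matrix_vector_mult_diff_distrib)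
  then show "lift c v \<in> B_max P" "Gamma0 P (lift c v) = c" "Gamma1 P (lift c v) = v"
    unfolding l using B_max_mem[of 0 "\<lambda>i. 0" c ?x] Gamma_bpair[of 0 "\<lambda>i. 0" c ?x] by simp_all
qed

text \<open>Only elements of \<open>B_max\<close> with \<open>c = 0\<close> are used as tests:
  multivalued elements, pairs \<open>(f, L f)\<close>, and elements whose first component is in
  \<open>K_min\<close>. They determine in turn the singular coordinates of \<open>g\<close>, the
  regular parts, and the last Gram block of \<open>g'\<close>.\<close>

lemma B_min_subset: "B_min P \<subseteq> B_max P"
proof clarify
  fix g g' assume "(g, g') \<in> B_min P"
  then have g: "g \<in> H_A P" "g' \<in> H_A P" and adj: "\<And>f f'. (f, f') \<in> B_max P \<Longrightarrow> ip_A P f g' = ip_A P f' g"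
    unfolding B_min_def rel_adjoint_def by auto
  obtain v a where v: "v \<in> H (int m)" "g = v + ksum a" using g(1) unfolding H_A_iff by blast
  obtain v' a' where v': "v' \<in> H (int m)" "g' = v' + ksum a'" using g(2) unfolding H_A_iff by blast
  have eta0: "eta P 0 i = 0" for i by (cases i) (simp add: eta_def)
  have Md0: "Md 0 i = 0" for i by (simp add: Md_eq)
  \<comment> \<open>Column \<open>i\<close> of the inverse Gram matrix, for \<open>i\<close> outside
    the last block, has zero \<open>top_row\<close> and is thus a multivalued element of
    \<open>B_max\<close>. Pairing \<open>a\<close> with it extracts the coordinate
    \<open>a i\<close> up to conjugation.\<close>
  have aj: "a i = 0" if i: "i \<in> idx P" "snd i \<noteq> m" for i
  proof -
    obtain B where B: "\<And>i k. i \<in> idx P \<Longrightarrow> k \<in> idx P \<Longrightarrow> (\<Sum>j\<in>idx P. Gram P i j * B j k) = (if i = k then 1 else 0)"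
      using Gram_invertible unfolding invertible_on_def by blast
    have b0: "top_row (\<lambda>k. B k i) = 0"
      unfolding top_row_def vec_eq_iff using B[OF idx_top i(1)] i(2) by (auto simp: prod_eq_iff)
    have pair: "bfst 0 0 0 = 0 + ksum (\<lambda>i. 0)" "bsnd 0 0 0 (\<lambda>k. B k i) = 0 + ksum (\<lambda>k. B k i)"
      using L_scale[of 0 "int m" 0] by (simp_all add: bfst_def bsnd_def eta0 Md0 ksum_eta)
    have "gf (\<lambda>k. B k i) a = 0"
      using adj[OF B_max_mem[OF _ b0, of 0 0 0]] unfolding pair v(2) v'(2)
      using ip_A_eq[OF _ v'(1), of 0 "\<lambda>i. 0" a'] ip_A_eq[OF _ v(1), of 0 "\<lambda>k. B k i" a] v(1) v'(1)
      by (simp add: gf_def)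
    then have "gf a (\<lambda>k. B k i) = 0" using gf_commute[of a] by simp
    moreover have "gf a (\<lambda>k. B k i) = (\<Sum>k\<in>idx P. cnj (a k) * (\<Sum>j\<in>idx P. Gram P k j * B j i))"
      by (simp add: gf_def sum_distrib_left mult.assoc)
    moreover have "\<dots> = (\<Sum>k\<in>idx P. if k = i then cnj (a i) else 0)"
      using B[OF _ i(1)] by (intro sum.cong) auto
    ultimately show ?thesis using i(1) by simp
  qed
  define y where "y = col a m"
  have ka: "ksum a = ksum (eta P y)"
  proof (rule ksum_cong)
    fix i assume "i \<in> idx P"
    then show "a i = eta P y i" using aj[of i] by (cases i) (auto simp: eta_def y_def col_def)
  qed
  interpret S: selfadjoint "H (int m)" ipm "H (int m + 2)" L by (rule selfadjoint_H)
  \<comment> \<open>Testing with all pairs \<open>(f, L f)\<close> is the adjoint test for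
    \<open>L\<close> in \<open>H m\<close>.\<close>
  have "v \<in> H (int m + 2) \<and> L v = v'"
  proof (rule S.adjointI[OF v(1) v'(1)])
    fix f assume f: "f \<in> H (int m + 2)"
    have pair: "bfst f 0 0 = f + ksum (\<lambda>i. 0)" "bsnd f 0 0 (\<lambda>i. 0) = L f + ksum (\<lambda>i. 0)"
      by (simp_all add: bfst_def bsnd_def eta0 Md0 ksum_eta)
    show "ipm f v' = ipm (L f) v"
      using adj[OF B_max_mem[OF f, of "\<lambda>i. 0" 0 0]] unfolding pair v(2) v'(2)
        ip_A_eq[OF H2_mem[OF f] v'(1)] ip_A_eq[OF L_mem[OF f] v(1)]
      by (simp add: gf_def)
  qed
  then have v2: "v \<in> H (int m + 2)" and Lv: "v' = L v" by auto
  have "top_row a' = Delta P *v y"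
  proof (rule cdot_eqI)
    fix x
    have pair: "bfst 0 0 x = 0 + ksum (eta P x)" "bsnd 0 0 x (\<lambda>i. 0) = 0 + ksum (Md x)"
      using L_scale[of 0 "int m" 0] by (simp_all add: bfst_def bsnd_def eta0)
    have "ip_A P (0 + ksum (eta P x)) g' = ip_A P (0 + ksum (Md x)) g"
      using adj[OF B_max_mem[of 0 "\<lambda>i. 0" 0 x]] unfolding pair by simp
    then have "gf (eta P x) a' = gf (Md x) (eta P y)"
      unfolding v(2) v'(2) ka using ip_A_eq[OF _ v'(1), of 0] ip_A_eq[OF _ v(1), of 0] v(1) v'(1) by simp
    also have "\<dots> = cdot (Delta P *v x) y"
      using gf_commute[of "Md x" "eta P y"] cdot_commute[of "Delta P *v x" y] by (simp add: gf_eta top_row_Md)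
    finally show "cdot x (top_row a') = cdot x (Delta P *v y)" by (simp add: gf_eta cdot_Delta)
  qed
  then have b: "top_row (\<lambda>i. a' i - Md y i) = 0" by (simp add: top_row_diff top_row_Md)
  have "g = bfst v 0 y" "g' = bsnd v 0 y (\<lambda>i. a' i - Md y i)"
    using v(2) v'(2) Lv ka by (simp_all add: bfst_def bsnd_def eta0)
  then show "(g, g') \<in> B_max P" using B_max_mem[OF v2 b, of 0 y] by simp
qed

text \<open>By Green's identity, membership says that the boundary values annihilate those of all of
  \<open>B_max\<close>; these fill the whole space by \<open>lift\<close>, and the boundary form is
  nondegenerate.\<close>

lemma B_min_mem_iff:
  assumes "(g, g') \<in> B_max P"
  shows "(g, g') \<in> B_min P \<longleftrightarrow> Gamma0 P (g, g') = 0 \<and> Gamma1 P (g, g') = 0"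
proof
  assume l: "(g, g') \<in> B_min P"
  have "cdot c (Gamma1 P (g, g')) - cdot v (Gamma0 P (g, g')) = 0" for c v
  proof -
    obtain f f' where f: "lift c v = (f, f')" by fastforce
    then have fB: "(f, f') \<in> B_max P" "Gamma0 P (f, f') = c" "Gamma1 P (f, f') = v"
      using lift[of c v] by auto
    have "ip_A P f g' = ip_A P f' g" using l fB(1) unfolding B_min_def rel_adjoint_def by auto
    then show ?thesis using Green_identity[OF fB(1) assms] fB by simp
  qed
  from this[of _ 0] this[of 0] show "Gamma0 P (g, g') = 0 \<and> Gamma1 P (g, g') = 0"
    by (auto intro!: cdot_eqI)
next
  assume r: "Gamma0 P (g, g') = 0 \<and> Gamma1 P (g, g') = 0"
  have "ip_A P f g' = ip_A P f' g" if "(f, f') \<in> B_max P" for f f'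
    using Green_identity[OF that assms] r by simp
  then show "(g, g') \<in> B_min P"
    unfolding B_min_def rel_adjoint_def using B_max_H_A[OF assms] by auto
qed

text \<open>For a pair in the adjoint of \<open>B_min\<close>, its pairing \<open>\<Lambda>\<close>
  with \<open>B_max\<close> vanishes on \<open>B_min\<close>, so it depends only on the boundary
  values. By finite dimension it is given by two vectors, hence by some element of
  \<open>B_max\<close>; subtracting that element leaves a member of \<open>B_min\<close>.\<close>

lemma B_max_biadjoint: "B_max P = rel_adjoint (H_A P) (ip_A P) (B_min P)"
proof (intro set_eqI iffI)
  fix fh assume fh: "fh \<in> B_max P"
  obtain u u' where uu: "fh = (u, u')" by fastforce
  have "ip_A P f u' = ip_A P f' u" if f: "(f, f') \<in> B_min P" for f f'
  proof -
    have fB: "(f, f') \<in> B_max P" using f B_min_subset by blast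
    then show ?thesis using Green_identity[OF fB fh[unfolded uu]] f B_min_mem_iff[OF fB] by simp
  qed
  then show "fh \<in> rel_adjoint (H_A P) (ip_A P) (B_min P)"
    unfolding rel_adjoint_def using B_max_H_A fh uu by auto
next
  fix fh assume fh: "fh \<in> rel_adjoint (H_A P) (ip_A P) (B_min P)"
  obtain u u' where uu: "fh = (u, u')" by fastforce
  then have u: "u \<in> H_A P" "u' \<in> H_A P"
    and adj: "\<And>f f'. (f, f') \<in> B_min P \<Longrightarrow> ip_A P f u' = ip_A P f' u"
    using fh unfolding rel_adjoint_def by auto
  define \<Lambda> where "\<Lambda> fh = ip_A P (fst fh) u' - ip_A P (snd fh) u" for fh
  have \<Lambda>_lin: "\<Lambda> (a *\<^sub>C f + b *\<^sub>C g, a *\<^sub>C f' + b *\<^sub>C g') = cnj a * \<Lambda> (f, f') + cnj b * \<Lambda> (g, g')"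
    if "(f, f') \<in> B_max P" "(g, g') \<in> B_max P" for a b f f' g g'
    using B_max_H_A[OF that(1)] B_max_H_A[OF that(2)] u
    by (simp add: \<Lambda>_def ip_A_lin_left algebra_simps)
  have \<Lambda>_Gamma: "\<Lambda> p = \<Lambda> r" if p: "p \<in> B_max P" and r: "r \<in> B_max P"
    and "Gamma0 P p = Gamma0 P r" "Gamma1 P p = Gamma1 P r" for p r
  proof -
    obtain f f' g g' where pr: "p = (f, f')" "r = (g, g')" by fastforce
    note lin = B_max_linear[OF p[unfolded pr] r[unfolded pr], of 1 "-1"]
    have "(1 *\<^sub>C f + (-1) *\<^sub>C g, 1 *\<^sub>C f' + (-1) *\<^sub>C g') \<in> B_min P"
      unfolding B_min_mem_iff[OF lin(1)] lin(2,3) using that pr by (simp add: vec_eq_iff)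
    then have "\<Lambda> (1 *\<^sub>C f + (-1) *\<^sub>C g, 1 *\<^sub>C f' + (-1) *\<^sub>C g') = 0"
      using adj unfolding \<Lambda>_def by simp
    then show ?thesis using \<Lambda>_lin[OF p[unfolded pr] r[unfolded pr], of 1 "-1"] pr by simp
  qed
  have \<Lambda>_lift: "\<Lambda> (lift (a *s c + b *s d) (a *s v + b *s w)) = cnj a * \<Lambda> (lift c v) + cnj b * \<Lambda> (lift d w)"
    for a b c d v w
  proof -
    obtain f f' g g' where pr: "lift c v = (f, f')" "lift d w = (g, g')" by fastforce
    have B: "(f, f') \<in> B_max P" "(g, g') \<in> B_max P" using lift(1) pr by metis+
    have G: "Gamma0 P (f, f') = c" "Gamma1 P (f, f') = v" "Gamma0 P (g, g') = d" "Gamma1 P (g, g') = w"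
      using lift pr by metis+
    have "\<Lambda> (lift (a *s c + b *s d) (a *s v + b *s w)) = \<Lambda> (a *\<^sub>C f + b *\<^sub>C g, a *\<^sub>C f' + b *\<^sub>C g')"
      using B_max_linear[OF B] by (intro \<Lambda>_Gamma lift) (simp_all add: lift G)
    then show ?thesis using \<Lambda>_lin[OF B] pr by simp
  qed
  have "\<exists>a. \<forall>c. \<Lambda> (lift c 0) = cdot c a"
    using \<Lambda>_lift[of 1 _ 1 _ 0 0] \<Lambda>_lift[of _ _ 0 0 0 0] by (intro conjugate_linear_functional) simp_all
  then obtain a where a: "\<And>c. \<Lambda> (lift c 0) = cdot c a" by blast
  have "\<exists>b. \<forall>v. \<Lambda> (lift 0 v) = cdot v b"
    using \<Lambda>_lift[of 1 0 1 0] \<Lambda>_lift[of _ 0 0 0 _ 0] by (intro conjugate_linear_functional) simp_all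
  then obtain b where b: "\<And>v. \<Lambda> (lift 0 v) = cdot v b" by blast
  have ab: "\<Lambda> (lift c v) = cdot c a + cdot v b" for c v
    using \<Lambda>_lift[of 1 c 1 0 0 v] a b by simp
  \<comment> \<open>Green's identity pairs the first boundary value with the second and carries a
    minus sign in the other term, so the vectors \<open>a\<close> and \<open>b\<close> are matched
    by the boundary values \<open>- b\<close> and \<open>a\<close>.\<close>
  obtain w w' where w: "lift (- b) a = (w, w')" by fastforce
  have wB: "(w, w') \<in> B_max P" "Gamma0 P (w, w') = - b" "Gamma1 P (w, w') = a"
    using lift[of "- b" a] w by auto
  have wA: "w \<in> H_A P" "w' \<in> H_A P" using B_max_H_A[OF wB(1)] by auto
  have "(u - w, u' - w') \<in> B_min P"
    unfolding B_min_def rel_adjoint_def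
  proof (clarify, intro conjI ballI)
    show "u - w \<in> H_A P" "u' - w' \<in> H_A P"
      using H_A_lin[OF u(1) wA(1), of 1 "-1"] H_A_lin[OF u(2) wA(2), of 1 "-1"] by (simp_all add: scaleC_one)
    fix p assume p: "p \<in> B_max P"
    obtain f f' where ff: "p = (f, f')" by fastforce
    have fA: "f \<in> H_A P" "f' \<in> H_A P" using B_max_H_A p ff by auto
    have "\<Lambda> p = \<Lambda> (lift (Gamma0 P p) (Gamma1 P p))"
      using p by (intro \<Lambda>_Gamma) (simp_all add: lift)
    also have "\<dots> = cdot (Gamma0 P p) a - cdot (Gamma1 P p) (- b)"
      using cdot_diff_right[of "Gamma1 P p" 0 b] by (simp add: ab)
    also have "\<dots> = ip_A P f w' - ip_A P f' w"
      using Green_identity[OF p[unfolded ff] wB(1)] wB by (simp add: ff)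
    finally show "case p of (f, f') \<Rightarrow> ip_A P f (u' - w') = ip_A P f' (u - w)"
      using u wA fA by (simp add: \<Lambda>_def ff ip_A_diff_right algebra_simps)
  qed
  then have "(u - w, u' - w') \<in> B_max P" using B_min_subset by blast
  from B_max_linear(1)[OF this wB(1), of 1 1] show "fh \<in> B_max P" by (simp add: uu scaleC_one)
qed

lemma boundary_triple: "boundary_triple (H_A P) (ip_A P) (B_min P) (B_max P) (Gamma0 P) (Gamma1 P)"
  unfolding boundary_triple_def
proof (intro conjI)
  show "(\<lambda>fh. (Gamma0 P fh, Gamma1 P fh)) ` B_max P = UNIV"
  proof (intro set_eqI iffI UNIV_I)
    fix p :: "(complex^'s) \<times> (complex^'s)"
    show "p \<in> (\<lambda>fh. (Gamma0 P fh, Gamma1 P fh)) ` B_max P"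
      using lift[of "fst p" "snd p"] by (intro image_eqI[of _ _ "lift (fst p) (snd p)"]) auto
  qed
qed (use B_max_biadjoint B_max_linear Green_identity in \<open>auto simp del: vec_eq_iff\<close>)

end


section \<open>The Weyl function\<close>

context peak_model begin

abbreviation Dh where "Dh \<equiv> Delta_hat P"
abbreviation N where "N z \<equiv> matrix_inv (mat z - Dh)"
abbreviation \<gamma> where "\<gamma> \<equiv> gamma_field (B_max P) (Gamma0 P)"
abbreviation W where "W \<equiv> weyl_function (B_max P) (Gamma0 P) (Gamma1 P)"

lemma G_min_Delta_hat: "G_min P *v (Dh *v x) = Delta P *v x"
  by (simp add: Delta_hat_def matrix_inv_mult(1)[OF G_min_invertible] flip: matrix_vector_mul_assoc)

text \<open>Multiplication by the invertible \<open>G_min\<close> yields the last Gram block of the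
  eigenvalue equation, the form in which it arises from \<open>B_max\<close>.\<close>

lemma chi_equation: "(mat z - Dh) *v x = c \<longleftrightarrow> z *s (G_min P *v x) = Delta P *v x + G_min P *v c"
proof -
  have "G_min P *v ((mat z - Dh) *v x) = z *s (G_min P *v x) - Delta P *v x"
    by (simp add: matrix_vector_mult_diff_rdistrib matrix_vector_mult_diff_distrib mat_mult_vec
        vector_scalar_commute G_min_Delta_hat)
  moreover have "(mat z - Dh) *v x = c \<longleftrightarrow> G_min P *v ((mat z - Dh) *v x) = G_min P *v c"
    using matrix_inv_mult(2)[OF G_min_invertible] by metis
  ultimately show ?thesis by (auto simp: algebra_simps)
qed

lemma N_invertible:
  assumes "z \<in> matrix_res Dh"
  shows "invertible (mat z - Dh)" and "N z *v c = - (matrix_inv (Dh - mat z) *v c)"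
proof -
  have inv: "invertible (Dh - mat z)" using assms by (simp add: matrix_res_def)
  have neg: "(mat z - Dh) *v x = - ((Dh - mat z) *v x)" for x
    by (simp add: matrix_vector_mult_diff_rdistrib)
  show i: "invertible (mat z - Dh)" using inv unfolding invertible_iff_ker neg by simp
  have "(Dh - mat z) *v (- x) = - ((Dh - mat z) *v x)" for x
    using matrix_vector_mult_diff_distrib[of "Dh - mat z" 0 x] by simp
  then show "N z *v c = - (matrix_inv (Dh - mat z) *v c)"
    by (intro matrix_inv_eqI[OF i]) (simp add: neg matrix_inv_mult(1)[OF inv])
qed

lemma N_iff: "z \<in> matrix_res Dh \<Longrightarrow> x = N z *v c \<longleftrightarrow> (mat z - Dh) *v x = c"
  using matrix_inv_mult[OF N_invertible(1)] by metis

text \<open>The regular parts of \<open>z f\<close> and of the second component give the resolvent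
  equation for \<open>g + hs (m + 1) c\<close>. Among the singular coordinates the
  \<open>H_perp\<close> term is unknown, but applying \<open>top_row\<close> eliminates it.\<close>

lemma ker_B_max_forward:
  assumes z: "z \<in> res_L P" and f: "(f, z *\<^sub>C f) \<in> B_max P" and c: "Gamma0 P (f, z *\<^sub>C f) = c"
  shows "\<exists>x. (mat z - Dh) *v x = c \<and> f = resolv P z (hs m c) + hs m x"
proof -
  obtain g d x b where g: "g \<in> H (int m + 2)" "top_row b = 0" "f = bfst g d x" "z *\<^sub>C f = bsnd g d x b"
    using f unfolding B_max_iff by blast
  have d: "d = c" using Gamma_bpair(1)[OF g(1,2)] c g(3,4) by metis
  define w where "w = g + hs (m + 1) c"
  have w: "w \<in> H (int m)" using regular_mem(1)[OF g(1)] by (simp add: w_def)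
  have zw: "z *\<^sub>C w \<in> H (int m)" using w by simp
  have "z *\<^sub>C w + ksum (\<lambda>i. z * eta P x i) = bsnd g c x b"
    using g(3,4) d by (simp add: bfst_def w_def scaleC_add_right ksum_scale)
  note dec = decomposition_unique[OF zw regular_mem(2)[OF g(1)] this[unfolded bsnd_def]]
  have "top_row (\<lambda>i. z * eta P x i) = top_row (\<lambda>i. Md x i + eta P c i + b i)"
    by (rule top_row_cong) (rule dec(2))
  then have "z *s (G_min P *v x) = Delta P *v x + G_min P *v c"
    by (simp add: top_row_scale top_row_eta top_row_bsnd[OF g(2)])
  moreover have "resolv P z (hs m c) = w"
  proof (rule resolv_eqI[OF z w])
    have "L w = L g + L (hs (m + 1) c)"
      unfolding w_def by (rule L_add[OF H2_mem[OF g(1)] hs_top_mem])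
    then show "L w - z *\<^sub>C w = hs m c"
      using dec(1) A_hs_top[of c] by (simp add: A_def algebra_simps)
  qed
  ultimately show ?thesis
    using g(3) d by (intro exI[of _ x]) (simp add: chi_equation bfst_def w_def ksum_eta)
qed

text \<open>\<open>L - z\<close> maps \<open>hs (m + 1) c\<close> to
  \<open>hs m c - (z - z1) *\<^sub>C hs (m + 1) c\<close>. So the smooth part of the kernel element
  is \<open>z - z1\<close> times the resolvent of \<open>hs (m + 1) c\<close>, which is where the
  prefactor of \<open>q_fun\<close> comes from.\<close>

lemma regular_component:
  assumes z: "z \<in> res_L P"
  shows "(z - z1c P) *\<^sub>C resolv P z (hs (m + 1) c) = resolv P z (hs m c) - hs (m + 1) c"
proof -
  have r: "resolv P z (hs m c) \<in> H (int m)" using resolv_mem[OF z hs_m_mem] by simp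
  have "resolv P z ((z - z1c P) *\<^sub>C hs (m + 1) c) = resolv P z (hs m c) - hs (m + 1) c"
  proof (rule resolv_eqI[OF z])
    show "resolv P z (hs m c) - hs (m + 1) c \<in> H (int m)" using r by simp
    show "L (resolv P z (hs m c) - hs (m + 1) c) - z *\<^sub>C (resolv P z (hs m c) - hs (m + 1) c) =
        (z - z1c P) *\<^sub>C hs (m + 1) c"
      unfolding shift_diff[OF r hs_top_mem] shift_resolv[OF z hs_m_mem]
      using A_hs_top[of c] by (simp add: A_def complex_vector.scale_left_diff_distrib algebra_simps)
  qed
  then show ?thesis using resolv_scale[OF z hs_top_mem] by simp
qed

lemma ker_B_max_backward:
  assumes z: "z \<in> res_L P" and x: "(mat z - Dh) *v x = c" and f: "f = resolv P z (hs m c) + hs m x"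
  shows "(f, z *\<^sub>C f) \<in> B_max P" "Gamma0 P (f, z *\<^sub>C f) = c"
    "Gamma1 P (f, z *\<^sub>C f) = (z - z1c P) *s phi_vec P (resolv P z (hs (m + 1) c)) - G_min P *v x"
proof -
  define g where "g = (z - z1c P) *\<^sub>C resolv P z (hs (m + 1) c)"
  have rg: "resolv P z (hs (m + 1) c) \<in> H (int m + 2)" by (rule resolv_mem[OF z hs_top_mem])
  then have g: "g \<in> H (int m + 2)" by (simp add: g_def)
  have gr: "g + hs (m + 1) c = resolv P z (hs m c)" using regular_component[OF z] by (simp add: g_def)
  have Lg: "L g - z *\<^sub>C g = (z - z1c P) *\<^sub>C hs (m + 1) c"
    unfolding g_def shift_scale[OF rg] shift_resolv[OF z hs_top_mem] ..
  \<comment> \<open>The whole defect of the singular eigenvalue equation is assigned to the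
    \<open>H_perp\<close> term; the equation for \<open>x\<close> says precisely that its last Gram
    block vanishes.\<close>
  define b where "b i = z * eta P x i - (Md x i + eta P c i)" for i
  have b: "top_row b = 0"
  proof -
    have "top_row b = z *s (G_min P *v x) - (Delta P *v x + G_min P *v c)"
      using top_row_diff[of "\<lambda>i. z * eta P x i" "\<lambda>i. Md x i + eta P c i"] top_row_bsnd[of "\<lambda>i. 0" x c]
      by (simp add: b_def[abs_def] top_row_scale top_row_eta)
    then show ?thesis using x unfolding chi_equation by simp
  qed
  have f1: "f = bfst g c x" using gr f by (simp add: bfst_def ksum_eta)
  have "bsnd g c x b = (L g + z1c P *\<^sub>C hs (m + 1) c) + ksum (\<lambda>i. z * eta P x i)"
    by (simp add: bsnd_def b_def)
  also have "\<dots> = z *\<^sub>C (g + hs (m + 1) c) + z *\<^sub>C hs m x"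
    using Lg by (simp add: ksum_scale ksum_eta scaleC_add_right complex_vector.scale_left_diff_distrib algebra_simps)
  finally have f2: "z *\<^sub>C f = bsnd g c x b" unfolding gr by (simp add: f scaleC_add_right)
  show "(f, z *\<^sub>C f) \<in> B_max P" "Gamma0 P (f, z *\<^sub>C f) = c"
    unfolding f2 unfolding f1 using B_max_mem[OF g b] Gamma_bpair(1)[OF g b] by auto
  have "Gamma1 P (f, z *\<^sub>C f) = phi_vec P g - G_min P *v x"
    unfolding f2 unfolding f1 by (rule Gamma_bpair(2)[OF g b])
  then show "Gamma1 P (f, z *\<^sub>C f) = (z - z1c P) *s phi_vec P (resolv P z (hs (m + 1) c)) - G_min P *v x"
    unfolding g_def phi_vec_scale[OF rg] .
qed

lemma ker_B_max_iff:
  assumes "z \<in> res_L P" "z \<in> matrix_res Dh"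
  shows "f \<in> ker_rel (B_max P) z \<and> Gamma0 P (f, z *\<^sub>C f) = c \<longleftrightarrow>
    f = resolv P z (hs m c) + hs m (N z *v c)"
proof
  assume "f \<in> ker_rel (B_max P) z \<and> Gamma0 P (f, z *\<^sub>C f) = c"
  then obtain x where x: "(mat z - Dh) *v x = c" "f = resolv P z (hs m c) + hs m x"
    using ker_B_max_forward[OF assms(1), of f c] unfolding ker_rel_def by blast
  then show "f = resolv P z (hs m c) + hs m (N z *v c)" using N_iff[OF assms(2), of x c] by simp
next
  assume f: "f = resolv P z (hs m c) + hs m (N z *v c)"
  have "(mat z - Dh) *v (N z *v c) = c" using N_iff[OF assms(2), of _ c] by blast
  then show "f \<in> ker_rel (B_max P) z \<and> Gamma0 P (f, z *\<^sub>C f) = c"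
    using ker_B_max_backward(1,2)[OF assms(1) _ f] unfolding ker_rel_def by blast
qed

lemma gamma_eq:
  assumes "z \<in> res_L P" "z \<in> matrix_res Dh"
  shows "\<gamma> z c = resolv P z (hs m c) + hs m (N z *v c)"
  unfolding gamma_field_def ker_B_max_iff[OF assms] by simp

section \<open>Coordinate formulas, the Weyl function and analyticity\<close>

lemma resolv_sum:
  assumes z: "z \<in> res_L P" and w: "\<And>i. i \<in> I \<Longrightarrow> w i \<in> H n"
  shows "resolv P z (sum w I) = (\<Sum>i\<in>I. resolv P z (w i))"
  using w
proof (induction I rule: infinite_finite_induct)
  case (insert i I)
  then show ?case by (simp add: resolv_add[OF z, of _ n] H.sum_mem)
qed (use resolv_scale[OF z, of 0 n 0] in auto)

lemma resolv_hs:
  assumes z: "z \<in> res_L P"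
  shows "resolv P z (hs j c) = (\<Sum>\<tau>\<in>UNIV. (c $ \<tau>) *\<^sub>C resolv P z (h \<tau> j))"
  unfolding hsum_def by (subst resolv_sum[OF z H.scale_mem[OF h_mem]]) (simp add: resolv_scale[OF z h_mem])

lemma resolv_resolv_hs:
  assumes z: "z \<in> res_L P"
  shows "resolv P z (resolv P z (hs j c)) = (\<Sum>\<tau>\<in>UNIV. (c $ \<tau>) *\<^sub>C resolv P z (resolv P z (h \<tau> j)))"
  unfolding resolv_hs[OF z]
  by (subst resolv_sum[OF z H.scale_mem[OF resolv_mem[OF z h_mem]]])
    (simp add: resolv_scale[OF z resolv_mem[OF z h_mem]])

lemma phi_vec_sum:
  "(\<And>i. i \<in> I \<Longrightarrow> w i \<in> H (int m + 2)) \<Longrightarrow> phi_vec P (sum w I) = (\<Sum>i\<in>I. phi_vec P (w i))"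
proof (induction I rule: infinite_finite_induct)
  case (insert i I)
  then show ?case by (simp add: phi_vec_add H.sum_mem)
qed auto

lemma weyl_eq:
  assumes z: "z \<in> res_L P" "z \<in> matrix_res Dh"
  shows "W z = (*v) (q_fun P z + r_hat P z)"
proof
  fix c
  let ?x = "N z *v c"
  have rm: "resolv P z (h \<tau> (m + 1)) \<in> H (int m + 2)" for \<tau> by (rule resolv_mem[OF z(1) h_top_mem])
  have "phi_vec P (resolv P z (hs (m + 1) c)) = (\<Sum>\<tau>\<in>UNIV. (c $ \<tau>) *s phi_vec P (resolv P z (h \<tau> (m + 1))))"
    unfolding resolv_hs[OF z(1)] using rm by (subst phi_vec_sum) (simp_all add: phi_vec_scale)
  then have q: "(z - z1c P) *s phi_vec P (resolv P z (hs (m + 1) c)) = q_fun P z *v c"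
    by (simp only: vec_eq_iff vector_smult_component)
      (simp add: q_fun_def phi_vec_def matrix_vector_mult_def sum_distrib_left mult_ac)
  have "W z c = q_fun P z *v c - G_min P *v ?x"
    unfolding weyl_function_def gamma_eq[OF z] q[symmetric]
    using N_iff[OF z(2), of ?x c] by (intro ker_B_max_backward(3)[OF z(1)]) simp_all
  moreover have "- (G_min P *v ?x) = r_hat P z *v c"
    using matrix_vector_mult_diff_distrib[of "G_min P" 0 "matrix_inv (Dh - mat z) *v c"]
    by (simp add: N_invertible(2)[OF z(2)] r_hat_def flip: matrix_vector_mul_assoc)
  ultimately show "W z c = (q_fun P z + r_hat P z) *v c"
    by (simp add: matrix_vector_mult_add_rdistrib)
qed

text \<open>The functional acts on \<open>H (m + 2)\<close>, where no expansion of the resolvent is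
  available. Writing it as an inner product in \<open>H m\<close> with \<open>A\<close> of the
  resolvent vector, and \<open>A\<close> as \<open>L - z\<close> plus \<open>z - z1\<close>, leaves
  only a matrix element of the resolvent in \<open>H m\<close>.\<close>

lemma q_fun_holomorphic: "(\<lambda>z. q_fun P z $ \<sigma> $ \<tau>) holomorphic_on res_L P"
proof -
  let ?F = "\<lambda>z. ipm (h \<sigma> (m + 1)) (resolv P z (h \<tau> (m + 1)))"
  have hm: "h \<tau> (m + 1) \<in> H (int m - 2)" using H_mono[of "int m - 2" "int m"] h_top_mem by auto
  have rm: "resolv P z g \<in> H (int m)" if "z \<in> res_L P" "g \<in> H (int m)" for z g
    using resolv_mem[OF that] H_add2 by blast
  have "?F field_differentiable at z" if z: "z \<in> res_L P" for z
  proof -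
    obtain C \<delta> where C: "C \<ge> 0" "\<delta> > 0" and est: "\<And>w g. w \<in> res_L P \<Longrightarrow> cmod (w - z) < \<delta> \<Longrightarrow> g \<in> H (int m - 2) \<Longrightarrow>
      nrm (resolv P w g - resolv P z g - (w - z) *\<^sub>C resolv P z (resolv P z g))
        \<le> C * (cmod (w - z))\<^sup>2 * nrm (resolv P z g)"
      using resolv_expansion[OF z, of m] by blast
    let ?g = "h \<tau> (m + 1)"
    let ?K = "nrm (h \<sigma> (m + 1)) * (C * nrm (resolv P z ?g))"
    show ?thesis
    proof (rule field_differentiable_quadratic_remainder[OF open_res z C(2)])
      show "0 \<le> ?K" using C(1) h_top_mem rm[OF z h_top_mem] by (intro mult_nonneg_nonneg) auto
      fix w assume w: "w \<in> res_L P" "cmod (w - z) < \<delta>"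
      note mem = h_top_mem rm[OF z h_top_mem] rm[OF w(1) h_top_mem] rm[OF z rm[OF z h_top_mem]]
      let ?u = "resolv P w ?g - resolv P z ?g - (w - z) *\<^sub>C resolv P z (resolv P z ?g)"
      have eq: "?F w - ?F z - (w - z) * ipm (h \<sigma> (m + 1)) (resolv P z (resolv P z ?g)) = ipm (h \<sigma> (m + 1)) ?u"
        using mem by (simp only: H.ip_diff_right[OF h_top_mem] H.ip_scale_right[OF h_top_mem]
            H.diff_mem H.scale_mem)
      have "cmod (ipm (h \<sigma> (m + 1)) ?u) \<le> nrm (h \<sigma> (m + 1)) * nrm ?u"
        using mem by (intro H.Cauchy_Schwarz H.diff_mem H.scale_mem)
      also have "\<dots> \<le> nrm (h \<sigma> (m + 1)) * (C * (cmod (w - z))\<^sup>2 * nrm (resolv P z ?g))"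
        using est[OF w hm] h_top_mem by (intro mult_left_mono H.norm_nonneg)
      finally show "cmod (?F w - ?F z - (w - z) * ipm (h \<sigma> (m + 1)) (resolv P z (resolv P z ?g)))
          \<le> ?K * (cmod (w - z))\<^sup>2" unfolding eq by (simp add: mult_ac)
    qed
  qed
  then have F: "?F holomorphic_on res_L P"
    unfolding holomorphic_on_def using field_differentiable_at_within by blast
  have eq: "q_fun P z $ \<sigma> $ \<tau> = (z - z1c P) * (ipm (h \<sigma> (m + 1)) (h \<tau> (m + 1)) + (z - z1c P) * ?F z)"
    if z: "z \<in> res_L P" for z
  proof -
    let ?r = "resolv P z (h \<tau> (m + 1))"
    have "A ?r = (L ?r - z *\<^sub>C ?r) + (z - z1c P) *\<^sub>C ?r"
      by (simp add: A_def complex_vector.scale_left_diff_distrib)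
    then have "A ?r = h \<tau> (m + 1) + (z - z1c P) *\<^sub>C ?r" unfolding shift_resolv[OF z h_top_mem] .
    then have "phi_vec P ?r $ \<sigma> = ipm (h \<sigma> (m + 1)) (h \<tau> (m + 1)) + (z - z1c P) * ?F z"
      unfolding phi_vec_eq[OF resolv_mem[OF z h_top_mem]]
      using rm[OF z h_top_mem] by (simp add: H.ip_add_right[OF h_top_mem h_top_mem] H.ip_scale_right[OF h_top_mem] del: One_nat_def add_Suc_right)
    then show ?thesis by (simp add: q_fun_def phi_vec_def)
  qed
  show ?thesis
    by (rule holomorphic_transform[OF _ eq[symmetric]]) (intro holomorphic_intros F)
qed

lemma q_plus_r_holomorphic:
  "(\<lambda>z. (q_fun P z + r_hat P z) $ \<sigma> $ \<tau>) holomorphic_on res_L P \<inter> matrix_res Dh"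
proof -
  have "(\<lambda>z. q_fun P z $ \<sigma> $ \<tau> + (\<Sum>k\<in>UNIV. G_min P $ \<sigma> $ k * matrix_inv (Dh - mat z) $ k $ \<tau>))
      holomorphic_on res_L P \<inter> matrix_res Dh"
    by (intro holomorphic_intros holomorphic_on_subset[OF q_fun_holomorphic]
        holomorphic_on_subset[OF matrix_inv_entry_holomorphic]) auto
  then show ?thesis by (simp add: r_hat_def matrix_matrix_mult_def)
qed

lemma weyl_bounded_analytic: "bounded_analytic_on (*s) UNIV norm W (res_L P \<inter> matrix_res Dh)"
  by (rule bounded_analytic_matrix[OF _ _ q_plus_r_holomorphic])
    (auto simp: open_res open_matrix_res weyl_eq)

lemma norm_combination_le:
  assumes w: "\<And>\<tau>. w \<tau> \<in> H (int m)"
  shows "nrm (\<Sum>\<tau>\<in>UNIV. (c $ \<tau>) *\<^sub>C w \<tau>) \<le> (\<Sum>\<tau>\<in>UNIV. nrm (w \<tau>)) * norm (c::complex^'s)"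
proof -
  have "nrm (\<Sum>\<tau>\<in>UNIV. (c $ \<tau>) *\<^sub>C w \<tau>) \<le> (\<Sum>\<tau>\<in>UNIV. nrm ((c $ \<tau>) *\<^sub>C w \<tau>))"
    using w by (intro H.norm_sum_le) simp
  also have "\<dots> \<le> (\<Sum>\<tau>\<in>UNIV. norm c * nrm (w \<tau>))"
    using w by (intro sum_mono) (simp add: H.norm_scale mult_right_mono Finite_Cartesian_Product.norm_nth_le)
  finally show ?thesis by (simp add: sum_distrib_left mult.commute)
qed

text \<open>Both the values of the \<open>\<gamma>\<close>-field and its derivative have this shape,
  with different vectors \<open>w\<close> and matrices \<open>B\<close>.\<close>

lemma bounded_operator_combination:
  assumes w: "\<And>\<tau>. w \<tau> \<in> H (int m)"
  shows "bounded_operator (*\<^sub>C) (H_A P) (norm_A P)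
    (\<lambda>c::complex^'s. (\<Sum>\<tau>\<in>UNIV. (c $ \<tau>) *\<^sub>C w \<tau>) + hs m (B *v c))"
  unfolding bounded_operator_def
proof (intro conjI)
  show "Vector_Spaces.linear (*s) (*\<^sub>C) (\<lambda>c. (\<Sum>\<tau>\<in>UNIV. (c $ \<tau>) *\<^sub>C w \<tau>) + hs m (B *v c))"
    by unfold_locales (simp_all add: scaleC_add_left scaleC_add_right sum.distrib matrix_vector_right_distrib
        hs_add hs_scale vector_scalar_commute complex_vector.scale_sum_right scaleC_scaleC algebra_simps)
  have mem: "(\<Sum>\<tau>\<in>UNIV. (c $ \<tau>) *\<^sub>C w \<tau>) \<in> H (int m)" for c :: "complex^'s"
    using w by (intro H.sum_mem) simp
  show "range (\<lambda>c. (\<Sum>\<tau>\<in>UNIV. (c $ \<tau>) *\<^sub>C w \<tau>) + hs m (B *v c)) \<subseteq> H_A P"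
    using H_A_mem[OF mem] by (auto simp flip: ksum_eta)
  obtain K where K: "\<And>c. norm (B *v c) \<le> K * norm c"
    using bounded_operator_matrix[of B] unfolding bounded_operator_def by blast
  have "norm_A P ((\<Sum>\<tau>\<in>UNIV. (c $ \<tau>) *\<^sub>C w \<tau>) + hs m (B *v c)) \<le>
      ((\<Sum>\<tau>\<in>UNIV. nrm (w \<tau>)) + real CARD('s) * K) * norm c" for c
  proof -
    have "norm_A P ((\<Sum>\<tau>\<in>UNIV. (c $ \<tau>) *\<^sub>C w \<tau>) + hs m (B *v c)) \<le>
        nrm (\<Sum>\<tau>\<in>UNIV. (c $ \<tau>) *\<^sub>C w \<tau>) + real CARD('s) * norm (B *v c)"
      using mem by (rule norm_A_eta_le)
    also have "\<dots> \<le> (\<Sum>\<tau>\<in>UNIV. nrm (w \<tau>)) * norm c + real CARD('s) * (K * norm c)"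
      using norm_combination_le[OF w] K by (intro add_mono mult_left_mono) auto
    finally show ?thesis by (simp add: algebra_simps)
  qed
  then show "\<exists>C. \<forall>c. norm_A P ((\<Sum>\<tau>\<in>UNIV. (c $ \<tau>) *\<^sub>C w \<tau>) + hs m (B *v c)) \<le> C * norm c" by blast
qed

text \<open>Regular and singular parts are differentiated separately, the former by
  \<open>resolv_expansion\<close>, the latter by analyticity of \<open>N\<close>, and each error
  receives half of \<open>e\<close>.\<close>

lemma gamma_bounded_analytic:
  "bounded_analytic_on (*\<^sub>C) (H_A P) (norm_A P) \<gamma> (res_L P \<inter> matrix_res Dh)"
  unfolding bounded_analytic_on_def
proof (intro conjI ballI)
  show "open (res_L P \<inter> matrix_res Dh)" using open_res open_matrix_res by auto
next
  fix z assume z: "z \<in> res_L P \<inter> matrix_res Dh"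
  then have z1: "z \<in> res_L P" and z2: "z \<in> matrix_res Dh" by auto
  have rm: "resolv P w (h \<tau> m) \<in> H (int m)" if "w \<in> res_L P" for w \<tau>
    using resolv_mem[OF that h_mem, of \<tau> m] by simp
  have rrm: "resolv P z (resolv P z (h \<tau> m)) \<in> H (int m)" for \<tau>
    using resolv_mem[OF z1 rm[OF z1]] H_add2 by blast
  have gam: "\<gamma> w = (\<lambda>c. (\<Sum>\<tau>\<in>UNIV. (c $ \<tau>) *\<^sub>C resolv P w (h \<tau> m)) + hs m (N w *v c))"
    if "w \<in> res_L P \<inter> matrix_res Dh" for w
    using that gamma_eq resolv_hs by auto
  show "bounded_operator (*\<^sub>C) (H_A P) (norm_A P) (\<gamma> z)"
    unfolding gam[OF z] using rm[OF z1] by (rule bounded_operator_combination)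
  have "(\<lambda>z. N z $ \<sigma> $ \<tau>) holomorphic_on matrix_res Dh" for \<sigma> \<tau>
  proof (rule holomorphic_transform)
    show "(\<lambda>z. - (matrix_inv (Dh - mat z) $ \<sigma> $ \<tau>)) holomorphic_on matrix_res Dh"
      by (intro holomorphic_on_minus matrix_inv_entry_holomorphic)
    show "- (matrix_inv (Dh - mat z) $ \<sigma> $ \<tau>) = N z $ \<sigma> $ \<tau>" if "z \<in> matrix_res Dh" for z
      using arg_cong[OF N_invertible(2)[OF that, of "axis \<tau> 1"], of "\<lambda>v. v $ \<sigma>"]
      by (simp add: matrix_vector_mult_axis)
  qed
  then have "bounded_analytic_on (*s) UNIV norm (\<lambda>z. (*v) (N z)) (matrix_res Dh)"
    by (rule bounded_analytic_matrix[OF open_matrix_res refl])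
  then obtain D where "bounded_operator (*s) UNIV norm D" and
    Dest: "\<And>e. e > 0 \<Longrightarrow> \<exists>\<delta>>0. \<forall>w\<in>matrix_res Dh. cmod (w - z) < \<delta> \<longrightarrow>
      (\<forall>c. norm (N w *v c - N z *v c - (w - z) *s D c) \<le> e * cmod (w - z) * norm c)"
    using z2 unfolding bounded_analytic_on_def by blast
  then have "D c = matrix D *v c" for c unfolding bounded_operator_def by (simp add: matrix_works)
  \<comment> \<open>The derivative of the resolvent is its square, and \<open>D\<close> is the
    derivative of \<open>N\<close> at \<open>z\<close>.\<close>
  define D' where "D' c = (\<Sum>\<tau>\<in>UNIV. (c $ \<tau>) *\<^sub>C resolv P z (resolv P z (h \<tau> m))) + hs m (matrix D *v c)" for c
  have "bounded_operator (*\<^sub>C) (H_A P) (norm_A P) D'"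
    unfolding D'_def using rrm by (rule bounded_operator_combination)
  moreover have "\<exists>\<delta>>0. \<forall>w\<in>res_L P \<inter> matrix_res Dh. cmod (w - z) < \<delta> \<longrightarrow>
      (\<forall>c. norm_A P (\<gamma> w c - \<gamma> z c - (w - z) *\<^sub>C D' c) \<le> e * cmod (w - z) * norm c)"
    if e: "e > 0" for e
  proof -
    obtain C \<delta>1 where C: "C \<ge> 0" "\<delta>1 > 0" and est: "\<And>w g. w \<in> res_L P \<Longrightarrow> cmod (w - z) < \<delta>1 \<Longrightarrow> g \<in> H (int m - 2) \<Longrightarrow>
      nrm (resolv P w g - resolv P z g - (w - z) *\<^sub>C resolv P z (resolv P z g))
        \<le> C * (cmod (w - z))\<^sup>2 * nrm (resolv P z g)"
      using resolv_expansion[OF z1, of m] by blast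
    define K where "K = (\<Sum>\<tau>\<in>UNIV. nrm (resolv P z (h \<tau> m)))"
    have K: "K \<ge> 0" unfolding K_def using rm[OF z1] by (intro sum_nonneg) auto
    have CK: "C * K \<ge> 0" using C(1) K by simp
    define e2 where "e2 = e / (2 * real CARD('s))"
    have e2: "e2 > 0" using e by (simp add: e2_def)
    obtain \<delta>2 where \<delta>2: "\<delta>2 > 0" "\<And>w c. w \<in> matrix_res Dh \<Longrightarrow> cmod (w - z) < \<delta>2 \<Longrightarrow>
        norm (N w *v c - N z *v c - (w - z) *s D c) \<le> e2 * cmod (w - z) * norm c"
      using Dest[OF e2] by blast
    \<comment> \<open>The last bound turns the quadratic error with constant \<open>C * K\<close>
      into at most \<open>e / 2\<close> times the increment; the added 1 covers
      \<open>C * K = 0\<close>.\<close>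
    define \<delta> where "\<delta> = min (min \<delta>1 \<delta>2) (e / (2 * (C * K + 1)))"
    have "norm_A P (\<gamma> w c - \<gamma> z c - (w - z) *\<^sub>C D' c) \<le> e * cmod (w - z) * norm c"
      if w: "w \<in> res_L P \<inter> matrix_res Dh" "cmod (w - z) < \<delta>" for w c
    proof -
      have w1: "w \<in> res_L P" and w2: "w \<in> matrix_res Dh" using w by auto
      define g where "g = hs m c"
      have g: "g \<in> H (int m - 2)" by (simp add: g_def hs_m_mem)
      have gz: "resolv P z g \<in> H (int m)" "resolv P w g \<in> H (int m)"
        using resolv_mem[OF z1 g] resolv_mem[OF w1 g] by simp_all
      then have gzz: "resolv P z (resolv P z g) \<in> H (int m)" using resolv_mem[OF z1] H_add2 by blast
      define u where "u = resolv P w g - resolv P z g - (w - z) *\<^sub>C resolv P z (resolv P z g)"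
      define v where "v = N w *v c - N z *v c - (w - z) *s D c"
      have u: "u \<in> H (int m)" using gz gzz by (simp add: u_def)
      have D'c: "D' c = resolv P z (resolv P z g) + hs m (D c)"
        unfolding D'_def g_def resolv_resolv_hs[OF z1] using \<open>\<And>c. D c = matrix D *v c\<close> by metis
      have "\<gamma> w c - \<gamma> z c - (w - z) *\<^sub>C D' c = u + hs m v"
        unfolding gamma_eq[OF z1 z2] gamma_eq[OF w1 w2] D'c u_def v_def g_def hs_diff hs_scale scaleC_add_right
        by (simp add: algebra_simps)
      then have "norm_A P (\<gamma> w c - \<gamma> z c - (w - z) *\<^sub>C D' c) \<le> nrm u + real CARD('s) * norm v"
        using norm_A_eta_le[OF u, of v] by simp
      also have "nrm u \<le> e / 2 * cmod (w - z) * norm c"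
      proof -
        have "nrm (resolv P z g) \<le> K * norm c"
          unfolding g_def resolv_hs[OF z1] K_def using rm[OF z1] by (rule norm_combination_le)
        then have "nrm u \<le> C * (cmod (w - z))\<^sup>2 * (K * norm c)"
          using est[OF w1 _ g] w(2) C(1) unfolding u_def \<delta>_def
          by (smt (verit) min_less_iff_conj mult_left_mono zero_le_mult_iff zero_le_power2)
        also have "\<dots> = (C * K * cmod (w - z)) * (cmod (w - z) * norm c)"
          by (simp add: power2_eq_square mult_ac)
        also have "\<dots> \<le> e / 2 * (cmod (w - z) * norm c)"
        proof (rule mult_right_mono)
          have "C * K * cmod (w - z) \<le> (C * K + 1) * (e / (2 * (C * K + 1)))"
            using w(2) CK by (intro mult_mono) (auto simp: \<delta>_def)
          also have "\<dots> = e / 2" using CK by (simp add: field_simps)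
          finally show "C * K * cmod (w - z) \<le> e / 2" .
        qed simp
        finally show ?thesis by (simp add: mult_ac)
      qed
      also have "real CARD('s) * norm v \<le> real CARD('s) * (e2 * cmod (w - z) * norm c)"
        unfolding v_def using w(2) by (intro mult_left_mono \<delta>2(2)[OF w2]) (auto simp: \<delta>_def)
      also have "\<dots> = e / 2 * cmod (w - z) * norm c" by (simp add: e2_def)
      finally show ?thesis by (simp add: algebra_simps)
    qed
    moreover have "\<delta> > 0" using C \<delta>2(1) e CK by (simp add: \<delta>_def)
    ultimately show ?thesis by blast
  qed
  ultimately show "\<exists>D. bounded_operator (*\<^sub>C) (H_A P) (norm_A P) D \<and>
      (\<forall>e>0. \<exists>\<delta>>0. \<forall>w\<in>res_L P \<inter> matrix_res Dh. cmod (w - z) < \<delta> \<longrightarrow>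
        (\<forall>c. norm_A P (\<gamma> w c - \<gamma> z c - (w - z) *\<^sub>C D c) \<le> e * cmod (w - z) * norm c))"
    by blast
qed

text \<open>\<open>Dh\<close> is symmetric for the inner product defined by \<open>G_min\<close>: an
  eigenvalue would be a quotient of the real number \<open>cdot x (Delta P *v x)\<close> by a
  positive one.\<close>

lemma nonreal_in_matrix_res:
  assumes "Im z \<noteq> 0"
  shows "z \<in> matrix_res Dh"
  unfolding matrix_res_def mem_Collect_eq invertible_iff_ker
proof (intro allI impI)
  fix x assume "(Dh - mat z) *v x = 0"
  then have "Dh *v x = z *s x" by (simp add: matrix_vector_mult_diff_rdistrib mat_mult_vec)
  then have "Delta P *v x = z *s (G_min P *v x)"
    using G_min_Delta_hat[of x] by (simp add: vector_scalar_commute)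
  then have eq: "cdot x (Delta P *v x) = z * cdot x (G_min P *v x)" by (simp add: cdot_scale_right)
  have "cdot x (Delta P *v x) = cnj (cdot x (Delta P *v x))"
    using cdot_Delta[of x x] cdot_commute[of "Delta P *v x" x] by simp
  then have "Im (cdot x (Delta P *v x)) = 0" by (metis Reals_cnj_iff complex_is_Real_iff)
  then show "x = 0"
    using eq assms G_min_positive unfolding positive_definite_def by force
qed

section \<open>The Nevanlinna property\<close>

lemma gamma_in_B_max:
  assumes "z \<in> res_L P" "z \<in> matrix_res Dh"
  shows "(\<gamma> z c, z *\<^sub>C \<gamma> z c) \<in> B_max P" "Gamma0 P (\<gamma> z c, z *\<^sub>C \<gamma> z c) = c"
    "Gamma1 P (\<gamma> z c, z *\<^sub>C \<gamma> z c) = W z c"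
  using ker_B_max_iff[OF assms, of "\<gamma> z c" c] gamma_eq[OF assms] unfolding ker_rel_def weyl_function_def by auto

text \<open>Two independent points are allowed so that \<open>w = cnj z\<close> yields the symmetry
  of the Weyl function and \<open>w = z\<close> its imaginary part.\<close>

lemma weyl_identity:
  assumes z: "z \<in> res_L P" "z \<in> matrix_res Dh" and w: "w \<in> res_L P" "w \<in> matrix_res Dh"
  shows "(w - cnj z) * ip_A P (\<gamma> z c) (\<gamma> w e) = cdot c (W w e) - cdot (W z c) e"
proof -
  note gz = gamma_in_B_max[OF z, of c] and gw = gamma_in_B_max[OF w, of e]
  have mem: "\<gamma> z c \<in> H_A P" "\<gamma> w e \<in> H_A P" using B_max_H_A gz(1) gw(1) by blast+
  show ?thesis
    using Green_identity[OF gz(1) gw(1)] gz gw ip_A_lin_right[OF mem(1) mem(2) mem(2), of w 0]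
      ip_A_lin_left[OF mem(2) mem(1) mem(1), of z 0] by (simp add: algebra_simps)
qed

text \<open>The vector lies in \<open>H_min\<close>, where the form is positive. The singular part
  alone gives strictness, since \<open>N z *v c\<close> is nonzero for nonzero
  \<open>c\<close>.\<close>

lemma gamma_definite:
  assumes z: "z \<in> res_L P" "z \<in> matrix_res Dh" and c: "c \<noteq> 0"
  shows "Im (ip_A P (\<gamma> z c) (\<gamma> z c)) = 0" "0 < Re (ip_A P (\<gamma> z c) (\<gamma> z c))"
proof -
  define x where "x = N z *v c"
  have "(mat z - Dh) *v x = c" using N_iff[OF z(2), of x c] by (simp add: x_def)
  then have "x \<noteq> 0" using c by auto
  then have x: "Im (cdot x (G_min P *v x)) = 0" "0 < Re (cdot x (G_min P *v x))"
    using G_min_positive unfolding positive_definite_def by auto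
  define r where "r = resolv P z (hs m c)"
  have r: "r \<in> H (int m)" using resolv_mem[OF z(1) hs_m_mem] by (simp add: r_def)
  have g: "\<gamma> z c = r + ksum (eta P x)" by (simp add: gamma_eq[OF z] r_def x_def ksum_eta)
  have "ip_A P (\<gamma> z c) (\<gamma> z c) = ipm r r + cdot x (G_min P *v x)"
    unfolding g ip_A_eq[OF r r] gf_eta top_row_eta ..
  then show "Im (ip_A P (\<gamma> z c) (\<gamma> z c)) = 0" "0 < Re (ip_A P (\<gamma> z c) (\<gamma> z c))"
    using x H.ip_self[OF r] by (auto intro: add_nonneg_pos)
qed

lemma nonreal_resolvent:
  assumes "z \<notin> \<real>"
  shows "z \<in> res_L P" and "z \<in> matrix_res Dh"
  using assms nonreal_in_res nonreal_in_matrix_res by (auto simp: complex_is_Real_iff)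

text \<open>The quotient of the imaginary parts is the Gram matrix of the
  \<open>\<gamma>\<close>-field at \<open>z\<close>: its quadratic form at \<open>c\<close> is
  \<open>ip_A P (\<gamma> z c) (\<gamma> z c)\<close>.\<close>

lemma weyl_nevanlinna: "uniformly_strict_nevanlinna (\<lambda>z. matrix (W z))"
  unfolding uniformly_strict_nevanlinna_def
proof (intro conjI allI impI)
  have mat: "matrix (W z) = q_fun P z + r_hat P z" if "z \<notin> \<real>" for z
    by (simp add: weyl_eq nonreal_resolvent that)
  fix \<sigma> \<tau>
  have "(\<lambda>z. matrix (W z) $ \<sigma> $ \<tau>) holomorphic_on - \<real>"
  proof (rule holomorphic_transform)
    show "(\<lambda>z. (q_fun P z + r_hat P z) $ \<sigma> $ \<tau>) holomorphic_on - \<real>"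
      by (rule holomorphic_on_subset[OF q_plus_r_holomorphic]) (use nonreal_resolvent in auto)
  qed (simp add: mat)
  then show "(\<lambda>z. matrix (W z) $ \<sigma> $ \<tau>) analytic_on - \<real>"
    by (simp add: analytic_on_open open_Compl closed_complex_Reals)
next
  fix z :: complex assume z: "z \<notin> \<real>"
  have cz: "cnj z \<notin> \<real>" using z by (simp add: complex_is_Real_iff)
  have mv: "matrix (W w) *v c = W w c" if "w \<notin> \<real>" for w c
    by (simp add: weyl_eq nonreal_resolvent that)
  show "cadj (matrix (W z)) = matrix (W (cnj z))"
    unfolding matrix_eq
  proof (intro allI cdot_eqI)
    fix e c
    have "cdot c (cadj (matrix (W z)) *v e) = cdot (matrix (W z) *v c) e"
      using cdot_matrix_vector[of e "matrix (W z)" c] cdot_commute[of "matrix (W z) *v c" e]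
        cdot_commute[of c "cadj (matrix (W z)) *v e"] by simp
    then show "cdot c (cadj (matrix (W z)) *v e) = cdot c (matrix (W (cnj z)) *v e)"
      using weyl_identity[OF nonreal_resolvent[OF z] nonreal_resolvent[OF cz], of c e] by (simp add: mv z cz)
  qed
  show "positive_definite (\<chi> \<sigma> \<tau>. (matrix (W z) - cadj (matrix (W z))) $ \<sigma> $ \<tau> / (2 * \<i>) / complex_of_real (Im z))"
    (is "positive_definite ?Q")
    unfolding positive_definite_def
  proof (intro allI impI)
    fix c :: "complex^'s" assume c: "c \<noteq> 0"
    let ?M = "matrix (W z)"
    have Im: "Im z \<noteq> 0" using z by (simp add: complex_is_Real_iff)
    have entry: "?Q $ \<sigma> $ \<tau> * c $ \<tau> = (1 / (2 * \<i> * Im z)) * ((?M - cadj ?M) $ \<sigma> $ \<tau> * c $ \<tau>)" for \<sigma> \<tau>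
      by (simp only: vec_lambda_beta divide_divide_eq_left times_divide_eq_left mult_1)
    have "?Q *v c = (1 / (2 * \<i> * Im z)) *s ((?M - cadj ?M) *v c)"
      unfolding vec_eq_iff vector_smult_component matrix_vector_mult_def
      by (simp only: vec_lambda_beta[of "\<lambda>i. \<Sum>j\<in>UNIV. _ i j"] sum_distrib_left entry simp_thms)
    then have "cdot c (?Q *v c) = (cdot c (?M *v c) - cdot c (cadj ?M *v c)) / (2 * \<i> * Im z)"
      by (simp only: cdot_scale_right matrix_vector_mult_diff_rdistrib cdot_diff_right
          times_divide_eq_left mult_1)
    also have "cdot c (cadj ?M *v c) = cdot (?M *v c) c"
      using cdot_matrix_vector[of c ?M c] cdot_commute[of "?M *v c" c] cdot_commute[of c "cadj ?M *v c"] by simp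
    also have "cdot c (?M *v c) - cdot (?M *v c) c = (z - cnj z) * ip_A P (\<gamma> z c) (\<gamma> z c)"
      using weyl_identity[OF nonreal_resolvent[OF z] nonreal_resolvent[OF z], of c c] by (simp add: mv z)
    also have "z - cnj z = 2 * \<i> * Im z" by (simp add: complex_diff_cnj)
    finally have "cdot c (?Q *v c) = ip_A P (\<gamma> z c) (\<gamma> z c)" using Im by simp
    then show "Im (cdot c (?Q *v c)) = 0 \<and> 0 < Re (cdot c (?Q *v c))"
      using gamma_definite[OF nonreal_resolvent[OF z] c] by simp
  qed
qed

lemma ker_rel_eq:
  assumes "z \<in> res_L P" "z \<in> matrix_res Dh"
  shows "ker_rel (B_max P) z = range (\<gamma> z)"
    "ker_rel (B_max P) z = {resolv P z (hs m c) + hs m x | c x. x = N z *v c}"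
proof -
  show r: "ker_rel (B_max P) z = range (\<gamma> z)"
    using ker_B_max_iff[OF assms] gamma_eq[OF assms] by (auto simp: image_iff)
  show "ker_rel (B_max P) z = {resolv P z (hs m c) + hs m x | c x. x = N z *v c}"
    unfolding r using gamma_eq[OF assms] by (auto simp: image_iff)
qed

end

theorem theorem3p3:
  fixes P :: "('h::complex_vector, 's::finite) peak_data"
  assumes "hilbert_space (Hsp P 0) (ips P 0)"
    and "selfadjoint_op (Hsp P 0) (ips P 0) (Hsp P 2) (Lop P)"
    and "lower_semibounded (ips P 0) (Hsp P 2) (Lop P)"
    and "z1c P \<in> res_L P"
    and "\<And>\<mu>. \<mu> \<notin> res_L P \<Longrightarrow> z1 P < Re \<mu>"
    and "is_hilbert_scale P"
    and "1 \<le> mm P"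
    and "\<And>\<sigma>. phi P \<sigma> \<in> Hsp P (- int (mm P) - 2) - Hsp P (- int (mm P) - 1)"
    and "\<And>c :: complex^'s.
      (\<Sum>\<sigma>\<in>UNIV. (c $ \<sigma>) *\<^sub>C phi P \<sigma>) \<in> Hsp P (- int (mm P) - 1) \<Longrightarrow> c = 0"
    and "invertible_on (idx P) (Gram P)"
    and "hermitian_on (idx P) (Gram P)"
    and "\<And>\<sigma> \<tau>. 2 \<le> mm P \<Longrightarrow>
      Gram P (\<sigma>, mm P - 1) (\<tau>, mm P) = Gram P (\<sigma>, mm P) (\<tau>, mm P - 1)"
    and "positive_definite (G_min P)"
  shows
    \<comment> \<open>\<open>\<Gamma>'\<close> is well-defined on \<open>B_max\<close>\<close>
    "B_max P = {fh. \<exists>fs c x k' kp. B_repr P fh fs c x k' kp} \<and>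
     (\<forall>fh fs c x k' kp. B_repr P fh fs c x k' kp \<longrightarrow>
        Gamma0 P fh = c \<and> Gamma1 P fh = phi_vec P fs - G_min P *v x) \<and>
     boundary_triple (H_A P) (ip_A P) (B_min P) (B_max P) (Gamma0 P) (Gamma1 P) \<and>
     (\<forall>\<sigma> \<tau>. Delta P $ \<sigma> $ \<tau> =
        z1c P * G_min P $ \<sigma> $ \<tau> + (if 2 \<le> mm P then Gram P (\<sigma>, mm P - 1) (\<tau>, mm P) else 0)) \<and>
     cadj (Delta P) = Delta P \<and>
     (let \<gamma> = gamma_field (B_max P) (Gamma0 P);
          M = weyl_function (B_max P) (Gamma0 P) (Gamma1 P);
          \<Omega> = res_L P \<inter> matrix_res (Delta_hat P)
      in (\<forall>z\<in>\<Omega>. \<forall>c. \<exists>!f. f \<in> ker_rel (B_max P) z \<and> Gamma0 P (f, z *\<^sub>C f) = c) \<and>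
         bounded_analytic_on (*\<^sub>C) (H_A P) (norm_A P) \<gamma> \<Omega> \<and>
         bounded_analytic_on (*s) UNIV norm M \<Omega> \<and>
         (\<forall>z\<in>\<Omega>. range (\<gamma> z) = ker_rel (B_max P) z \<and>
            ker_rel (B_max P) z =
              {resolv P z (hsum P (mm P) c) + hsum P (mm P) x | c x.
                 x = matrix_inv (mat z - Delta_hat P) *v c} \<and>
            (\<forall>c. \<gamma> z c = resolv P z (hsum P (mm P) c) +
               hsum P (mm P) (matrix_inv (mat z - Delta_hat P) *v c)) \<and>
            matrix (M z) = q_fun P z + r_hat P z) \<and>
         uniformly_strict_nevanlinna (\<lambda>z. matrix (M z)))"
proof -
  interpret peak_model P
    using assms by unfold_locales auto
  have ex1: "\<exists>!f. f \<in> ker_rel (B_max P) z \<and> Gamma0 P (f, z *\<^sub>C f) = c"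
    if "z \<in> res_L P \<inter> matrix_res (Delta_hat P)" for z c
    using that by (simp add: ker_B_max_iff)
  have weyl: "matrix (W z) = q_fun P z + r_hat P z" if "z \<in> res_L P \<inter> matrix_res (Delta_hat P)" for z
    using that by (simp add: weyl_eq)
  show ?thesis
    unfolding Let_def
  proof (intro conjI allI impI ballI)
    fix z assume z: "z \<in> res_L P \<inter> matrix_res (Delta_hat P)"
    then have z': "z \<in> res_L P" "z \<in> matrix_res (Delta_hat P)" by auto
    show "range (\<gamma> z) = ker_rel (B_max P) z" by (rule ker_rel_eq(1)[OF z', symmetric])
    show "ker_rel (B_max P) z = {resolv P z (hsum P (mm P) c) + hsum P (mm P) x | c x.
        x = matrix_inv (mat z - Delta_hat P) *v c}"
      by (rule ker_rel_eq(2)[OF z'])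
    show "\<gamma> z c = resolv P z (hsum P (mm P) c) + hsum P (mm P) (matrix_inv (mat z - Delta_hat P) *v c)" for c
      by (rule gamma_eq[OF z'])
  next
    show "\<And>fh fs c x k' kp. B_repr P fh fs c x k' kp \<Longrightarrow> Gamma0 P fh = c"
      "\<And>fh fs c x k' kp. B_repr P fh fs c x k' kp \<Longrightarrow> Gamma1 P fh = phi_vec P fs - G_min P *v x"
      by (rule Gamma_eq, assumption)+
  qed (rule B_max_eq boundary_triple Delta_eq Delta_hermitian ex1 gamma_bounded_analytic
      weyl_bounded_analytic weyl weyl_nevanlinna; assumption)+
qed

end
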